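(* Let $U_0\in\mathcal{M}^N_{\geqslant}$, and define $$c_e=2\Big(\frac{\sqrt2E(U_0)}{\lambda_1}+c_\Omega^2\sqrt{E(U_0)\lambda_{\max}(\langle U_0,U_0\rangle)}\Big)\sqrt{NE(U_0)\lambda_{\max}(\langle U_0,U_0\rangle)}+\frac12.$$ Let $\{U_n\}$ be generated by the two-stage scheme with time steps satisfying, for all $n$, $$\tau_n<\min\Big(\frac{\lambda_1}{2c_e\lambda_{\max}(\langle U_0,U_0\rangle)},\ \frac{\lambda_1}{2\sqrt{2E(U_0)\lambda_{\max}(\langle U_0,U_0\rangle)}}\Big).$$ Then for all $n\geqslant0$, $$E(U_n)-E(U_{n+1})\geqslant\Big(\frac{\lambda_1}{2\lambda_{\max}(\langle U_0,U_0\rangle)}-c_e\tau_n\Big)\tau_n\|\mathcal{A}_{U_n}U_n\|_a^2.$$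
   Context: $\Omega\subset\mathbb{R}^d$ is a bounded domain, and $(\cdot,\cdot)$, $\|\cdot\|$ denote the $L^2(\Omega)$ inner product and norm. $\mathcal{V}:\Omega\to\mathbb{R}$ is a potential such that $a(u,v)=\int_\Omega(\nabla u\cdot\nabla v+\mathcal{V}uv)\,dx$ on $H_0^1(\Omega)$ is symmetric, bounded and coercive, with $c_1\|\nabla u\|^2\leqslant a(u,u)\leqslant c_2\|\nabla u\|^2$. $\|u\|_a=\sqrt{a(u,u)}$, and $c_\Omega>0$ is a constant with $\|u\|\leqslant c_\Omega\|u\|_a$ for all $u\in H_0^1(\Omega)$. $\lambda_1$ is the smallest eigenvalue of $a(u,v)=\lambda(u,v)$ for all $v$. $\mathcal{G}=(-\Delta+\mathcal{V})^{-1}$: $\mathcal{G}f\in H_0^1(\Omega)$ is the unique element with $a(\mathcal{G}f,v)=(f,v)$ for all $v\in H_0^1(\Omega)$. For $N$-tuples: - $\mathcal{G}U=(\mathcal{G}u_1,\dots,\mathcal{G}u_N)$; - $UA$ has $j$-th entry $\sum_iu_iA_{ij}$; - $\langle U,V\rangle=((u_i,v_j))_{i,j}$ and $\langle U,V\rangle_a=(a(u_i,v_j))_{i,j}$; - $\|U\|_a^2=\operatorname{tr}\langle U,U\rangle_a$. $E(U)=\frac12\|U\|_a^2$. $\lambda_{\max}$ denotes the largest eigenvalue. The quasi-Stiefel set is $\mathcal{M}^N_{\geqslant}=\{U:\langle U,U\rangle-I_N\text{ positive semidefinite}\}$. Define $\mathcal{A}_UV=\mathcal{G}U\langle U,V\rangle-U\langle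 U,\mathcal{G}V\rangle$. The two-stage scheme: given $U_n$ and $\tau_n>0$, $\hat U_{n+1}$ solves $$\hat U_{n+1}=U_n+\tau_n\mathcal{A}_{U_n}\Big(\tfrac{\hat U_{n+1}+U_n}{2}\Big),$$ and $$U_{n+1}=\hat U_{n+1}-\tau_n\mathcal{G}\hat U_{n+1}\big(\langle\hat U_{n+1},\hat U_{n+1}\rangle-I_N\big).$$ *)

theory Defs
  imports "HOL-Analysis.Analysis"
begin

text \<open>Abstract rendering of the setting. The type 'v plays the role of L2(Omega)
 (inner product and norm of real_inner), the set H plays the role of H_0^1(Omega),
 a is the bilinear form, G the solution operator. N-tuples are functions 'n => 'v
 with a finite index type 'n, so N = CARD('n). Gram matrices are real^'n^'n.\<close>

definition gram :: "('n::finite \<Rightarrow> 'v::real_inner) \<Rightarrow> ('n \<Rightarrow> 'v) \<Rightarrow> real^'n^'n" where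
  "gram U V = (\<chi> i j. inner (U i) (V j))"

definition gram_a :: "('v \<Rightarrow> 'v \<Rightarrow> real) \<Rightarrow> ('n::finite \<Rightarrow> 'v) \<Rightarrow> ('n \<Rightarrow> 'v) \<Rightarrow> real^'n^'n" where
  "gram_a a U V = (\<chi> i j. a (U i) (V j))"

definition tmul :: "('n::finite \<Rightarrow> 'v::real_vector) \<Rightarrow> real^'n^'n \<Rightarrow> ('n \<Rightarrow> 'v)" where
  "tmul U A = (\<lambda>j. \<Sum>i\<in>UNIV. (A $ i $ j) *\<^sub>R U i)"

definition tG :: "('v \<Rightarrow> 'v) \<Rightarrow> ('n \<Rightarrow> 'v) \<Rightarrow> ('n \<Rightarrow> 'v)" where
  "tG G U = (\<lambda>i. G (U i))"

definition mtrace :: "real^'n^'n \<Rightarrow> real" where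
  "mtrace M = (\<Sum>i\<in>UNIV. M $ i $ i)"

definition tnorm_a :: "('v \<Rightarrow> 'v \<Rightarrow> real) \<Rightarrow> ('n::finite \<Rightarrow> 'v) \<Rightarrow> real" where
  "tnorm_a a U = sqrt (mtrace (gram_a a U U))"

definition energy :: "('v \<Rightarrow> 'v \<Rightarrow> real) \<Rightarrow> ('n::finite \<Rightarrow> 'v) \<Rightarrow> real" where
  "energy a U = (1/2) * (tnorm_a a U)^2"

definition A_op :: "('v::real_inner \<Rightarrow> 'v) \<Rightarrow> ('n::finite \<Rightarrow> 'v) \<Rightarrow> ('n \<Rightarrow> 'v) \<Rightarrow> ('n \<Rightarrow> 'v)" where
  "A_op G U V = (\<lambda>j. tmul (tG G U) (gram U V) j - tmul U (gram U (tG G V)) j)"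

definition lambda_max :: "real^'n^'n \<Rightarrow> real" where
  "lambda_max M = Max {l. \<exists>x::real^'n. x \<noteq> 0 \<and> M *v x = l *\<^sub>R x}"

definition psd :: "real^'n^'n \<Rightarrow> bool" where
  "psd M \<longleftrightarrow> (\<forall>x::real^'n. 0 \<le> x \<bullet> (M *v x))"

definition quasi_stiefel :: "('n::finite \<Rightarrow> 'v::real_inner) \<Rightarrow> bool" where
  "quasi_stiefel U \<longleftrightarrow> psd (gram U U - mat 1)"

definition standing ::
  "'v::real_inner set \<Rightarrow> ('v \<Rightarrow> 'v \<Rightarrow> real) \<Rightarrow> ('v \<Rightarrow> 'v) \<Rightarrow> real \<Rightarrow> real \<Rightarrow> bool" where
  "standing H a G c\<Omega> lam1 \<longleftrightarrow>
     subspace H \<and>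
     (\<forall>u\<in>H. \<forall>v\<in>H. a u v = a v u) \<and>
     (\<forall>u\<in>H. \<forall>v\<in>H. \<forall>w\<in>H. \<forall>c. a (u + v) w = a u w + a v w \<and> a (c *\<^sub>R u) w = c * a u w) \<and>
     (\<forall>u\<in>H. 0 \<le> a u u) \<and>
     c\<Omega> > 0 \<and> (\<forall>u\<in>H. norm u \<le> c\<Omega> * sqrt (a u u)) \<and>
     \<comment> \<open>lambda1 is the smallest eigenvalue of a(u,v) = lambda (u,v)\<close>
     (\<exists>u\<in>H. u \<noteq> 0 \<and> (\<forall>v\<in>H. a u v = lam1 * inner u v)) \<and>
     (\<forall>\<mu>. \<forall>u\<in>H. u \<noteq> 0 \<and> (\<forall>v\<in>H. a u v = \<mu> * inner u v) \<longrightarrow> lam1 \<le> \<mu>) \<and>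
     \<comment> \<open>Rayleigh bound, true for the smallest eigenvalue in the concrete setting\<close>
     (\<forall>u\<in>H. lam1 * inner u u \<le> a u u) \<and>
     \<comment> \<open>G = (-Delta + V)^{-1}\<close>
     (\<forall>f. G f \<in> H \<and> (\<forall>v\<in>H. a (G f) v = inner f v))"

end

theory Submission
  imports Defs
begin

text \<open>The first stage is a Cayley step: it preserves Gram matrices, and the energy it dissipates is a trace over the skew
  operators built from \<open>\<langle>U, G U\<rangle>\<close> and \<open>\<langle>U, U\<rangle>\<close>, which controls \<open>\<parallel>A\<^sub>U U\<parallel>\<^sub>a\<^sup>2 / \<lambda>\<^sub>m\<^sub>a\<^sub>x\<close>. The second stage lowers the
  energy by about \<open>2 \<tau> (tr D + tr D\<^sup>2)\<close>, where \<open>D = \<langle>U, U\<rangle> - I\<close> is the defect. For \<open>N = 1\<close> the defect stays nonnegative, but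
  for \<open>N \<ge> 2\<close> the iterates may leave the quasi-Stiefel set. What persists is
  \<open>|D \<phi>|\<^sup>2 \<le> (\<lambda>\<^sub>m\<^sub>a\<^sub>x - 1) (\<phi> \<bullet> D \<phi> + c |(G - \<mu>) U \<phi>|\<^sup>2)\<close> for all \<open>\<phi>\<close> and \<open>0 \<le> \<mu> \<le> 1\<close>, with \<open>G\<close> scaled to norm one: where \<open>D\<close> is
  negative, \<open>U \<phi>\<close> is far from every eigenvector of \<open>G\<close>. The step reproduces this inequality because it damps \<open>D \<phi>\<close> and lets
  \<open>(G - \<mu>) U \<phi>\<close> grow. Taking for \<open>\<phi>\<close> the eigenvectors of \<open>\<langle>U, G U\<rangle>\<close> and for \<open>\<mu>\<close> the eigenvalues bounds \<open>tr D\<close> from below by a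
  part of the dissipation that the decay estimate does not need.\<close>

section \<open>Positive semidefinite forms\<close>

locale psd_form =
  fixes V :: "'a::real_vector set" and B :: "'a \<Rightarrow> 'a \<Rightarrow> real"
  assumes subspace_carrier: "subspace V"
    and sym: "v \<in> V \<Longrightarrow> w \<in> V \<Longrightarrow> B v w = B w v"
    and add_left: "v \<in> V \<Longrightarrow> w \<in> V \<Longrightarrow> z \<in> V \<Longrightarrow> B (v + w) z = B v z + B w z"
    and scale_left: "v \<in> V \<Longrightarrow> z \<in> V \<Longrightarrow> B (c *\<^sub>R v) z = c * B v z"
    and nonneg: "v \<in> V \<Longrightarrow> 0 \<le> B v v"
begin

lemma carrier_closed [simp, intro]:
  "v \<in> V \<Longrightarrow> w \<in> V \<Longrightarrow> v + w \<in> V" "v \<in> V \<Longrightarrow> w \<in> V \<Longrightarrow> v - w \<in> V"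
  "v \<in> V \<Longrightarrow> c *\<^sub>R v \<in> V" "0 \<in> V"
  using subspace_carrier by (auto simp: subspace_add subspace_diff subspace_scale subspace_0)

lemma sum_closed: "(\<And>i. i \<in> I \<Longrightarrow> f i \<in> V) \<Longrightarrow> sum f I \<in> V"
  using subspace_carrier by (simp add: subspace_sum)

lemma add_right: "v \<in> V \<Longrightarrow> w \<in> V \<Longrightarrow> z \<in> V \<Longrightarrow> B z (v + w) = B z v + B z w"
  by (metis carrier_closed(1) add_left sym)

lemma scale_right: "v \<in> V \<Longrightarrow> z \<in> V \<Longrightarrow> B z (c *\<^sub>R v) = c * B z v"
  by (metis carrier_closed(3) scale_left sym)

lemma diff_left: "v \<in> V \<Longrightarrow> w \<in> V \<Longrightarrow> z \<in> V \<Longrightarrow> B (v - w) z = B v z - B w z"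
  using add_left[of v "(-1) *\<^sub>R w" z] scale_left[of w z "-1"] carrier_closed(3)[of w "-1"] by simp

lemma diff_right: "v \<in> V \<Longrightarrow> w \<in> V \<Longrightarrow> z \<in> V \<Longrightarrow> B z (v - w) = B z v - B z w"
  by (metis carrier_closed(2) diff_left sym)

lemmas bilinear_simps = add_left add_right diff_left diff_right scale_left scale_right

lemma zero_left: "v \<in> V \<Longrightarrow> B 0 v = 0"
  using scale_left[of v v 0] by simp

lemma sum_left: "(\<And>i. i \<in> I \<Longrightarrow> f i \<in> V) \<Longrightarrow> v \<in> V \<Longrightarrow> B (sum f I) v = (\<Sum>i\<in>I. B (f i) v)"
  by (induction I rule: infinite_finite_induct) (auto simp: zero_left add_left sum_closed)

lemma cauchy_schwarz:
  assumes v: "v \<in> V" and w: "w \<in> V"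
  shows "(B v w)\<^sup>2 \<le> B v v * B w w"
proof -
  have expand: "B (s *\<^sub>R v - t *\<^sub>R w) (s *\<^sub>R v - t *\<^sub>R w) = s\<^sup>2 * B v v - 2 * s * t * B v w + t\<^sup>2 * B w w" for s t
    using v w by (simp add: bilinear_simps sym[of w v] power2_eq_square algebra_simps)
  have expand_nonneg: "0 \<le> s\<^sup>2 * B v v - 2 * s * t * B v w + t\<^sup>2 * B w w" for s t
    unfolding expand[symmetric] using v w by (intro nonneg) auto
  consider "0 < B w w" | "0 < B v v" | "B v v = 0" "B w w = 0"
    using nonneg[OF v] nonneg[OF w] by linarith
  then show ?thesis
  proof cases
    case 1
    have "0 \<le> B w w * (B v v * B w w - (B v w)\<^sup>2)"
      using expand_nonneg[of "B w w" "B v w"] by (simp add: power2_eq_square algebra_simps)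
    then show ?thesis using 1 by (simp add: zero_le_mult_iff)
  next
    case 2
    have "0 \<le> B v v * (B v v * B w w - (B v w)\<^sup>2)"
      using expand_nonneg[of "B v w" "B v v"] by (simp add: power2_eq_square algebra_simps)
    then show ?thesis using 2 by (simp add: zero_le_mult_iff)
  next
    case 3
    then show ?thesis using expand_nonneg[of 1 "B v w"] by (simp add: power2_eq_square)
  qed
qed

definition seminorm :: "'a \<Rightarrow> real" where
  "seminorm v = sqrt (B v v)"

lemma seminorm_nonneg: "v \<in> V \<Longrightarrow> 0 \<le> seminorm v"
  by (simp add: seminorm_def nonneg)

lemma seminorm_power2: "v \<in> V \<Longrightarrow> (seminorm v)\<^sup>2 = B v v"
  by (simp add: seminorm_def nonneg)

lemma abs_le_seminorm:
  assumes "v \<in> V" "w \<in> V"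
  shows "\<bar>B v w\<bar> \<le> seminorm v * seminorm w"
  using real_sqrt_le_mono[OF cauchy_schwarz[OF assms]] by (simp add: seminorm_def real_sqrt_mult)

lemma seminorm_scale: "v \<in> V \<Longrightarrow> seminorm (c *\<^sub>R v) = \<bar>c\<bar> * seminorm v"
  by (simp add: seminorm_def bilinear_simps real_sqrt_mult flip: mult.assoc)

lemma seminorm_add_le:
  assumes v: "v \<in> V" and w: "w \<in> V"
  shows "seminorm (v + w) \<le> seminorm v + seminorm w"
proof (rule power2_le_imp_le)
  have "(seminorm (v + w))\<^sup>2 = (seminorm v)\<^sup>2 + 2 * B v w + (seminorm w)\<^sup>2"
    using v w by (simp add: seminorm_power2 bilinear_simps sym[of w v])
  also have "\<dots> \<le> (seminorm v + seminorm w)\<^sup>2"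
    using abs_le_seminorm[OF v w] by (simp add: power2_sum)
  finally show "(seminorm (v + w))\<^sup>2 \<le> (seminorm v + seminorm w)\<^sup>2" .
qed (use v w seminorm_nonneg in simp)

lemma seminorm_diff_le: "v \<in> V \<Longrightarrow> w \<in> V \<Longrightarrow> seminorm (v - w) \<le> seminorm v + seminorm w"
  using seminorm_add_le[of v "(-1) *\<^sub>R w"] seminorm_scale[of w "-1"] carrier_closed(3)[of w "-1"] by simp

lemma symmetric_operator_bound:
  assumes lin: "linear f" and closed: "\<And>v. v \<in> V \<Longrightarrow> f v \<in> V"
    and symf: "\<And>v w. v \<in> V \<Longrightarrow> w \<in> V \<Longrightarrow> B (f v) w = B v (f w)"
    and m: "0 \<le> m" and bound: "\<And>v. v \<in> V \<Longrightarrow> \<bar>B v (f v)\<bar> \<le> m * B v v" and v: "v \<in> V"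
  shows "B (f v) (f v) \<le> m\<^sup>2 * B v v"
proof -
  have polarized: "2 * B w (f v) \<le> m * (B w w + B v v)" if w: "w \<in> V" for w
  proof -
    have "4 * B w (f v) = B (w + v) (f (w + v)) - B (w - v) (f (w - v))"
      using v w symf[OF v w] sym[OF closed[OF v] w]
      by (simp add: linear_add[OF lin] linear_diff[OF lin] bilinear_simps closed)
    also have "\<dots> \<le> m * B (w + v) (w + v) + m * B (w - v) (w - v)"
      using bound[of "w + v"] bound[of "w - v"] v w by (simp add: abs_le_iff)
    also have "\<dots> = 2 * (m * (B w w + B v v))"
      using v w by (simp add: bilinear_simps algebra_simps)
    finally show ?thesis by simp
  qed
  show ?thesis
  proof (cases "m = 0")
    case True
    then show ?thesis using polarized[OF closed[OF v]] by simp
  next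
    case False
    have "2 * B ((1 / m) *\<^sub>R f v) (f v) \<le> m * (B ((1 / m) *\<^sub>R f v) ((1 / m) *\<^sub>R f v) + B v v)"
      using closed[OF v] by (intro polarized) simp
    then have "2 * (B (f v) (f v) / m) \<le> B (f v) (f v) / m + m * B v v"
      using False closed[OF v] by (simp add: bilinear_simps distrib_left)
    then have "B (f v) (f v) / m \<le> m * B v v" by simp
    then show ?thesis using False m by (simp add: pos_divide_le_eq power2_eq_square mult_ac)
  qed
qed

end

lemma psd_form_operator:
  assumes "subspace V" "linear f" "\<And>v w. f v \<bullet> w = v \<bullet> f w" "\<And>v. v \<in> V \<Longrightarrow> 0 \<le> v \<bullet> f v"
  shows "psd_form V (\<lambda>v w. v \<bullet> f w)"
  using assms by unfold_locales (simp_all add: inner_add_left, metis inner_commute)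

lemma norm_symmetric_operator_le:
  fixes f :: "'a::real_inner \<Rightarrow> 'a"
  assumes "linear f" "\<And>v w. f v \<bullet> w = v \<bullet> f w" "0 \<le> m" "\<And>v. \<bar>v \<bullet> f v\<bar> \<le> m * (v \<bullet> v)"
  shows "norm (f v) \<le> m * norm v"
proof -
  interpret inner_form: psd_form "UNIV :: 'a set" "(\<bullet>)"
    using psd_form_operator[of UNIV "\<lambda>v::'a. v"] by (simp add: linear_iff)
  have "(norm (f v))\<^sup>2 \<le> (m * norm v)\<^sup>2"
    using inner_form.symmetric_operator_bound[of f m v] assms
    by (simp add: power2_norm_eq_inner power_mult_distrib)
  then show ?thesis using assms(3) by (rule power2_le_imp_le[OF _ mult_nonneg_nonneg]) simp
qed

lemma norm_psd_operator_power2_le: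
  fixes f :: "'a::real_inner \<Rightarrow> 'a"
  assumes lin: "linear f" and sym: "\<And>v w. f v \<bullet> w = v \<bullet> f w"
    and pos: "\<And>v. 0 \<le> v \<bullet> f v" and quadratic_le: "\<And>v. v \<bullet> f v \<le> m * (v \<bullet> v)" and m: "0 \<le> m"
  shows "(norm (f v))\<^sup>2 \<le> m * (v \<bullet> f v)"
proof (cases "f v = 0")
  case False
  interpret form: psd_form UNIV "\<lambda>v w. v \<bullet> f w"
    using lin sym pos by (intro psd_form_operator) auto
  have "(norm (f v))\<^sup>2 * (norm (f v))\<^sup>2 = (v \<bullet> f (f v))\<^sup>2"
    by (simp add: sym[of v "f v", symmetric] dot_square_norm power2_eq_square)
  also have "\<dots> \<le> (v \<bullet> f v) * (f v \<bullet> f (f v))" by (rule form.cauchy_schwarz) auto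
  also have "\<dots> \<le> (v \<bullet> f v) * (m * (norm (f v))\<^sup>2)"
    using quadratic_le[of "f v"] by (intro mult_left_mono pos) (simp add: power2_norm_eq_inner)
  finally have "(norm (f v))\<^sup>2 * (norm (f v))\<^sup>2 \<le> (norm (f v))\<^sup>2 * (m * (v \<bullet> f v))" by (simp only: mult_ac)
  then show ?thesis by (rule mult_left_le_imp_le) (use False in simp)
qed (use m pos in simp)

lemma norm_adjoint_le:
  fixes f :: "'a::real_inner \<Rightarrow> 'b::real_inner"
  assumes adj: "\<And>\<xi> v. f \<xi> \<bullet> v = \<xi> \<bullet> g v" and norm_f_le: "\<And>\<xi>. norm (f \<xi>) \<le> m * norm \<xi>" and m: "0 \<le> m"
  shows "norm (g v) \<le> m * norm v"
proof (cases "g v = 0")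
  case False
  have "norm (g v) * norm (g v) = f (g v) \<bullet> v"
    by (simp add: adj power2_norm_eq_inner flip: power2_eq_square)
  also have "\<dots> \<le> norm (f (g v)) * norm v" by (rule norm_cauchy_schwarz)
  also have "\<dots> \<le> (m * norm (g v)) * norm v" by (intro mult_right_mono norm_f_le) simp
  finally show ?thesis using False by (simp add: mult_ac)
qed (use m in simp)

section \<open>Symmetric operators on Euclidean spaces\<close>

definition orthonormal :: "'a::real_inner set \<Rightarrow> bool" where
  "orthonormal B \<longleftrightarrow> finite B \<and> pairwise orthogonal B \<and> (\<forall>b\<in>B. norm b = 1)"

lemma orthonormal_inner:
  assumes "orthonormal B" "b \<in> B" "c \<in> B"
  shows "b \<bullet> c = (if b = c then 1 else 0)"
  using assms by (auto simp: orthonormal_def pairwise_def orthogonal_def norm_eq_1)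

lemma orthonormal_expand:
  assumes "orthonormal B" "v \<in> span B"
  shows "(\<Sum>b\<in>B. (v \<bullet> b) *\<^sub>R b) = v"
  using assms by (intro orthonormal_basis_expand) (auto simp: orthonormal_def)

lemma orthonormal_parseval:
  assumes "orthonormal B" "span B = UNIV"
  shows "v \<bullet> w = (\<Sum>b\<in>B. (v \<bullet> b) * (b \<bullet> w))"
proof -
  have "v \<bullet> w = (\<Sum>b\<in>B. (v \<bullet> b) *\<^sub>R b) \<bullet> w" using assms by (simp add: orthonormal_expand)
  then show ?thesis by (simp add: inner_sum_left)
qed

lemma sum_Basis_bilinear:
  fixes B :: "'a::euclidean_space set" and \<beta> :: "'a \<Rightarrow> 'a \<Rightarrow> real"
  assumes B: "orthonormal B" "span B = UNIV" and \<beta>: "bilinear \<beta>"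
  shows "(\<Sum>b\<in>Basis. \<beta> b b) = (\<Sum>c\<in>B. \<beta> c c)"
proof -
  have lin: "linear (\<beta> v)" "linear (\<lambda>w. \<beta> w v)" for v
    using \<beta> by (auto simp: bilinear_def)
  have expand: "\<beta> v (\<Sum>i\<in>I. f i *\<^sub>R g i) = (\<Sum>i\<in>I. f i * \<beta> v (g i))"
    "\<beta> (\<Sum>i\<in>I. f i *\<^sub>R g i) v = (\<Sum>i\<in>I. f i * \<beta> (g i) v)" for v f I and g :: "'a \<Rightarrow> 'a"
    using linear_sum[OF lin(1)[of v], of "\<lambda>i. f i *\<^sub>R g i"] linear_sum[OF lin(2)[of v], of "\<lambda>i. f i *\<^sub>R g i"]
    by (simp_all add: linear_scale[OF lin(1)] linear_scale[OF lin(2)])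
  have "(\<Sum>b\<in>Basis. \<beta> b b) = (\<Sum>b\<in>Basis. \<beta> b (\<Sum>c\<in>B. (b \<bullet> c) *\<^sub>R c))"
    using orthonormal_expand[OF B(1)] B(2) by simp
  also have "\<dots> = (\<Sum>b\<in>Basis. \<Sum>c\<in>B. (b \<bullet> c) * \<beta> b c)" by (simp only: expand)
  also have "\<dots> = (\<Sum>c\<in>B. \<Sum>b\<in>Basis. (c \<bullet> b) * \<beta> b c)"
    by (subst sum.swap) (simp add: inner_commute)
  also have "\<dots> = (\<Sum>c\<in>B. \<beta> (\<Sum>b\<in>Basis. (c \<bullet> b) *\<^sub>R b) c)" by (simp only: expand)
  also have "\<dots> = (\<Sum>c\<in>B. \<beta> c c)" by (simp only: euclidean_representation)
  finally show ?thesis .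
qed

lemma bilinear_inner: "linear f \<Longrightarrow> linear g \<Longrightarrow> bilinear (\<lambda>v w. f v \<bullet> g w)"
  by (auto simp: bilinear_def linear_iff inner_add_left inner_add_right)

lemma quadratic_form_max_eigenvector:
  fixes f :: "'a::euclidean_space \<Rightarrow> 'a"
  assumes lin: "linear f" and sym: "\<And>v w. f v \<bullet> w = v \<bullet> f w"
    and V: "subspace V" "\<And>v. v \<in> V \<Longrightarrow> f v \<in> V" and v0: "v0 \<in> V" "v0 \<noteq> 0"
  obtains e lam where "e \<in> V" "norm e = 1" "f e = lam *\<^sub>R e" "\<And>v. v \<in> V \<Longrightarrow> v \<bullet> f v \<le> lam * (v \<bullet> v)"
proof -
  let ?S = "V \<inter> sphere 0 1"
  have "compact ?S" using closed_subspace[OF V(1)] by (simp add: closed_Int_compact)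
  moreover have normalized: "(1 / norm v) *\<^sub>R v \<in> ?S" if "v \<in> V" "v \<noteq> 0" for v
    using that V(1) by (simp add: subspace_scale)
  then have "?S \<noteq> {}" using v0 by blast
  moreover have "continuous_on ?S (\<lambda>v. v \<bullet> f v)"
    using lin by (intro continuous_intros linear_continuous_on_compose[OF continuous_on_id])
  ultimately obtain e where e: "e \<in> ?S" and e_max: "\<And>v. v \<in> ?S \<Longrightarrow> v \<bullet> f v \<le> e \<bullet> f e"
    using continuous_attains_sup by metis
  define lam where "lam = e \<bullet> f e"
  have e_in: "e \<in> V" and inner_e: "e \<bullet> e = 1" using e by (auto simp: norm_eq_1)
  have quadratic_le: "v \<bullet> f v \<le> lam * (v \<bullet> v)" if v: "v \<in> V" for v
  proof (cases "v = 0")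
    case False
    have "(v \<bullet> f v) / (v \<bullet> v) \<le> lam"
      using e_max[OF normalized[OF v False]]
      by (simp add: linear_scale[OF lin] lam_def power2_eq_square flip: power2_norm_eq_inner)
    then show ?thesis using False by (simp add: pos_divide_le_eq)
  qed (simp add: linear_0[OF lin])
  interpret gap: psd_form V "\<lambda>v w. v \<bullet> (lam *\<^sub>R w - f w)"
    using quadratic_le by (intro psd_form_operator V linear_compose_sub lin linear_compose_scale_right linear_ident)
      (simp_all add: sym inner_diff_left inner_diff_right)
  define g where "g = lam *\<^sub>R e - f e"
  have "g \<in> V" using e_in V by (simp add: g_def subspace_diff subspace_scale)
  then have "(e \<bullet> (lam *\<^sub>R g - f g))\<^sup>2 \<le> (e \<bullet> g) * (g \<bullet> (lam *\<^sub>R g - f g))"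
    using gap.cauchy_schwarz[OF e_in] by (simp add: g_def)
  moreover have "e \<bullet> g = 0" by (simp add: g_def inner_diff_right lam_def inner_e)
  moreover have "e \<bullet> (lam *\<^sub>R g - f g) = (lam *\<^sub>R e - f e) \<bullet> g" by (simp add: inner_diff_right inner_diff_left sym)
  ultimately have "f e = lam *\<^sub>R e" by (simp flip: g_def) (simp add: g_def)
  moreover have "norm e = 1" using e by simp
  ultimately show thesis using that e_in quadratic_le by blast
qed

lemma orthonormal_insert:
  assumes V: "subspace V" and e: "e \<in> V" "norm e = 1"
    and B: "orthonormal B" "B \<subseteq> {v \<in> V. e \<bullet> v = 0}" "{v \<in> V. e \<bullet> v = 0} \<subseteq> span B"
  shows "orthonormal (insert e B)" "insert e B \<subseteq> V" "V \<subseteq> span (insert e B)"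
proof -
  have "e \<notin> B" using B(2) e(2) by auto
  then show "orthonormal (insert e B)"
    using B(1,2) e(2) by (auto simp: orthonormal_def pairwise_insert orthogonal_def inner_commute)
  show "insert e B \<subseteq> V" using B(2) e(1) by auto
  show "V \<subseteq> span (insert e B)"
  proof
    fix v assume "v \<in> V"
    then have "v - (e \<bullet> v) *\<^sub>R e \<in> {v \<in> V. e \<bullet> v = 0}"
      using V e by (simp add: subspace_diff subspace_scale inner_diff_right norm_eq_1)
    then show "v \<in> span (insert e B)" using B(3) unfolding span_insert by blast
  qed
qed

lemma invariant_subspace_eigenbasis:
  fixes f :: "'a::euclidean_space \<Rightarrow> 'a"
  assumes lin: "linear f" and sym: "\<And>v w. f v \<bullet> w = v \<bullet> f w"
  shows "subspace V \<Longrightarrow> (\<And>v. v \<in> V \<Longrightarrow> f v \<in> V) \<Longrightarrow>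
    \<exists>B k. orthonormal B \<and> B \<subseteq> V \<and> V \<subseteq> span B \<and> (\<forall>b\<in>B. f b = k b *\<^sub>R b)"
proof (induction "dim V" arbitrary: V rule: less_induct)
  case less
  show ?case
  proof (cases "\<exists>v0\<in>V. v0 \<noteq> 0")
    case False
    then have "V \<subseteq> span {}" by auto
    then show ?thesis by (intro exI[of _ "{}"]) (auto simp: orthonormal_def)
  next
    case True
    then obtain e lam where e: "e \<in> V" "norm e = 1" "f e = lam *\<^sub>R e"
      using quadratic_form_max_eigenvector[OF lin sym less.prems] by metis
    let ?W = "{v \<in> V. e \<bullet> v = 0}"
    have subspace_W: "subspace ?W" using less.prems(1) by (auto simp: subspace_def inner_add_right)
    have invariant_W: "f v \<in> ?W" if "v \<in> ?W" for v
      using that less.prems(2) by (auto simp: sym[symmetric] e(3))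
    have "?W = {v \<in> V. \<forall>w \<in> span {e}. orthogonal w v}" by (auto simp: span_singleton orthogonal_def)
    then have "dim ?W + dim (span {e}) = dim V"
      using e less.prems(1) by (simp only:) (intro dim_subspace_orthogonal_to_vectors; simp add: span_minimal)
    moreover have "dim (span {e}) = 1" using e by (auto simp: dim_singleton)
    ultimately have "dim ?W < dim V" by linarith
    from less.hyps[OF this subspace_W invariant_W] obtain B k
      where B: "orthonormal B" "B \<subseteq> ?W" "?W \<subseteq> span B" and eigen: "\<forall>b\<in>B. f b = k b *\<^sub>R b"
      by blast
    have "e \<notin> B" using B(2) e(2) by auto
    then have "\<forall>b\<in>insert e B. f b = (k(e := lam)) b *\<^sub>R b" using eigen e(3) by auto
    then show ?thesis using orthonormal_insert[OF less.prems(1) e(1,2) B] by blast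
  qed
qed

theorem spectral_theorem:
  fixes f :: "'a::euclidean_space \<Rightarrow> 'a"
  assumes "linear f" "\<And>v w. f v \<bullet> w = v \<bullet> f w"
  obtains B k where "orthonormal B" "span B = UNIV" "\<And>b. b \<in> B \<Longrightarrow> f b = k b *\<^sub>R b"
  using invariant_subspace_eigenbasis[OF assms, of UNIV] by auto

lemma psd_operator_le_trace:
  fixes f :: "'a::euclidean_space \<Rightarrow> 'a"
  assumes lin: "linear f" and sym: "\<And>v w. f v \<bullet> w = v \<bullet> f w" and pos: "\<And>v. 0 \<le> v \<bullet> f v"
  shows "v \<bullet> f v \<le> (\<Sum>b\<in>Basis. b \<bullet> f b) * (v \<bullet> v)"
proof -
  obtain B k where B: "orthonormal B" "span B = UNIV" "\<And>b. b \<in> B \<Longrightarrow> f b = k b *\<^sub>R b"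
    using spectral_theorem[OF lin sym] by metis
  have eigenvalue: "b \<bullet> f b = k b" if "b \<in> B" for b
    using that B(3) orthonormal_inner[OF B(1)] by simp
  have trace: "(\<Sum>b\<in>Basis. b \<bullet> f b) = (\<Sum>b\<in>B. k b)"
    using sum_Basis_bilinear[OF B(1,2) bilinear_inner[OF linear_ident lin]] eigenvalue by simp
  have "v \<bullet> f v = (\<Sum>b\<in>B. (v \<bullet> b) * (b \<bullet> f v))" by (rule orthonormal_parseval[OF B(1,2)])
  also have "\<dots> = (\<Sum>b\<in>B. k b * (v \<bullet> b)\<^sup>2)"
    using B(3) by (intro sum.cong) (auto simp: sym[symmetric] power2_eq_square inner_commute[of v])
  also have "\<dots> \<le> (\<Sum>b\<in>B. k b * (v \<bullet> v))"
  proof (intro sum_mono mult_left_mono)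
    fix b assume b: "b \<in> B"
    show "(v \<bullet> b)\<^sup>2 \<le> v \<bullet> v" using Cauchy_Schwarz_ineq[of v b] orthonormal_inner[OF B(1) b b] by simp
    show "0 \<le> k b" using pos[of b] eigenvalue[OF b] by simp
  qed
  also have "\<dots> = (\<Sum>b\<in>Basis. b \<bullet> f b) * (v \<bullet> v)" by (simp add: trace sum_distrib_right)
  finally show ?thesis .
qed

section \<open>Positive contractions\<close>

lemma abs_shift_le:
  fixes a b t m :: real
  assumes "0 \<le> a" "a \<le> b" "t \<le> m" "1 - t \<le> m"
  shows "\<bar>a - t * b\<bar> \<le> m * b"
  using assms mult_right_mono[of t m b] mult_right_mono[of "1 - t" m b] by (simp add: left_diff_distrib abs_le_iff)

locale positive_contraction =
  fixes G :: "'v::real_inner \<Rightarrow> 'v"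
  assumes G_linear: "linear G"
    and G_sym: "G v \<bullet> w = v \<bullet> G w"
    and G_contraction: "G v \<bullet> G v \<le> v \<bullet> G v"
begin

lemma G_nonneg: "0 \<le> v \<bullet> G v"
  using G_contraction[of v] inner_ge_zero[of "G v"] by linarith

lemma inner_G_commute: "v \<bullet> G w = w \<bullet> G v"
  by (metis G_sym inner_commute)

sublocale green: psd_form UNIV "\<lambda>v w. v \<bullet> G w"
  by (intro psd_form_operator G_linear G_sym G_nonneg) simp

abbreviation green_norm :: "'v \<Rightarrow> real" where
  "green_norm \<equiv> green.seminorm"

lemma green_norm_nonneg: "0 \<le> green_norm v"
  by (simp add: green.seminorm_nonneg)

lemma green_norm_power2: "(green_norm v)\<^sup>2 = v \<bullet> G v"
  by (simp add: green.seminorm_power2)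

lemma norm_G_le_green_norm: "norm (G v) \<le> green_norm v"
  unfolding green.seminorm_def norm_eq_sqrt_inner using G_contraction by (rule real_sqrt_le_mono)

lemma norm_G_le: "norm (G v) \<le> norm v"
proof (cases "G v = 0")
  case False
  have "norm (G v) * norm (G v) \<le> v \<bullet> G v"
    using G_contraction[of v] by (simp add: dot_square_norm power2_eq_square)
  also have "\<dots> \<le> norm v * norm (G v)" by (rule norm_cauchy_schwarz)
  finally show ?thesis using False by simp
qed simp

lemma inner_G_le: "v \<bullet> G v \<le> v \<bullet> v"
proof -
  have "v \<bullet> G v \<le> norm v * norm (G v)" by (rule norm_cauchy_schwarz)
  also have "\<dots> \<le> norm v * norm v" by (intro mult_left_mono norm_G_le) simp
  finally show ?thesis by (simp add: dot_square_norm power2_eq_square)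
qed

definition shifted :: "real \<Rightarrow> 'v \<Rightarrow> 'v" where
  "shifted t v = G v - t *\<^sub>R v"

lemma shifted_linear: "linear (shifted t)"
  unfolding shifted_def by (intro linear_compose_sub G_linear linear_scale_self)

lemma shifted_G: "shifted t (G v) = G (shifted t v)"
  by (simp add: shifted_def linear_diff[OF G_linear] linear_scale[OF G_linear])

lemma shifted_sym: "shifted t v \<bullet> w = v \<bullet> shifted t w"
  by (simp add: shifted_def inner_diff_left inner_diff_right G_sym)

lemma norm_shifted_le:
  assumes "0 \<le> t" "t \<le> m" "1 - t \<le> m"
  shows "norm (shifted t v) \<le> m * norm v"
proof (rule norm_symmetric_operator_le[OF shifted_linear shifted_sym])
  show "\<bar>w \<bullet> shifted t w\<bar> \<le> m * (w \<bullet> w)" for w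
    using abs_shift_le[OF G_nonneg inner_G_le assms(2,3)] by (simp add: shifted_def inner_diff_right)
qed (use assms in simp)

lemma green_norm_shifted_le:
  assumes "0 \<le> t" "t \<le> m" "1 - t \<le> m"
  shows "green_norm (shifted t v) \<le> m * green_norm v"
proof (rule power2_le_imp_le)
  have bound: "\<bar>w \<bullet> G (shifted t w)\<bar> \<le> m * (w \<bullet> G w)" for w
  proof -
    have "w \<bullet> G (shifted t w) = G w \<bullet> G w - t * (w \<bullet> G w)"
      by (simp add: shifted_def linear_diff[OF G_linear] linear_scale[OF G_linear] inner_diff_right G_sym)
    then show ?thesis using abs_shift_le[OF inner_ge_zero G_contraction assms(2,3)] by simp
  qed
  have "shifted t v \<bullet> G (shifted t v) \<le> m\<^sup>2 * (v \<bullet> G v)"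
    by (rule green.symmetric_operator_bound[OF shifted_linear])
      (use assms bound in \<open>auto simp: shifted_sym shifted_G\<close>)
  then show "(green_norm (shifted t v))\<^sup>2 \<le> (m * green_norm v)\<^sup>2"
    by (simp add: power_mult_distrib green_norm_power2)
qed (use assms green_norm_nonneg in simp)

lemma norm_shifted_one_le:
  assumes "1 \<le> t"
  shows "norm (shifted 1 v) \<le> norm (shifted t v)"
proof (rule power2_le_imp_le)
  have "0 \<le> (t - 1) * ((t - 1) * (v \<bullet> v) + 2 * (v \<bullet> v - v \<bullet> G v))"
    using assms inner_G_le[of v] by simp
  also have "\<dots> = (norm (shifted t v))\<^sup>2 - (norm (shifted 1 v))\<^sup>2"
    unfolding power2_norm_eq_inner
    by (simp add: shifted_def inner_diff_left inner_diff_right inner_commute[of "G v" v] algebra_simps)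
  finally show "(norm (shifted 1 v))\<^sup>2 \<le> (norm (shifted t v))\<^sup>2" by simp
qed simp

end

section \<open>The two stages on synthesis operators\<close>

text \<open>An \<open>N\<close>-tuple \<open>U\<close> enters through its synthesis operator \<open>u \<xi> = \<Sum>\<xi>\<^sub>i u\<^sub>i\<close> and the adjoint \<open>us\<close>; \<open>uh\<close> and
  \<open>uhs\<close> belong to the intermediate tuple. Gram matrices become compositions such as \<open>us \<circ> u\<close>.\<close>

locale two_stage = positive_contraction G
  for G :: "'v::real_inner \<Rightarrow> 'v" +
  fixes u uh :: "'e::real_inner \<Rightarrow> 'v" and us uhs :: "'v \<Rightarrow> 'e"
    and x l :: real
  assumes u_linear: "linear u" and uh_linear: "linear uh"
    and us_linear: "linear us" and uhs_linear: "linear uhs"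
    and u_adj: "u \<xi> \<bullet> v = \<xi> \<bullet> us v" and uh_adj: "uh \<xi> \<bullet> v = \<xi> \<bullet> uhs v"
    and x_pos: "0 < x"
    and midpoint: "uh \<xi> = u \<xi> + x *\<^sub>R
      (G (u (us ((1/2) *\<^sub>R (uh \<xi> + u \<xi>)))) - u (us (G ((1/2) *\<^sub>R (uh \<xi> + u \<xi>)))))"
    and l_ge: "1 \<le> l"
    and u_le: "(norm (u \<xi>))\<^sup>2 \<le> l * (norm \<xi>)\<^sup>2"
begin

definition skew :: "'v \<Rightarrow> 'v" where "skew v = G (u (us v)) - u (us (G v))"
definition mid :: "'e \<Rightarrow> 'v" where "mid \<xi> = (1/2) *\<^sub>R (uh \<xi> + u \<xi>)"
definition mid_adj :: "'v \<Rightarrow> 'e" where "mid_adj v = (1/2) *\<^sub>R (uhs v + us v)"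
definition incr :: "'e \<Rightarrow> 'v" where "incr \<xi> = uh \<xi> - u \<xi>"
definition incr_adj :: "'v \<Rightarrow> 'e" where "incr_adj v = uhs v - us v"
definition defect :: "'e \<Rightarrow> 'e" where "defect \<xi> = us (u \<xi>) - \<xi>"
definition ritz :: "'e \<Rightarrow> 'e" where "ritz \<xi> = us (G (u \<xi>))"
definition ritz_hat :: "'e \<Rightarrow> 'e" where "ritz_hat \<xi> = uhs (G (uh \<xi>))"
definition upd :: "'e \<Rightarrow> 'v" where "upd \<xi> = uh \<xi> - x *\<^sub>R G (uh (defect \<xi>))"
definition d :: real where "d = l - 1"

lemma d_nonneg: "0 \<le> d"
  using l_ge by (simp add: d_def)

lemma four_d_le: "4 * d \<le> l\<^sup>2"
  using zero_le_power2[of "l - 2"] by (simp add: d_def power2_eq_square algebra_simps)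

lemma operators_linear: "linear skew" "linear mid" "linear mid_adj" "linear incr" "linear incr_adj"
    "linear defect" "linear ritz" "linear ritz_hat"
  by (rule linearI; simp add: skew_def mid_def mid_adj_def incr_def incr_adj_def defect_def ritz_def ritz_hat_def
      linear_add[OF G_linear] linear_scale[OF G_linear] algebra_simps
      linear_add[OF u_linear] linear_scale[OF u_linear] linear_add[OF uh_linear] linear_scale[OF uh_linear]
      linear_add[OF us_linear] linear_scale[OF us_linear] linear_add[OF uhs_linear] linear_scale[OF uhs_linear])+

lemmas all_linear = u_linear uh_linear us_linear uhs_linear operators_linear G_linear shifted_linear
lemmas linear_simps = all_linear[THEN linear_add] all_linear[THEN linear_diff] all_linear[THEN linear_scale]
  all_linear[THEN linear_neg] all_linear[THEN linear_0]

lemma upd_linear: "linear upd"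
  by (rule linearI) (simp_all add: upd_def linear_simps algebra_simps)

lemma us_u: "us (u \<xi>) = \<xi> + defect \<xi>"
  by (simp add: defect_def)

lemma skew_antisym: "skew v \<bullet> z = - (v \<bullet> skew z)"
  by (simp add: skew_def inner_diff_left inner_diff_right u_adj G_sym inner_commute[of v]
      inner_commute[of "us v"] inner_commute[of "us (G v)"])

lemma skew_eq_shifted: "skew v = shifted t (u (us v)) - u (us (shifted t v))"
  by (simp add: skew_def shifted_def linear_simps)

lemma mid_adj: "mid \<xi> \<bullet> v = \<xi> \<bullet> mid_adj v"
  by (simp add: mid_def mid_adj_def inner_add_left inner_add_right u_adj uh_adj)

lemma incr_adj: "incr \<xi> \<bullet> v = \<xi> \<bullet> incr_adj v"
  by (simp add: incr_def incr_adj_def inner_diff_left inner_diff_right u_adj uh_adj)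

lemma uh_eq: "uh \<xi> = u \<xi> + incr \<xi>"
  by (simp add: incr_def)

lemma mid_eq: "mid \<xi> = u \<xi> + (1/2) *\<^sub>R incr \<xi>"
  by (simp add: mid_def incr_def algebra_simps flip: scaleR_add_left)

lemma incr_eq_skew: "incr \<xi> = x *\<^sub>R skew (mid \<xi>)"
  unfolding incr_def skew_def mid_def by (subst midpoint) simp

lemma incr_adj_eq_skew: "incr_adj v = - (x *\<^sub>R mid_adj (skew v))"
proof -
  have "\<xi> \<bullet> incr_adj v = \<xi> \<bullet> - (x *\<^sub>R mid_adj (skew v))" for \<xi>
    by (simp add: incr_adj[symmetric] incr_eq_skew skew_antisym mid_adj)
  then show ?thesis by (rule vector_eq_ldot[THEN iffD1, rule_format])
qed

lemma uh_inner_uh: "uh \<xi> \<bullet> uh \<zeta> = u \<xi> \<bullet> u \<zeta>"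
proof -
  have "incr \<xi> \<bullet> mid \<zeta> + mid \<xi> \<bullet> incr \<zeta> = 0"
    by (simp add: incr_eq_skew skew_antisym)
  then show ?thesis
    by (simp add: incr_def mid_def inner_diff_left inner_diff_right inner_add_left inner_add_right field_simps)
qed

lemma uhs_uh: "uhs (uh \<xi>) = us (u \<xi>)"
proof -
  have "\<zeta> \<bullet> uhs (uh \<xi>) = \<zeta> \<bullet> us (u \<xi>)" for \<zeta>
    by (simp add: u_adj[symmetric] uh_adj[symmetric] uh_inner_uh)
  then show ?thesis by (rule vector_eq_ldot[THEN iffD1, rule_format])
qed

lemma sqrt_l_mult: "sqrt l * sqrt l = l" "sqrt l * (sqrt l * a) = l * a" "sqrt l * (m * (sqrt l * a)) = m * l * a"
proof -
  show sqrt_l: "sqrt l * sqrt l = l" using l_ge by simp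
  show "sqrt l * (sqrt l * a) = l * a" "sqrt l * (m * (sqrt l * a)) = m * l * a"
    using sqrt_l by (metis mult.assoc, metis mult.assoc mult.commute)
qed

lemma norm_u_le: "norm (u \<xi>) \<le> sqrt l * norm \<xi>"
  by (rule power2_le_imp_le) (use u_le l_ge in \<open>simp_all add: power_mult_distrib\<close>)

lemma norm_uh_le: "norm (uh \<xi>) \<le> sqrt l * norm \<xi>"
  using norm_u_le[of \<xi>] uh_inner_uh[of \<xi> \<xi>] by (simp add: norm_eq_sqrt_inner)

lemma norm_mid_le: "norm (mid \<xi>) \<le> sqrt l * norm \<xi>"
  unfolding mid_def using norm_u_le[of \<xi>] norm_uh_le[of \<xi>] norm_triangle_ineq[of "uh \<xi>" "u \<xi>"] by simp

lemma norm_us_le: "norm (us v) \<le> sqrt l * norm v"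
  by (rule norm_adjoint_le[OF u_adj norm_u_le]) (use l_ge in simp)

lemma norm_uhs_le: "norm (uhs v) \<le> sqrt l * norm v"
  by (rule norm_adjoint_le[OF uh_adj norm_uh_le]) (use l_ge in simp)

lemma norm_mid_adj_le: "norm (mid_adj v) \<le> sqrt l * norm v"
  by (rule norm_adjoint_le[OF mid_adj norm_mid_le]) (use l_ge in simp)

lemma norm_us_power2_le: "(norm (us v))\<^sup>2 \<le> l * (norm v)\<^sup>2"
  using power_mono[OF norm_us_le, of v 2] l_ge by (simp add: power_mult_distrib)

lemma norm_us_image_u_le:
  assumes "norm (P (u \<xi>)) \<le> m * norm (u \<xi>)" "0 \<le> m"
  shows "norm (us (P (u \<xi>))) \<le> m * l * norm \<xi>"
proof -
  have "norm (us (P (u \<xi>))) \<le> sqrt l * (m * norm (u \<xi>))"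
    by (rule order_trans[OF norm_us_le mult_left_mono[OF assms(1)]]) (use l_ge in simp)
  also have "\<dots> \<le> sqrt l * (m * (sqrt l * norm \<xi>))"
    using assms l_ge by (intro mult_left_mono norm_u_le) auto
  finally show ?thesis by (simp only: sqrt_l_mult)
qed

lemma defect_sym: "defect \<xi> \<bullet> \<zeta> = \<xi> \<bullet> defect \<zeta>"
  by (simp add: defect_def inner_diff_left inner_diff_right inner_commute[of "us _" \<zeta>] u_adj[symmetric])
     (simp add: u_adj[symmetric] inner_commute)

lemma inner_defect: "\<xi> \<bullet> defect \<xi> = (norm (u \<xi>))\<^sup>2 - (norm \<xi>)\<^sup>2"
  by (simp add: defect_def inner_diff_right u_adj[symmetric] power2_norm_eq_inner)

lemma defect_le: "\<xi> \<bullet> defect \<xi> \<le> d * (\<xi> \<bullet> \<xi>)"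
  using u_le[of \<xi>] by (simp add: inner_defect d_def left_diff_distrib power2_norm_eq_inner)

lemma ritz_sym: "ritz \<xi> \<bullet> \<zeta> = \<xi> \<bullet> ritz \<zeta>"
  by (simp add: ritz_def inner_commute[of "us _" \<zeta>] u_adj[symmetric]) (rule inner_G_commute)

lemma inner_ritz: "\<xi> \<bullet> ritz \<zeta> = u \<xi> \<bullet> G (u \<zeta>)"
  by (simp add: ritz_def u_adj)

lemma ritz_le: "\<xi> \<bullet> ritz \<xi> \<le> l * (\<xi> \<bullet> \<xi>)"
  using inner_G_le[of "u \<xi>"] u_le[of \<xi>] by (simp add: inner_ritz power2_norm_eq_inner)

lemma inner_ritz_hat: "\<xi> \<bullet> ritz_hat \<zeta> = uh \<xi> \<bullet> G (uh \<zeta>)"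
  by (simp add: ritz_hat_def uh_adj)

sublocale ritz_hat: psd_form UNIV "\<lambda>\<xi> \<zeta>. \<xi> \<bullet> ritz_hat \<zeta>"
  by (intro psd_form_operator operators_linear)
    (simp_all add: inner_commute[of "ritz_hat _"] inner_ritz_hat inner_G_commute G_nonneg)

lemma ritz_hat_sym: "ritz_hat \<xi> \<bullet> \<zeta> = \<xi> \<bullet> ritz_hat \<zeta>"
  by (metis UNIV_I inner_commute ritz_hat.sym)

lemma ritz_hat_le: "\<xi> \<bullet> ritz_hat \<xi> \<le> l * (\<xi> \<bullet> \<xi>)"
  using inner_G_le[of "uh \<xi>"] u_le[of \<xi>] by (simp add: inner_ritz_hat uh_inner_uh power2_norm_eq_inner)

lemma norm_G_uh_le: "(norm (G (uh \<xi>)))\<^sup>2 \<le> \<xi> \<bullet> ritz_hat \<xi>"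
  using G_contraction by (simp add: inner_ritz_hat power2_norm_eq_inner)

lemma norm_upd:
  "(norm (upd \<xi>))\<^sup>2 = (norm (u \<xi>))\<^sup>2 - 2 * x * (ritz_hat \<xi> \<bullet> defect \<xi>) + x\<^sup>2 * (norm (G (uh (defect \<xi>))))\<^sup>2"
proof -
  have "uh \<xi> \<bullet> G (uh (defect \<xi>)) = ritz_hat \<xi> \<bullet> defect \<xi>"
    by (simp add: ritz_hat_sym inner_ritz_hat)
  then show ?thesis
    unfolding power2_norm_eq_inner
    by (simp add: upd_def inner_diff_left inner_diff_right uh_inner_uh
        inner_commute[of "G _" "uh \<xi>"] power2_eq_square algebra_simps)
qed

end

section \<open>The scalar balance behind the defect inequality\<close>

text \<open>The product with \<open>l\<close> is at most \<open>2/5\<close>, as the trace estimate requires, and at most \<open>8 (l - 1)\<close>, which keeps the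
  defect above \<open>- (l - 1)\<close>.\<close>

definition defect_weight :: "real \<Rightarrow> real" where
  "defect_weight l = 8 * (l - 1) / (l * (20 * l - 19))"

lemma defect_weight_bounds:
  assumes l: "1 \<le> l"
  shows "0 \<le> defect_weight l" "defect_weight l * l \<le> 2/5" "defect_weight l * l \<le> 8 * (l - 1)"
    "defect_weight l * l * (20 * l - 19) = 8 * (l - 1)"
proof -
  have pos: "0 < l * (20 * l - 19)" "0 < 20 * l - 19" using l by simp_all
  show "0 \<le> defect_weight l" using pos l by (simp add: defect_weight_def)
  show weight: "defect_weight l * l * (20 * l - 19) = 8 * (l - 1)" using pos by (simp add: defect_weight_def)
  then have weight_l: "defect_weight l * l = 8 * (l - 1) / (20 * l - 19)" using pos by (simp add: eq_divide_eq)
  show "defect_weight l * l \<le> 2/5" unfolding weight_l using pos by (simp add: pos_divide_le_eq)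
  have "8 * (l - 1) * 1 \<le> 8 * (l - 1) * (20 * l - 19)" using l by (intro mult_left_mono) simp_all
  then show "defect_weight l * l \<le> 8 * (l - 1)" unfolding weight_l using pos by (simp add: pos_divide_le_eq)
qed

definition growth_loss :: "real \<Rightarrow> real \<Rightarrow> real \<Rightarrow> real \<Rightarrow> real \<Rightarrow> real \<Rightarrow> real" where
  "growth_loss l p s \<beta> \<nu> \<rho> = s / 2 * \<beta> * ((l - 1 + 11/20 * p) * \<beta> + (l + 11/20 * p) * \<nu>) + s * l * \<beta> * \<nu>
    + 3/8 * l\<^sup>2 * \<beta>\<^sup>2 + \<beta> * (2 * (l - 1) * \<beta> + 8/3 * p * \<beta> + (l + 5/3 * p) * \<nu>)
    + ((s + 4 * p) * \<beta> + 17/6 * p * \<nu>) * \<rho>"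

lemma quadratic_form_balance:
  fixes d K a A m n e \<beta> \<nu> :: real
  assumes d: "0 \<le> d" and K: "0 \<le> K" "K * (1 + 20 * d) = 8 * d" and mixed: "0 \<le> 2 * K * m + n"
    and beta: "0 \<le> (2 + 5 * d) * (a - 13/100 * (1 + 20 * d) * A\<^sup>2) - 5/2 * d * m - 5/32 * (1 + 20 * d) * n"
    and nu: "0 \<le> e - (2 + 5 * d) / 5 * (2 * K * m + n)"
  shows "0 \<le> d * (K * a - 26/25 * d * A\<^sup>2) * \<beta>\<^sup>2 - d * (2 * K * m + n) * (\<beta> * \<nu>) + e * \<nu>\<^sup>2"
proof -
  let ?F = "(2 + 5 * d) * (a - 13/100 * (1 + 20 * d) * A\<^sup>2) - 5/2 * d * m - 5/32 * (1 + 20 * d) * n"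
    and ?T = "d * (K * a - 26/25 * d * A\<^sup>2) * \<beta>\<^sup>2 - d * (2 * K * m + n) * (\<beta> * \<nu>) + e * \<nu>\<^sup>2"
  have "20 * (2 + 5 * d) * ?T = 20 * d * K * ?F * \<beta>\<^sup>2
      + 20 * (2 + 5 * d) * (e - (2 + 5 * d) / 5 * (2 * K * m + n)) * \<nu>\<^sup>2
      + (2 * K * m + n) * (5 * d * \<beta> - 2 * (2 + 5 * d) * \<nu>)\<^sup>2"
    using K(2) by algebra
  also have "0 \<le> \<dots>"
  proof (intro add_nonneg_nonneg)
    show "0 \<le> 20 * d * K * ?F * \<beta>\<^sup>2" using d K(1) by (intro mult_nonneg_nonneg beta) simp_all
    show "0 \<le> 20 * (2 + 5 * d) * (e - (2 + 5 * d) / 5 * (2 * K * m + n)) * \<nu>\<^sup>2"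
      using d by (intro mult_nonneg_nonneg nu) simp_all
    show "0 \<le> (2 * K * m + n) * (5 * d * \<beta> - 2 * (2 + 5 * d) * \<nu>)\<^sup>2" by (intro mult_nonneg_nonneg mixed) simp
  qed
  finally show ?thesis using d by (simp add: zero_le_mult_iff)
qed

locale balance_parameters =
  fixes d p l r s c :: real
  assumes d_nonneg: "0 \<le> d" and p_bounds: "1/18 \<le> p" "p \<le> 1/6"
    and l_eq: "l = 1 + d" and r_eq: "r = 9 * p - 1/2" and s_eq: "s = 27/4 * p - 1/24" and c_eq: "c = defect_weight l"
begin

text \<open>The coefficients arise when the bound \<open>l \<rho> \<le> rho_beta \<beta> + rho_nu \<nu>\<close> for the Ritz residual is substituted into
  \<open>total_loss\<close> below and denominators are cleared.\<close>

definition rho_beta :: real where "rho_beta = l + 12/5 * p"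
definition rho_nu :: real where "rho_nu = l + 13/10 * p"
definition growth_beta :: real where "growth_beta = s / 2 * (d + 11/20 * p) + 3/8 * l\<^sup>2 + 2 * d + 8/3 * p"
definition growth_mixed :: real where "growth_mixed = s / 2 * (l + 11/20 * p) + s * l + l + 5/3 * p"
definition l_gain :: real where "l_gain = 141/50 * l^3 + 1269/500 * r * l\<^sup>2 + r * d"
definition inflation :: real where "inflation = l + 8/3 * p"
definition weighted_mixed :: real where
  "weighted_mixed = l * growth_mixed + rho_beta * (17/6 * p) + rho_nu * (s + 4 * p)"
definition plain_mixed :: real where
  "plain_mixed = 2 * inflation * rho_beta + 52/25 * d * rho_beta * rho_nu + 15/8 * s * l * rho_beta"

lemmas parameter_defs = rho_beta_def rho_nu_def growth_beta_def growth_mixed_def l_gain_def inflation_def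
  weighted_mixed_def plain_mixed_def

lemma parameters_nonneg: "1 \<le> l" "0 \<le> s" "0 \<le> rho_beta" "0 \<le> rho_nu" "0 \<le> weighted_mixed" "0 \<le> plain_mixed"
  unfolding parameter_defs unfolding l_eq s_eq using d_nonneg p_bounds by simp_all

lemma interpolation_nonneg:
  "0 \<le> u \<Longrightarrow> 0 \<le> v \<Longrightarrow> 0 \<le> w \<Longrightarrow> 0 \<le> 9 * (1/6 - p) * u + 9 * (p - 1/18) * v + (p - 1/18) * (1/6 - p) * w"
  using p_bounds by simp

lemma d_powers: "0 \<le> d\<^sup>2" "0 \<le> d^3" "0 \<le> d^4" "2 * d \<le> d\<^sup>2 + 1" "2 * d\<^sup>2 \<le> d^3 + d" "2 * d^3 \<le> d^4 + d\<^sup>2"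
proof -
  have "0 \<le> d^i * (d - 1)\<^sup>2" for i using d_nonneg by simp
  from this[of 0] this[of 1] this[of 2]
  show "0 \<le> d\<^sup>2" "0 \<le> d^3" "0 \<le> d^4" "2 * d \<le> d\<^sup>2 + 1" "2 * d\<^sup>2 \<le> d^3 + d" "2 * d^3 \<le> d^4 + d\<^sup>2"
    using d_nonneg by (simp_all add: eval_nat_numeral algebra_simps)
qed

text \<open>Both coefficients are quadratic in \<open>p\<close>: the certificates interpolate them at the ends of \<open>[1/18, 1/6]\<close>.\<close>

lemma beta_coefficient_nonneg:
  "0 \<le> (2 + 5 * d) * (2 * (l_gain - l * growth_beta - rho_beta * (s + 4 * p)) - 13/100 * (1 + 20 * d) * rho_beta\<^sup>2)
    - 5/2 * d * weighted_mixed - 5/32 * (1 + 20 * d) * plain_mixed" (is "0 \<le> ?F")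
proof -
  have "?F = 9 * (1/6 - p) * (75132361/12960000 + 5679217/648000 * d - 66607/34560 * d\<^sup>2 - 6733/14400 * d^3 + 99/20 * d^4)
        + 9 * (p - 1/18) * (12613883/1920000 + 331877/72000 * d + 9670399/1152000 * d\<^sup>2 + 27839/6400 * d^3 + 99/20 * d^4)
        + (p - 1/18) * (1/6 - p) * (19018991/160000 + 3295639/6400 * d + 42657/200 * d\<^sup>2)"
    unfolding parameter_defs unfolding r_eq s_eq l_eq by algebra
  also have "0 \<le> \<dots>" by (rule interpolation_nonneg) (use d_powers d_nonneg in linarith)+
  finally show ?thesis .
qed

definition nu_coefficient :: "real \<Rightarrow> real" where
  "nu_coefficient t = 81/50 * l * l_gain - l * inflation - 22/25 * r * l\<^sup>2 - 9/5 * s * d * l\<^sup>2 - 15/8 * s * d * l * rho_nu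
    - 26/25 * d\<^sup>2 * rho_nu\<^sup>2 - 2 * d * inflation * rho_nu - 2 * t * d * rho_nu * (17/6 * p)"

lemma nu_coefficient_two_fifths_nonneg:
  "0 \<le> nu_coefficient (2/5) - (2 + 5 * d) / 5 * (4/5 * weighted_mixed + plain_mixed)" (is "0 \<le> ?F")
proof -
  have "?F = 9 * (1/6 - p) * (67684/50625 + 6644653/2700000 * d + 5371151/1620000 * d\<^sup>2 + 80411/22500 * d^3 + 3621/2500 * d^4)
        + 9 * (p - 1/18) * (793157/450000 + 25409/3600000 * d - 1359749/1200000 * d\<^sup>2 + 220099/150000 * d^3 + 3621/2500 * d^4)
        + (p - 1/18) * (1/6 - p) * (3064/125 + 20590593/200000 * d + 2262413/40000 * d\<^sup>2)"
    unfolding nu_coefficient_def parameter_defs unfolding r_eq s_eq l_eq by algebra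
  also have "0 \<le> \<dots>" by (rule interpolation_nonneg) (use d_powers d_nonneg in linarith)+
  finally show ?thesis .
qed

lemma nu_coefficient_nonneg:
  assumes t: "t \<le> 2/5"
  shows "0 \<le> nu_coefficient t - (2 + 5 * d) / 5 * (2 * t * weighted_mixed + plain_mixed)"
proof -
  have "nu_coefficient t - (2 + 5 * d) / 5 * (2 * t * weighted_mixed + plain_mixed)
      = nu_coefficient (2/5) - (2 + 5 * d) / 5 * (4/5 * weighted_mixed + plain_mixed)
        + (2/5 - t) * (2 * d * rho_nu * (17/6 * p) + 2/5 * (2 + 5 * d) * weighted_mixed)"
    by (simp add: nu_coefficient_def field_simps)
  also have "0 \<le> \<dots>"
    using t d_nonneg p_bounds parameters_nonneg
    by (intro add_nonneg_nonneg[OF nu_coefficient_two_fifths_nonneg] mult_nonneg_nonneg add_nonneg_nonneg) simp_all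
  finally show ?thesis .
qed

definition total_loss :: "real \<Rightarrow> real \<Rightarrow> real \<Rightarrow> real" where
  "total_loss \<beta> \<nu> \<rho> = d * (2 * c * growth_loss l p s \<beta> \<nu> \<rho> + 2 * (1 + 8/3 * p / l) * \<nu> * \<rho> + 26/25 * d * \<rho>\<^sup>2)
    + (1 + 8/3 * p / l) * \<nu>\<^sup>2 + 9/5 * s * d * \<nu> * (25/24 * \<rho> + \<nu>) + 22/25 * r * \<nu>\<^sup>2"

lemma total_loss_mono:
  assumes "0 \<le> \<beta>" "0 \<le> \<nu>" "0 \<le> \<rho>" "\<rho> \<le> \<rho>'"
  shows "total_loss \<beta> \<nu> \<rho> \<le> total_loss \<beta> \<nu> \<rho>'"
  unfolding total_loss_def growth_loss_def
  using assms d_nonneg p_bounds parameters_nonneg(1,2) defect_weight_bounds(1)[OF parameters_nonneg(1)]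
  by (intro order_refl add_mono mult_left_mono power_mono) (simp_all add: c_eq)

lemma l_power2_total_loss:
  "l\<^sup>2 * (l_gain / l * (2 * c * d * \<beta>\<^sup>2 + 81/50 * \<nu>\<^sup>2) - total_loss \<beta> \<nu> ((rho_beta * \<beta> + rho_nu * \<nu>) / l))
    = d * (c * l * (2 * (l_gain - l * growth_beta - rho_beta * (s + 4 * p))) - 26/25 * d * rho_beta\<^sup>2) * \<beta>\<^sup>2
      - d * (2 * (c * l) * weighted_mixed + plain_mixed) * (\<beta> * \<nu>) + nu_coefficient (c * l) * \<nu>\<^sup>2"
proof -
  define \<rho> where "\<rho> = rho_beta * \<beta> + rho_nu * \<nu>"
  have l_pos: "0 < l" using parameters_nonneg(1) by linarith
  have "growth_loss l p s \<beta> \<nu> (\<rho> / l)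
      = growth_beta * \<beta>\<^sup>2 + growth_mixed * (\<beta> * \<nu>) + ((s + 4 * p) * \<beta> + 17/6 * p * \<nu>) * (\<rho> / l)"
    unfolding growth_loss_def growth_beta_def growth_mixed_def unfolding l_eq by (simp add: power2_eq_square field_simps)
  moreover have "1 + 8/3 * p / l = inflation / l" using l_pos by (simp add: inflation_def add_divide_distrib)
  ultimately have loss_eq: "total_loss \<beta> \<nu> (\<rho> / l)
      = d * (2 * c * (growth_beta * \<beta>\<^sup>2 + growth_mixed * (\<beta> * \<nu>) + ((s + 4 * p) * \<beta> + 17/6 * p * \<nu>) * (\<rho> / l))
        + 2 * (inflation / l) * \<nu> * (\<rho> / l) + 26/25 * d * (\<rho> / l)\<^sup>2)
        + inflation / l * \<nu>\<^sup>2 + 9/5 * s * d * \<nu> * (25/24 * (\<rho> / l) + \<nu>) + 22/25 * r * \<nu>\<^sup>2"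
    unfolding total_loss_def by (simp only:)
  have "l\<^sup>2 * total_loss \<beta> \<nu> (\<rho> / l)
      = d * (2 * c * (l\<^sup>2 * (growth_beta * \<beta>\<^sup>2 + growth_mixed * (\<beta> * \<nu>)) + l * \<rho> * ((s + 4 * p) * \<beta> + 17/6 * p * \<nu>))
        + 2 * inflation * \<nu> * \<rho> + 26/25 * d * \<rho>\<^sup>2)
        + l * inflation * \<nu>\<^sup>2 + 9/5 * s * d * \<nu> * (25/24 * (l * \<rho>) + l\<^sup>2 * \<nu>) + 22/25 * r * l\<^sup>2 * \<nu>\<^sup>2"
    unfolding loss_eq using l_pos by (simp add: power2_eq_square field_simps)
  moreover have "l\<^sup>2 * (l_gain / l * (2 * c * d * \<beta>\<^sup>2 + 81/50 * \<nu>\<^sup>2)) = l * l_gain * (2 * c * d * \<beta>\<^sup>2 + 81/50 * \<nu>\<^sup>2)"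
    using l_pos by (simp add: power2_eq_square)
  ultimately show ?thesis
    unfolding \<rho>_def right_diff_distrib[of "l\<^sup>2"] weighted_mixed_def plain_mixed_def nu_coefficient_def by algebra
qed

theorem growth_balance:
  assumes nonneg: "0 \<le> \<beta>" "0 \<le> \<nu>" "0 \<le> \<rho>" and \<rho>_le: "l * \<rho> \<le> (l + 12/5 * p) * \<beta> + (l + 13/10 * p) * \<nu>"
    and gain: "141/50 * l\<^sup>2 + 1269/500 * r * l + r - r / l \<le> gain"
  shows "total_loss \<beta> \<nu> \<rho> \<le> gain * (2 * c * d * \<beta>\<^sup>2 + 81/50 * \<nu>\<^sup>2)"
proof -
  let ?\<rho> = "(rho_beta * \<beta> + rho_nu * \<nu>) / l"
  have l_pos: "0 < l" using parameters_nonneg(1) by linarith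
  have c_nonneg: "0 \<le> c" unfolding c_eq by (rule defect_weight_bounds(1)[OF parameters_nonneg(1)])
  then have c_l: "0 \<le> c * l" "c * l \<le> 2/5" "c * l * (1 + 20 * d) = 8 * d"
    using defect_weight_bounds(2,4)[OF parameters_nonneg(1), folded c_eq] l_pos by (simp_all add: l_eq)
  have "total_loss \<beta> \<nu> \<rho> \<le> total_loss \<beta> \<nu> ?\<rho>"
    using nonneg \<rho>_le l_pos
    by (intro total_loss_mono) (simp_all add: rho_beta_def rho_nu_def pos_le_divide_eq mult.commute)
  also have "\<dots> \<le> l_gain / l * (2 * c * d * \<beta>\<^sup>2 + 81/50 * \<nu>\<^sup>2)"
  proof -
    have "0 \<le> l\<^sup>2 * (l_gain / l * (2 * c * d * \<beta>\<^sup>2 + 81/50 * \<nu>\<^sup>2) - total_loss \<beta> \<nu> ?\<rho>)"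
      unfolding l_power2_total_loss
      using c_l(1) parameters_nonneg
      by (intro quadratic_form_balance[OF d_nonneg c_l(1,3) _ beta_coefficient_nonneg nu_coefficient_nonneg[OF c_l(2)]]) simp
    then show ?thesis using l_pos by (simp add: zero_le_mult_iff)
  qed
  also have "\<dots> \<le> gain * (2 * c * d * \<beta>\<^sup>2 + 81/50 * \<nu>\<^sup>2)"
  proof (rule mult_right_mono)
    have "l_gain / l = 141/50 * l\<^sup>2 + 1269/500 * r * l + r * d / l"
      using l_pos by (simp add: l_gain_def field_simps power2_eq_square power3_eq_cube)
    also have "r * d / l = r - r / l" using l_pos by (simp add: l_eq field_simps)
    finally show "l_gain / l \<le> gain" using gain by simp
  qed (use d_nonneg c_nonneg in simp)
  finally show ?thesis .
qed

end

section \<open>The first stage in a test direction\<close>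

context two_stage
begin

definition footprint :: "'v \<Rightarrow> real" where
  "footprint v = norm (us v) / 2 + norm (us (shifted (1/2) v))"

lemma footprint_nonneg: "0 \<le> footprint v"
  by (simp add: footprint_def)

lemma footprint_add_le: "footprint (v + w) \<le> footprint v + footprint w"
  using norm_triangle_ineq[of "us v" "us w"]
    norm_triangle_ineq[of "us (shifted (1/2) v)" "us (shifted (1/2) w)"]
  by (simp add: footprint_def linear_simps)

lemma footprint_le: "footprint v \<le> sqrt l * norm v"
proof -
  have "norm (us (shifted (1/2) v)) \<le> sqrt l * (1/2 * norm v)"
    by (rule order_trans[OF norm_us_le mult_left_mono[OF norm_shifted_le]]) (use l_ge in simp_all)
  then show ?thesis using norm_us_le[of v] by (simp add: footprint_def)
qed

lemma norm_us_shifted_le_footprint: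
  assumes "0 \<le> t" "t \<le> 1"
  shows "norm (us (shifted t v)) \<le> footprint v"
proof -
  have "us (shifted t v) = us (shifted (1/2) v) + (1/2 - t) *\<^sub>R us v"
    by (simp add: shifted_def linear_simps algebra_simps)
  then have "norm (us (shifted t v)) \<le> norm (us (shifted (1/2) v)) + \<bar>1/2 - t\<bar> * norm (us v)"
    using norm_triangle_ineq[of "us (shifted (1/2) v)" "(1/2 - t) *\<^sub>R us v"] by simp
  also have "\<dots> \<le> norm (us (shifted (1/2) v)) + 1/2 * norm (us v)"
  proof (intro add_left_mono mult_right_mono)
    show "\<bar>1/2 - t\<bar> \<le> 1/2" using assms by linarith
  qed simp
  finally show ?thesis by (simp add: footprint_def)
qed

lemma norm_skew_le_footprint: "norm (skew v) \<le> sqrt l * footprint v"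
proof -
  have "norm (skew v) \<le> norm (shifted (1/2) (u (us v))) + norm (u (us (shifted (1/2) v)))"
    unfolding skew_eq_shifted[of v "1/2"] by (rule norm_triangle_ineq4)
  also have "\<dots> \<le> 1/2 * norm (u (us v)) + norm (u (us (shifted (1/2) v)))"
    using norm_shifted_le[of "1/2" "1/2" "u (us v)"] by simp
  also have "\<dots> \<le> 1/2 * (sqrt l * norm (us v)) + sqrt l * norm (us (shifted (1/2) v))"
    by (intro add_mono mult_left_mono norm_u_le) auto
  finally show ?thesis by (simp add: footprint_def algebra_simps)
qed

lemma norm_skew_le: "norm (skew v) \<le> l * norm v"
  using order_trans[OF norm_skew_le_footprint mult_left_mono[OF footprint_le]] l_ge
  by (simp add: sqrt_l_mult)

lemma norm_us_image_skew_le: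
  assumes "norm (P (skew v)) \<le> m * norm (skew v)" "0 \<le> m"
  shows "norm (us (P (skew v))) \<le> m * l * footprint v"
proof -
  have "norm (us (P (skew v))) \<le> sqrt l * (m * norm (skew v))"
    by (rule order_trans[OF norm_us_le mult_left_mono[OF assms(1)]]) (use l_ge in simp)
  also have "\<dots> \<le> sqrt l * (m * (sqrt l * footprint v))"
    using assms l_ge by (intro mult_left_mono norm_skew_le_footprint) auto
  finally show ?thesis by (simp only: sqrt_l_mult)
qed

lemma norm_mid_adj_skew_le: "norm (mid_adj (skew v)) \<le> l * footprint v"
  using order_trans[OF norm_mid_adj_le mult_left_mono[OF norm_skew_le_footprint]] l_ge
  by (simp add: sqrt_l_mult)

lemma norm_incr_adj_le: "norm (incr_adj v) \<le> x * l * footprint v"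
  using mult_left_mono[OF norm_mid_adj_skew_le, of x v] x_pos by (simp add: incr_adj_eq_skew mult.assoc)

lemma norm_incr_le: "norm (incr \<xi>) \<le> x * l * (sqrt l * norm \<xi>)"
proof -
  have "norm (skew (mid \<xi>)) \<le> l * (sqrt l * norm \<xi>)"
    using l_ge by (intro order_trans[OF norm_skew_le mult_left_mono[OF norm_mid_le]]) auto
  then show ?thesis using x_pos by (simp add: incr_eq_skew mult_left_mono mult.assoc)
qed

end

locale test_direction = two_stage G u uh us uhs x l
  for G :: "'v::real_inner \<Rightarrow> 'v" and u uh :: "'e::real_inner \<Rightarrow> 'v" and us uhs x l +
  fixes b \<mu> :: real and \<phi> :: 'e
  assumes norm_defect_le: "norm (defect \<xi>) \<le> d * norm \<xi>"
    and defect_ge: "- (1/10 * (\<xi> \<bullet> \<xi>)) \<le> \<xi> \<bullet> defect \<xi>"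
    and norm_us_le_green: "norm (us v) \<le> sqrt b * green_norm v"
    and norm_uhs_le_green: "norm (uhs v) \<le> sqrt b * green_norm v"
    and l_le_b: "l \<le> b"
    and mu: "0 \<le> \<mu>" "\<mu> \<le> 1"
    and x_le: "x * (141/50 * (b + 9/10) * l\<^sup>2 + l) \<le> 1"
begin

text \<open>\<open>residual\<close> measures how far \<open>u \<phi>\<close> is from an eigenvector of \<open>G\<close> with eigenvalue \<open>\<mu>\<close>. All errors are measured in
  \<open>\<beta>\<close> and \<open>\<nu>\<close>; the numbers \<open>s\<close> and \<open>p\<close>, with \<open>sqrt r \<le> s\<close> and \<open>x l\<^sup>2 \<le> p\<close>, express the constants through \<open>r = l / b\<close>.\<close>

definition residual :: 'v where "residual = shifted \<mu> (u \<phi>)"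
definition ritz_residual :: 'e where "ritz_residual = ritz_hat \<phi> - \<mu> *\<^sub>R \<phi>"
definition \<gamma> :: real where "\<gamma> = green_norm residual"
definition \<kappa> :: real where "\<kappa> = green_norm (uh (defect \<phi>))"
definition \<beta> :: real where "\<beta> = sqrt b * \<gamma>"
definition \<nu> :: real where "\<nu> = 10/9 * (sqrt b * \<kappa>)"
definition r :: real where "r = l / b"
definition s :: real where "s = 1/3 + 3/4 * r"
definition p :: real where "p = 1/18 + 1/9 * r"

lemma b_pos: "0 < b"
  using l_le_b l_ge by linarith

lemma gamma_nonneg: "0 \<le> \<gamma>" and kappa_nonneg: "0 \<le> \<kappa>"
  by (simp_all add: \<gamma>_def \<kappa>_def green_norm_nonneg)

lemma beta_nonneg: "0 \<le> \<beta>" and nu_nonneg: "0 \<le> \<nu>"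
  using b_pos gamma_nonneg kappa_nonneg by (simp_all add: \<beta>_def \<nu>_def)

lemma r_bounds: "0 \<le> r" "r \<le> 1" "r * b = l"
  using b_pos l_ge l_le_b by (simp_all add: r_def)

lemma p_bounds: "1/18 \<le> p" "p \<le> 1/6"
  using r_bounds by (simp_all add: p_def)

lemma sqrt_l_le: "sqrt l \<le> s * sqrt b"
proof (rule real_le_lsqrt)
  have "0 \<le> (1/3 - 3/4 * r)\<^sup>2" by simp
  then have "r \<le> s\<^sup>2" by (simp add: s_def power2_eq_square algebra_simps)
  then have "r * b \<le> s\<^sup>2 * b" using b_pos by (intro mult_right_mono) simp_all
  then show "l \<le> (s * sqrt b)\<^sup>2" using r_bounds(3) b_pos by (simp add: power_mult_distrib)
qed (use l_ge r_bounds b_pos in \<open>simp_all add: s_def\<close>)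

lemma s_nonneg: "0 \<le> s"
  using r_bounds by (simp add: s_def)

lemma sqrt_l_gamma_le: "sqrt l * \<gamma> \<le> s * \<beta>" and sqrt_l_kappa_le: "sqrt l * \<kappa> \<le> 9/10 * s * \<nu>"
  using mult_right_mono[OF sqrt_l_le gamma_nonneg] mult_right_mono[OF sqrt_l_le kappa_nonneg]
  by (simp_all add: \<beta>_def \<nu>_def mult_ac)

lemma norm_defect_le_nu: "norm (defect \<phi>) \<le> \<nu>"
proof (cases "defect \<phi> = 0")
  case False
  let ?n = "norm (defect \<phi>)"
  have "9/10 * (?n * ?n) \<le> defect \<phi> \<bullet> (defect \<phi> + defect (defect \<phi>))"
    using defect_ge[of "defect \<phi>"] by (simp add: inner_add_right power2_norm_eq_inner flip: power2_eq_square)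
  also have "defect \<phi> + defect (defect \<phi>) = uhs (uh (defect \<phi>))" by (simp add: uhs_uh us_u)
  also have "defect \<phi> \<bullet> uhs (uh (defect \<phi>)) \<le> ?n * norm (uhs (uh (defect \<phi>)))" by (rule norm_cauchy_schwarz)
  also have "\<dots> \<le> ?n * (sqrt b * \<kappa>)"
    unfolding \<kappa>_def by (intro mult_left_mono norm_uhs_le_green) simp
  finally have "?n * (9/10 * ?n) \<le> ?n * (sqrt b * \<kappa>)" by simp
  then have "9/10 * ?n \<le> sqrt b * \<kappa>" by (rule mult_left_le_imp_le) (use False in simp)
  then show ?thesis by (simp add: \<nu>_def)
qed (use nu_nonneg in simp)

lemma x_l_power2_le: "x * l\<^sup>2 \<le> p"
proof -
  have "0 \<le> (141/50 * (1 + 2 * r) * (l + 1) - (18 - 1269/500 * (1 + 2 * r)) * r) * d + (141/50 - 4411/500 * r + 1769/250 * r\<^sup>2)"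
  proof (rule add_nonneg_nonneg[OF mult_nonneg_nonneg[OF _ d_nonneg]])
    have "(18 - 1269/500 * (1 + 2 * r)) * r \<le> (18 - 1269/500) * r"
      by (rule mult_right_mono) (use r_bounds in simp_all)
    also have "\<dots> \<le> 141/50 * (1 + 2 * r) * 2" using r_bounds by simp
    also have "\<dots> \<le> 141/50 * (1 + 2 * r) * (l + 1)" by (rule mult_left_mono) (use r_bounds l_ge in simp_all)
    finally show "0 \<le> 141/50 * (1 + 2 * r) * (l + 1) - (18 - 1269/500 * (1 + 2 * r)) * r"
      by (simp only: diff_ge_0_iff_ge)
    have "0 \<le> 1769/250 * (r - 623/1000)\<^sup>2" by simp
    then show "0 \<le> 141/50 - 4411/500 * r + 1769/250 * r\<^sup>2" using r_bounds by (simp add: power2_eq_square algebra_simps)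
  qed
  also have "\<dots> = (1 + 2 * r) * (141/50 * l\<^sup>2 + 1269/500 * r * l + r) - 18 * r * l"
    by (simp add: d_def power2_eq_square field_simps)
  finally have "18 * r * l * (x * l) \<le> (1 + 2 * r) * (141/50 * l\<^sup>2 + 1269/500 * r * l + r) * (x * l)"
    using x_pos l_ge by (intro mult_right_mono) simp_all
  also have "\<dots> = (1 + 2 * r) * x * (141/50 * (r * b) * l\<^sup>2 + 1269/500 * r * l\<^sup>2 + r * l)"
    unfolding r_bounds(3) by algebra
  also have "\<dots> = (1 + 2 * r) * r * (x * (141/50 * (b + 9/10) * l\<^sup>2 + l))" by algebra
  also have "\<dots> \<le> (1 + 2 * r) * r * 1" using r_bounds by (intro mult_left_mono x_le) simp
  finally have "r * (18 * (x * l\<^sup>2)) \<le> r * (1 + 2 * r)" by (simp add: power2_eq_square mult_ac)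
  moreover have "0 < r" using b_pos l_ge by (simp add: r_def)
  ultimately show ?thesis by (simp add: p_def)
qed

lemma x_bounds: "x * l \<le> 1/6" "x \<le> 1/6" "0 \<le> x * l"
proof -
  have "x * l \<le> x * l\<^sup>2" "x * 1 \<le> x * l"
    using x_pos l_ge by (intro mult_left_mono; simp add: power2_eq_square)+
  then show "x * l \<le> 1/6" "x \<le> 1/6" using x_l_power2_le p_bounds by linarith+
qed (use x_pos l_ge in simp_all)

lemma x_l_mult_le: "x * l * t \<le> p * t" "x * l\<^sup>2 * t \<le> p * t" if "0 \<le> t"
proof -
  have "x * l \<le> x * l\<^sup>2" using x_pos l_ge by (intro mult_left_mono) (simp_all add: power2_eq_square)
  then show "x * l * t \<le> p * t" "x * l\<^sup>2 * t \<le> p * t"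
    using x_l_power2_le that by (intro mult_right_mono; simp)+
qed

lemma p_mult_le: "0 \<le> t \<Longrightarrow> p * t \<le> 1/6 * t"
  by (intro mult_right_mono p_bounds)

lemma x_mu_bounds: "0 \<le> x * \<mu>" "x * \<mu> \<le> x" "x * \<mu> \<le> 1/6"
proof -
  show "0 \<le> x * \<mu>" "x * \<mu> \<le> x" using x_pos mu by (simp_all add: mult_left_le)
  then show "x * \<mu> \<le> 1/6" using x_bounds(2) by linarith
qed

lemma norm_shifted_mu_le: "norm (shifted \<mu> v) \<le> norm v"
  using norm_shifted_le[of \<mu> 1 v] mu by simp

lemma norm_shifted_half_le: "norm (shifted (1/2) v) \<le> 1/2 * norm v"
  by (rule norm_shifted_le) simp_all

lemma green_norm_shifted_mu_le: "green_norm (shifted \<mu> v) \<le> green_norm v"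
  using green_norm_shifted_le[of \<mu> 1 v] mu by simp

lemma norm_us_image_residual_le:
  assumes "green_norm (P residual) \<le> m * green_norm residual"
  shows "norm (us (P residual)) \<le> m * \<beta>"
proof -
  have "norm (us (P residual)) \<le> sqrt b * (m * green_norm residual)"
    by (rule order_trans[OF norm_us_le_green mult_left_mono[OF assms]]) (use b_pos in simp)
  then show ?thesis by (simp add: \<beta>_def \<gamma>_def mult_ac)
qed

lemma norm_us_residual_le: "norm (us residual) \<le> \<beta>"
  using norm_us_image_residual_le[of "\<lambda>v. v" 1] by simp

lemma norm_us_shifted_residual_le: "norm (us (shifted \<mu> residual)) \<le> \<beta>"
  using norm_us_image_residual_le[of "shifted \<mu>" 1] green_norm_shifted_mu_le by simp

lemma norm_us_half_residual_le: "norm (us (shifted (1/2) residual)) \<le> 1/2 * \<beta>"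
  by (rule norm_us_image_residual_le, rule green_norm_shifted_le) simp_all

lemma norm_us_half_shifted_residual_le: "norm (us (shifted (1/2) (shifted \<mu> residual))) \<le> 1/2 * \<beta>"
proof (rule norm_us_image_residual_le)
  show "green_norm (shifted (1/2) (shifted \<mu> residual)) \<le> 1/2 * green_norm residual"
    using green_norm_shifted_le[of "1/2" "1/2" "shifted \<mu> residual"] green_norm_shifted_mu_le[of residual] by simp
qed

lemma norm_us_G_residual_le: "norm (us (G residual)) \<le> \<beta>"
  using norm_us_image_residual_le[of "shifted 0" 1] green_norm_shifted_le[of 0 1 residual] by (simp add: shifted_def)

lemma footprint_residual_le: "footprint residual \<le> \<beta>"
  using norm_us_residual_le norm_us_half_residual_le by (simp add: footprint_def)

text \<open>The increment is controlled through \<open>us\<close> alone: \<open>residual\<close> need not be small in norm, but \<open>us residual\<close> and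
  \<open>us (G residual)\<close> are at most \<open>\<beta>\<close>, which the growth of the residual in the Green norm dominates.\<close>

lemma incr_eq:
  "incr \<phi> = x *\<^sub>R (residual - u (us residual) + shifted \<mu> (u (defect \<phi>)) + (1/2) *\<^sub>R skew (incr \<phi>))"
proof -
  have "incr \<phi> = x *\<^sub>R skew (u \<phi> + (1/2) *\<^sub>R incr \<phi>)"
    by (rule incr_eq_skew[unfolded mid_eq])
  also have "skew (u \<phi> + (1/2) *\<^sub>R incr \<phi>) = skew (u \<phi>) + (1/2) *\<^sub>R skew (incr \<phi>)"
    by (simp add: linear_simps)
  also have "skew (u \<phi>) = shifted \<mu> (u (us (u \<phi>))) - u (us residual)"
    by (simp add: skew_eq_shifted[of _ \<mu>] residual_def)
  also have "shifted \<mu> (u (us (u \<phi>))) = residual + shifted \<mu> (u (defect \<phi>))"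
    by (simp add: us_u residual_def linear_simps)
  finally show ?thesis by (simp add: algebra_simps)
qed

lemma norm_us_incr_le_footprint:
  "norm (us (incr \<phi>)) \<le> x * (d * \<beta> + l * \<nu> + 1/2 * l * footprint (incr \<phi>))"
proof -
  have us_incr_eq: "us (incr \<phi>) = x *\<^sub>R (us (shifted \<mu> (u (defect \<phi>))) - defect (us residual) + (1/2) *\<^sub>R us (skew (incr \<phi>)))"
    using arg_cong[OF incr_eq, of us] by (simp only: linear_simps us_u) (simp add: algebra_simps)
  have "norm (us (shifted \<mu> (u (defect \<phi>))) - defect (us residual) + (1/2) *\<^sub>R us (skew (incr \<phi>)))
      \<le> norm (us (shifted \<mu> (u (defect \<phi>)))) + norm (defect (us residual)) + norm ((1/2) *\<^sub>R us (skew (incr \<phi>)))"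
    by norm
  also have "\<dots> \<le> 1 * l * \<nu> + d * \<beta> + 1/2 * (1 * l * footprint (incr \<phi>))"
  proof (intro add_mono)
    show "norm (us (shifted \<mu> (u (defect \<phi>)))) \<le> 1 * l * \<nu>"
      using order_trans[OF norm_us_image_u_le[of "shifted \<mu>" "defect \<phi>" 1] mult_left_mono[OF norm_defect_le_nu]]
        norm_shifted_mu_le l_ge by simp
    show "norm (defect (us residual)) \<le> d * \<beta>"
      by (rule order_trans[OF norm_defect_le mult_left_mono[OF norm_us_residual_le d_nonneg]])
    show "norm ((1/2) *\<^sub>R us (skew (incr \<phi>))) \<le> 1/2 * (1 * l * footprint (incr \<phi>))"
      using norm_us_image_skew_le[of "\<lambda>v. v" _ 1] by simp
  qed
  finally show ?thesis unfolding us_incr_eq using x_pos by (simp add: add_ac)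
qed

lemma norm_us_image_incr_le_footprint:
  assumes lin: "linear P" and half: "\<And>v. norm (P v) \<le> 1/2 * norm v" and res: "norm (us (P residual)) \<le> 1/2 * \<beta>"
  shows "norm (us (P (incr \<phi>))) \<le> x * (1/2 * (1 + l) * \<beta> + 1/2 * l * \<nu> + 1/4 * l * footprint (incr \<phi>))"
proof -
  have us_image_incr_eq: "us (P (incr \<phi>)) = x *\<^sub>R (us (P residual) - us (P (u (us residual))) + us (P (shifted \<mu> (u (defect \<phi>))))
      + (1/2) *\<^sub>R us (P (skew (incr \<phi>))))"
    using arg_cong[OF incr_eq, of "\<lambda>v. us (P v)"]
    by (simp only: linear_simps linear_add[OF lin] linear_diff[OF lin] linear_scale[OF lin])
  have "norm (us (P residual) - us (P (u (us residual))) + us (P (shifted \<mu> (u (defect \<phi>))))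
        + (1/2) *\<^sub>R us (P (skew (incr \<phi>))))
      \<le> norm (us (P residual)) + norm (us (P (u (us residual)))) + norm (us (P (shifted \<mu> (u (defect \<phi>)))))
        + norm ((1/2) *\<^sub>R us (P (skew (incr \<phi>))))"
    by norm
  also have "\<dots> \<le> 1/2 * \<beta> + 1/2 * l * \<beta> + 1/2 * l * \<nu> + 1/2 * (1/2 * l * footprint (incr \<phi>))"
  proof (intro add_mono res)
    have "norm (us (P (u (us residual)))) \<le> 1/2 * l * norm (us residual)"
      by (rule norm_us_image_u_le) (use half in simp_all)
    also have "\<dots> \<le> 1/2 * l * \<beta>" using l_ge by (intro mult_left_mono norm_us_residual_le) simp
    finally show "norm (us (P (u (us residual)))) \<le> 1/2 * l * \<beta>" .
    have "norm (us (P (shifted \<mu> (u (defect \<phi>))))) \<le> 1/2 * l * norm (defect \<phi>)"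
    proof (rule norm_us_image_u_le[of "\<lambda>v. P (shifted \<mu> v)"])
      show "norm (P (shifted \<mu> (u (defect \<phi>)))) \<le> 1/2 * norm (u (defect \<phi>))"
        using half[of "shifted \<mu> (u (defect \<phi>))"] norm_shifted_mu_le[of "u (defect \<phi>)"] by linarith
    qed simp
    also have "\<dots> \<le> 1/2 * l * \<nu>" using l_ge by (intro mult_left_mono norm_defect_le_nu) simp
    finally show "norm (us (P (shifted \<mu> (u (defect \<phi>))))) \<le> 1/2 * l * \<nu>" .
    show "norm ((1/2) *\<^sub>R us (P (skew (incr \<phi>)))) \<le> 1/2 * (1/2 * l * footprint (incr \<phi>))"
      using norm_us_image_skew_le[of P "incr \<phi>" "1/2"] half by simp
  qed
  also have "\<dots> = 1/2 * (1 + l) * \<beta> + 1/2 * l * \<nu> + 1/4 * l * footprint (incr \<phi>)"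
    by (simp add: algebra_simps add_divide_distrib)
  finally show ?thesis unfolding us_image_incr_eq using x_pos by (simp add: mult_left_mono)
qed

lemma l_footprint_incr_le: "l * footprint (incr \<phi>) \<le> 11/10 * p * (\<beta> + \<nu>)"
proof -
  let ?f = "footprint (incr \<phi>)"
  have "?f \<le> x * (d * \<beta> + l * \<nu> + 1/2 * l * ?f) / 2 + x * (1/2 * (1 + l) * \<beta> + 1/2 * l * \<nu> + 1/4 * l * ?f)"
    using norm_us_incr_le_footprint norm_us_image_incr_le_footprint[OF shifted_linear norm_shifted_half_le norm_us_half_residual_le]
      footprint_def[of "incr \<phi>"] by linarith
  also have "\<dots> = x * l * (\<beta> + \<nu> + 1/2 * ?f)"
    by (simp add: d_def algebra_simps add_divide_distrib diff_divide_distrib)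
  finally have "l * ?f \<le> l * (x * l * (\<beta> + \<nu> + 1/2 * ?f))" using l_ge by (intro mult_left_mono) simp_all
  also have "\<dots> = x * l\<^sup>2 * (\<beta> + \<nu> + 1/2 * ?f)" by (simp add: power2_eq_square)
  also have "\<dots> \<le> p * (\<beta> + \<nu> + 1/2 * ?f)"
    using beta_nonneg nu_nonneg footprint_nonneg by (intro x_l_mult_le) simp
  also have "\<dots> = p * (\<beta> + \<nu>) + p * (1/2 * ?f)" by (simp only: distrib_left)
  also have "\<dots> \<le> p * (\<beta> + \<nu>) + 1/6 * (1/2 * ?f)"
    by (intro add_left_mono p_mult_le) (simp add: footprint_nonneg)
  finally have "l * ?f \<le> p * (\<beta> + \<nu>) + 1/12 * ?f" by simp
  moreover have "1 * ?f \<le> l * ?f" using l_ge by (intro mult_right_mono footprint_nonneg)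
  moreover have "0 \<le> p * (\<beta> + \<nu>)" using p_bounds beta_nonneg nu_nonneg by simp
  ultimately show ?thesis by (simp only: mult.assoc)
qed

lemma footprint_le_l: "footprint v \<le> l * footprint v"
  using mult_right_mono[OF l_ge footprint_nonneg[of v]] by simp

lemma l_footprint_shifted_incr_le: "l * footprint (shifted \<mu> (incr \<phi>)) \<le> p * (8/5 * \<beta> + 11/10 * \<nu>)"
proof -
  let ?f = "footprint (incr \<phi>)"
  have "norm (us (shifted (1/2) (shifted \<mu> (incr \<phi>)))) \<le> x * (1/2 * (1 + l) * \<beta> + 1/2 * l * \<nu> + 1/4 * l * ?f)"
  proof (rule norm_us_image_incr_le_footprint[of "\<lambda>v. shifted (1/2) (shifted \<mu> v)"])
    show "linear (\<lambda>v. shifted (1/2) (shifted \<mu> v))"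
      using linear_compose[OF shifted_linear shifted_linear] by (simp add: o_def)
    show "norm (shifted (1/2) (shifted \<mu> v)) \<le> 1/2 * norm v" for v
      using norm_shifted_half_le[of "shifted \<mu> v"] norm_shifted_mu_le[of v] by linarith
  qed (rule norm_us_half_shifted_residual_le)
  also have "\<dots> \<le> x * (l * (\<beta> + 1/2 * \<nu> + 1/4 * ?f))"
  proof (intro mult_left_mono)
    show "1/2 * (1 + l) * \<beta> + 1/2 * l * \<nu> + 1/4 * l * ?f \<le> l * (\<beta> + 1/2 * \<nu> + 1/4 * ?f)"
      using mult_right_mono[OF l_ge beta_nonneg] by (simp add: algebra_simps add_divide_distrib)
  qed (use x_pos in simp)
  finally have "l * norm (us (shifted (1/2) (shifted \<mu> (incr \<phi>)))) \<le> l * (x * (l * (\<beta> + 1/2 * \<nu> + 1/4 * ?f)))"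
    using l_ge by (intro mult_left_mono) simp_all
  also have "\<dots> = x * l\<^sup>2 * (\<beta> + 1/2 * \<nu> + 1/4 * ?f)" by (simp add: power2_eq_square)
  also have "\<dots> \<le> p * (\<beta> + 1/2 * \<nu> + 1/4 * ?f)"
    using beta_nonneg nu_nonneg footprint_nonneg by (intro x_l_mult_le) simp
  also have "\<dots> \<le> p * (\<beta> + 1/2 * \<nu> + 1/4 * (11/60 * (\<beta> + \<nu>)))"
  proof (intro mult_left_mono add_left_mono)
    show "?f \<le> 11/60 * (\<beta> + \<nu>)"
      using l_footprint_incr_le footprint_le_l[of "incr \<phi>"] p_mult_le[of "\<beta> + \<nu>"] beta_nonneg nu_nonneg by simp
  qed (use p_bounds in simp_all)
  finally have shifted_part: "l * norm (us (shifted (1/2) (shifted \<mu> (incr \<phi>)))) \<le> p * (\<beta> + 1/2 * \<nu> + 1/4 * (11/60 * (\<beta> + \<nu>)))" .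
  have "l * norm (us (shifted \<mu> (incr \<phi>))) \<le> l * ?f"
    using l_ge by (intro mult_left_mono norm_us_shifted_le_footprint mu) simp
  then have "l * footprint (shifted \<mu> (incr \<phi>)) \<le> 1/2 * (11/10 * p * (\<beta> + \<nu>)) + p * (\<beta> + 1/2 * \<nu> + 1/4 * (11/60 * (\<beta> + \<nu>)))"
    using shifted_part l_footprint_incr_le unfolding footprint_def[of "shifted \<mu> (incr \<phi>)"] distrib_left[of l] by simp
  also have "\<dots> = p * (1/2 * (11/10 * (\<beta> + \<nu>)) + (\<beta> + 1/2 * \<nu> + 1/4 * (11/60 * (\<beta> + \<nu>))))"
    by (simp add: field_simps)
  also have "\<dots> \<le> p * (8/5 * \<beta> + 11/10 * \<nu>)"
    using p_bounds beta_nonneg nu_nonneg by (intro mult_left_mono) (simp_all add: field_simps)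
  finally show ?thesis .
qed

lemma norm_us_incr_le: "norm (us (incr \<phi>)) \<le> x * ((d + 11/20 * p) * \<beta> + (l + 11/20 * p) * \<nu>)"
proof -
  have "d * \<beta> + l * \<nu> + 1/2 * l * footprint (incr \<phi>) \<le> (d + 11/20 * p) * \<beta> + (l + 11/20 * p) * \<nu>"
    using l_footprint_incr_le by (simp add: algebra_simps)
  then show ?thesis using norm_us_incr_le_footprint mult_left_mono[OF _ less_imp_le[OF x_pos]] order_trans by blast
qed

lemma shifted_uh: "shifted \<mu> (uh \<phi>) = residual + shifted \<mu> (incr \<phi>)"
  by (simp add: uh_eq residual_def linear_simps)

lemma ritz_residual_eq: "ritz_residual = \<mu> *\<^sub>R defect \<phi> + uhs (shifted \<mu> (uh \<phi>))"
proof -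
  have "G (uh \<phi>) = \<mu> *\<^sub>R uh \<phi> + shifted \<mu> (uh \<phi>)" by (simp add: shifted_def)
  then show ?thesis
    by (simp add: ritz_residual_def ritz_hat_def linear_simps uhs_uh defect_def algebra_simps)
qed

lemma l_norm_ritz_residual_le: "l * norm ritz_residual \<le> (l + 12/5 * p) * \<beta> + (l + 13/10 * p) * \<nu>"
proof -
  let ?f = "footprint (shifted \<mu> (incr \<phi>))"
  have incr_adj: "l * norm (incr_adj (shifted \<mu> (uh \<phi>))) \<le> p * (\<beta> + (4/15 * \<beta> + 11/60 * \<nu>))"
  proof -
    have "?f \<le> 4/15 * \<beta> + 11/60 * \<nu>"
      using l_footprint_shifted_incr_le footprint_le_l[of "shifted \<mu> (incr \<phi>)"] p_mult_le[of "8/5 * \<beta> + 11/10 * \<nu>"]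
        beta_nonneg nu_nonneg by simp
    then have "footprint (shifted \<mu> (uh \<phi>)) \<le> \<beta> + (4/15 * \<beta> + 11/60 * \<nu>)"
      using footprint_add_le[of residual "shifted \<mu> (incr \<phi>)"] footprint_residual_le unfolding shifted_uh by linarith
    then have "l * norm (incr_adj (shifted \<mu> (uh \<phi>))) \<le> l * (x * l * (\<beta> + (4/15 * \<beta> + 11/60 * \<nu>)))"
      using l_ge x_bounds(3) by (intro mult_left_mono order_trans[OF norm_incr_adj_le mult_left_mono]) simp_all
    also have "\<dots> = x * l\<^sup>2 * (\<beta> + (4/15 * \<beta> + 11/60 * \<nu>))" by (simp add: power2_eq_square)
    also have "\<dots> \<le> p * (\<beta> + (4/15 * \<beta> + 11/60 * \<nu>))" using beta_nonneg nu_nonneg by (intro x_l_mult_le) simp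
    finally show ?thesis .
  qed
  have triangle: "norm (a + (b + c + e)) \<le> norm a + norm b + norm c + norm e" for a b c e :: 'e
    by norm
  have "ritz_residual = \<mu> *\<^sub>R defect \<phi> + (us residual + us (shifted \<mu> (incr \<phi>)) + incr_adj (shifted \<mu> (uh \<phi>)))"
    unfolding ritz_residual_eq incr_adj_def by (simp add: shifted_uh linear_simps)
  then have "norm ritz_residual \<le> norm (\<mu> *\<^sub>R defect \<phi>) + norm (us residual) + norm (us (shifted \<mu> (incr \<phi>)))
      + norm (incr_adj (shifted \<mu> (uh \<phi>)))"
    by (simp only: triangle)
  moreover have "norm (\<mu> *\<^sub>R defect \<phi>) \<le> \<nu>"
    using mu mult_mono[of \<mu> 1 "norm (defect \<phi>)" \<nu>] norm_defect_le_nu by simp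
  ultimately have "norm ritz_residual \<le> \<nu> + \<beta> + footprint (incr \<phi>) + norm (incr_adj (shifted \<mu> (uh \<phi>)))"
    using norm_us_residual_le norm_us_shifted_le_footprint[OF mu, of "incr \<phi>"] by linarith
  then have "l * norm ritz_residual \<le> l * (\<nu> + \<beta> + footprint (incr \<phi>) + norm (incr_adj (shifted \<mu> (uh \<phi>))))"
    using l_ge by (intro mult_left_mono) simp_all
  also have "\<dots> = l * \<nu> + l * \<beta> + l * footprint (incr \<phi>) + l * norm (incr_adj (shifted \<mu> (uh \<phi>)))"
    by (simp only: distrib_left)
  also have "\<dots> \<le> l * \<nu> + l * \<beta> + 11/10 * p * (\<beta> + \<nu>) + p * (\<beta> + (4/15 * \<beta> + 11/60 * \<nu>))"
    by (intro add_mono order_refl l_footprint_incr_le incr_adj)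
  also have "\<dots> = (l + 71/30 * p) * \<beta> + (l + 77/60 * p) * \<nu>" by (simp add: field_simps)
  also have "\<dots> \<le> (l + 12/5 * p) * \<beta> + (l + 13/10 * p) * \<nu>"
    using p_bounds beta_nonneg nu_nonneg by (intro add_mono mult_right_mono) simp_all
  finally show ?thesis .
qed

end

section \<open>The lag between the Ritz operators\<close>

context test_direction
begin

definition half_shifted :: "'v \<Rightarrow> 'v" where
  "half_shifted v = (1/2) *\<^sub>R G v - \<mu> *\<^sub>R v"

text \<open>The lag compares the Ritz operators at the end and at the midpoint of the first stage. At \<open>\<phi>\<close>, the
  quadratic form of the new defect is that of the old one at the pullback, up to a factor and an error of order \<open>x\<^sup>2\<close>, while
  the residual grows by the factor \<open>1 + x G\<close>.\<close>

definition lag :: 'e where "lag = x *\<^sub>R (ritz_hat \<phi> - us (G (mid \<phi>)))"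
definition pullback :: 'e where "pullback = \<phi> - x *\<^sub>R ritz_hat \<phi>"
definition drift :: 'v where "drift = (1/2) *\<^sub>R u (us (incr \<phi>)) - incr (defect \<phi>)"
definition change :: 'v where "change = x *\<^sub>R G (residual + shifted \<mu> drift) + shifted \<mu> (u lag)"
definition lag_remainder :: 'e where
  "lag_remainder = us (half_shifted (shifted \<mu> (u (defect \<phi>)))) + (1/2) *\<^sub>R us (half_shifted (skew (incr \<phi>)))
    - (1/2) *\<^sub>R incr_adj (skew residual) - mid_adj (skew (shifted \<mu> (incr \<phi>)))"

lemma half_shifted_linear: "linear half_shifted"
  by (rule linearI) (simp_all add: half_shifted_def linear_simps algebra_simps)

lemma norm_half_shifted_le: "norm (half_shifted v) \<le> norm v"
proof -
  have "half_shifted v = (1/2) *\<^sub>R shifted (2 * \<mu>) v" by (simp add: half_shifted_def shifted_def algebra_simps)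
  moreover have "norm (shifted (2 * \<mu>) v) \<le> 2 * norm v"
    using mu by (intro norm_shifted_le) auto
  ultimately show ?thesis by simp
qed

lemma lag_eq_incr: "lag = x *\<^sub>R (us (half_shifted (incr \<phi>)) + incr_adj (shifted \<mu> (uh \<phi>)))"
proof -
  have mid: "mid \<phi> = uh \<phi> - (1/2) *\<^sub>R incr \<phi>"
    by (simp add: mid_def incr_def algebra_simps flip: scaleR_add_left)
  have incr_adj_uh: "incr_adj (uh \<phi>) = - us (incr \<phi>)"
    by (simp add: incr_adj_def uhs_uh incr_def linear_simps)
  have G_uh: "G (uh \<phi>) = \<mu> *\<^sub>R uh \<phi> + shifted \<mu> (uh \<phi>)" by (simp add: shifted_def)
  have "ritz_hat \<phi> = us (G (uh \<phi>)) + incr_adj (G (uh \<phi>))" by (simp add: ritz_hat_def incr_adj_def)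
  also have "incr_adj (G (uh \<phi>)) = incr_adj (shifted \<mu> (uh \<phi>)) - \<mu> *\<^sub>R us (incr \<phi>)"
    by (subst G_uh) (simp add: linear_simps incr_adj_uh)
  finally have "ritz_hat \<phi> - us (G (mid \<phi>)) = us (half_shifted (incr \<phi>)) + incr_adj (shifted \<mu> (uh \<phi>))"
    by (simp add: mid linear_simps half_shifted_def)
  then show ?thesis by (simp add: lag_def)
qed

lemma us_half_shifted_incr:
  "us (half_shifted (incr \<phi>)) = x *\<^sub>R ((1/2) *\<^sub>R (us (G residual) - ritz (us residual)) + \<mu> *\<^sub>R defect (us residual)
    + us (half_shifted (shifted \<mu> (u (defect \<phi>)))) + (1/2) *\<^sub>R us (half_shifted (skew (incr \<phi>))))"
proof -
  have "us (half_shifted (incr \<phi>)) = x *\<^sub>R (us (half_shifted (residual - u (us residual)))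
      + us (half_shifted (shifted \<mu> (u (defect \<phi>)))) + (1/2) *\<^sub>R us (half_shifted (skew (incr \<phi>))))"
    using arg_cong[OF incr_eq, of "\<lambda>v. us (half_shifted v)"]
    by (simp only: linear_simps half_shifted_linear[THEN linear_add] half_shifted_linear[THEN linear_diff]
        half_shifted_linear[THEN linear_scale])
  also have "us (half_shifted (residual - u (us residual)))
      = (1/2) *\<^sub>R (us (G residual) - ritz (us residual)) + \<mu> *\<^sub>R defect (us residual)"
    by (simp add: half_shifted_def linear_simps ritz_def defect_def algebra_simps)
  finally show ?thesis .
qed

lemma incr_adj_shifted_uh:
  "incr_adj (shifted \<mu> (uh \<phi>)) = x *\<^sub>R (us (G residual) + defect (us (G residual)) - ritz (us residual)
    - (1/2) *\<^sub>R incr_adj (skew residual) - mid_adj (skew (shifted \<mu> (incr \<phi>))))"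
proof -
  have "mid_adj (skew residual) = us (skew residual) + (1/2) *\<^sub>R incr_adj (skew residual)"
    by (simp add: mid_adj_def incr_adj_def algebra_simps flip: scaleR_add_left)
  also have "us (skew residual) = ritz (us residual) - us (G residual) - defect (us (G residual))"
    by (simp add: skew_def linear_simps ritz_def defect_def)
  finally have "- mid_adj (skew residual)
      = us (G residual) + defect (us (G residual)) - ritz (us residual) - (1/2) *\<^sub>R incr_adj (skew residual)"
    by (simp add: algebra_simps)
  moreover have "incr_adj (shifted \<mu> (uh \<phi>))
      = x *\<^sub>R (- mid_adj (skew residual) - mid_adj (skew (shifted \<mu> (incr \<phi>))))"
    unfolding incr_adj_eq_skew[of "shifted \<mu> (uh \<phi>)"] unfolding shifted_uh by (simp add: linear_simps algebra_simps)
  ultimately show ?thesis by (simp only:)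
qed

lemma lag_expansion:
  "lag = (x * x) *\<^sub>R ((3/2) *\<^sub>R (us (G residual) - ritz (us residual))
    + defect (us (G residual) + \<mu> *\<^sub>R us residual) + lag_remainder)"
proof -
  have "(3/2) *\<^sub>R z = (1/2) *\<^sub>R z + z" for z :: 'e
    using scaleR_add_left[of "1/2" 1 z] by simp
  then show ?thesis
    by (simp add: lag_eq_incr us_half_shifted_incr incr_adj_shifted_uh lag_remainder_def linear_simps
        scaleR_add_right scaleR_diff_right)
qed

lemma norm_lag_remainder_le: "norm lag_remainder \<le> 8/3 * p * \<beta> + (l + 5/3 * p) * \<nu>"
proof -
  have triangle: "norm (a + b - c - e) \<le> norm a + norm b + norm c + norm e" for a b c e :: 'e
    by norm
  have "norm (us (half_shifted (shifted \<mu> (u (defect \<phi>))))) \<le> l * norm (defect \<phi>)"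
    using norm_us_image_u_le[of "\<lambda>v. half_shifted (shifted \<mu> v)" "defect \<phi>" 1]
      order_trans[OF norm_half_shifted_le norm_shifted_mu_le] by simp
  also have "\<dots> \<le> l * \<nu>" using l_ge by (intro mult_left_mono norm_defect_le_nu) simp
  finally have defect_part: "norm (us (half_shifted (shifted \<mu> (u (defect \<phi>))))) \<le> l * \<nu>" .
  have skew_part: "norm (us (half_shifted (skew (incr \<phi>)))) \<le> 11/10 * p * (\<beta> + \<nu>)"
    using norm_us_image_skew_le[of half_shifted "incr \<phi>" 1] norm_half_shifted_le l_footprint_incr_le by simp
  have "footprint (skew residual) \<le> sqrt l * (sqrt l * \<beta>)"
    using l_ge by (intro order_trans[OF footprint_le] order_trans[OF mult_left_mono[OF norm_skew_le_footprint]]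
        mult_left_mono footprint_residual_le) simp_all
  then have "norm (incr_adj (skew residual)) \<le> x * l * (l * \<beta>)"
    using x_bounds(3) by (intro order_trans[OF norm_incr_adj_le mult_left_mono]) (simp_all add: sqrt_l_mult)
  also have "\<dots> = x * l\<^sup>2 * \<beta>" by (simp add: power2_eq_square)
  also have "\<dots> \<le> p * \<beta>" by (rule x_l_mult_le(2)[OF beta_nonneg])
  finally have incr_part: "norm (incr_adj (skew residual)) \<le> p * \<beta>" .
  have mid_part: "norm (mid_adj (skew (shifted \<mu> (incr \<phi>)))) \<le> p * (8/5 * \<beta> + 11/10 * \<nu>)"
    by (rule order_trans[OF norm_mid_adj_skew_le l_footprint_shifted_incr_le])
  have "norm lag_remainder \<le> l * \<nu> + 1/2 * (11/10 * p * (\<beta> + \<nu>)) + 1/2 * (p * \<beta>) + p * (8/5 * \<beta> + 11/10 * \<nu>)"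
    unfolding lag_remainder_def
    by (rule order_trans[OF triangle]) (use defect_part skew_part incr_part mid_part in \<open>intro add_mono; simp\<close>)
  also have "\<dots> = (53/20 * p) * \<beta> + (l + 33/20 * p) * \<nu>" by (simp add: field_simps)
  also have "\<dots> \<le> (8/3 * p) * \<beta> + (l + 5/3 * p) * \<nu>"
    using p_bounds beta_nonneg nu_nonneg by (intro add_mono mult_right_mono) simp_all
  finally show ?thesis .
qed

lemma norm_ritz_shift_le: "norm (\<mu> *\<^sub>R \<xi> - ritz \<xi>) \<le> l * norm \<xi>"
proof (rule norm_symmetric_operator_le)
  show "linear (\<lambda>\<xi>. \<mu> *\<^sub>R \<xi> - ritz \<xi>)"
    by (intro linear_compose_sub linear_scale_self operators_linear)
  show "(\<mu> *\<^sub>R \<xi> - ritz \<xi>) \<bullet> \<zeta> = \<xi> \<bullet> (\<mu> *\<^sub>R \<zeta> - ritz \<zeta>)" for \<xi> \<zeta>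
    by (simp add: inner_diff_left inner_diff_right ritz_sym)
  show "\<bar>\<xi> \<bullet> (\<mu> *\<^sub>R \<xi> - ritz \<xi>)\<bar> \<le> l * (\<xi> \<bullet> \<xi>)" for \<xi>
  proof -
    have "0 \<le> \<xi> \<bullet> ritz \<xi>" by (simp add: inner_ritz G_nonneg)
    moreover have "\<mu> * (\<xi> \<bullet> \<xi>) \<le> l * (\<xi> \<bullet> \<xi>)" "0 \<le> \<mu> * (\<xi> \<bullet> \<xi>)" using mu l_ge by (simp_all add: mult_right_mono)
    ultimately show ?thesis using ritz_le[of \<xi>] by (simp add: inner_diff_right abs_le_iff)
  qed
qed (use l_ge in simp)

lemma norm_defect_image_le: "norm (defect (us (G residual) + \<mu> *\<^sub>R us residual)) \<le> 2 * d * \<beta>"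
proof -
  have "norm (us (G residual) + \<mu> *\<^sub>R us residual) \<le> norm (us (G residual)) + \<mu> * norm (us residual)"
    using norm_triangle_ineq[of "us (G residual)" "\<mu> *\<^sub>R us residual"] mu by simp
  also have "\<dots> \<le> \<beta> + 1 * \<beta>"
    using mu beta_nonneg by (intro add_mono mult_mono norm_us_G_residual_le norm_us_residual_le) auto
  finally have "d * norm (us (G residual) + \<mu> *\<^sub>R us residual) \<le> d * (2 * \<beta>)"
    by (intro mult_left_mono d_nonneg) simp
  then show ?thesis using norm_defect_le[of "us (G residual) + \<mu> *\<^sub>R us residual"] by simp
qed

text \<open>The leading term of the lag enters through a product \<open>a \<bullet> b \<ge> - |a - b|\<^sup>2 / 4\<close>.\<close>

lemma residual_lag_ge:
  "us (shifted \<mu> residual) \<bullet> lag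
    \<ge> - (x\<^sup>2 * (3/8 * l\<^sup>2 * \<beta>\<^sup>2 + \<beta> * (2 * d * \<beta> + 8/3 * p * \<beta> + (l + 5/3 * p) * \<nu>)))"
proof -
  define target where "target = us (shifted \<mu> residual)"
  define leading where "leading = us (G residual) - ritz (us residual)"
  define rest where "rest = defect (us (G residual) + \<mu> *\<^sub>R us residual) + lag_remainder"
  let ?rest = "2 * d * \<beta> + 8/3 * p * \<beta> + (l + 5/3 * p) * \<nu>"
  have "target - leading = ritz (us residual) - \<mu> *\<^sub>R us residual"
    by (simp add: target_def leading_def shifted_def linear_simps)
  then have "norm (target - leading) \<le> l * \<beta>"
    using order_trans[OF norm_ritz_shift_le mult_left_mono[OF norm_us_residual_le]] l_ge
    by (simp add: norm_minus_commute)
  then have "(norm (target - leading))\<^sup>2 \<le> (l * \<beta>)\<^sup>2" by (intro power_mono) auto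
  moreover have "(norm (target + leading))\<^sup>2 = (norm (target - leading))\<^sup>2 + 4 * (target \<bullet> leading)"
    by (simp add: power2_norm_eq_inner algebra_simps inner_commute[of leading target])
  then have "- ((norm (target - leading))\<^sup>2 / 4) \<le> target \<bullet> leading"
    using zero_le_power2[of "norm (target + leading)"] by linarith
  ultimately have leading_part: "- (3/8 * l\<^sup>2 * \<beta>\<^sup>2) \<le> 3/2 * (target \<bullet> leading)" by (simp add: power_mult_distrib)
  have "norm rest \<le> ?rest"
    unfolding rest_def using norm_defect_image_le norm_lag_remainder_le
    by (intro order_trans[OF norm_triangle_ineq]) linarith
  then have "\<bar>target \<bullet> rest\<bar> \<le> \<beta> * ?rest"
    unfolding target_def
    by (intro order_trans[OF Cauchy_Schwarz_ineq2] mult_mono norm_us_shifted_residual_le beta_nonneg) simp_all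
  with leading_part have "- (3/8 * l\<^sup>2 * \<beta>\<^sup>2 + \<beta> * ?rest) \<le> 3/2 * (target \<bullet> leading) + target \<bullet> rest" by linarith
  then have "x\<^sup>2 * - (3/8 * l\<^sup>2 * \<beta>\<^sup>2 + \<beta> * ?rest) \<le> x\<^sup>2 * (3/2 * (target \<bullet> leading) + target \<bullet> rest)"
    by (intro mult_left_mono) simp_all
  also have "\<dots> = target \<bullet> lag"
    unfolding lag_expansion by (simp add: leading_def rest_def inner_add_right power2_eq_square algebra_simps)
  finally show ?thesis by (simp only: target_def mult_minus_right)
qed

lemma norm_lag_le:
  "norm lag \<le> x\<^sup>2 * (3/2 * (1 + l) * \<beta> + 2 * d * \<beta> + 8/3 * p * \<beta> + (l + 5/3 * p) * \<nu>)" (is "_ \<le> x\<^sup>2 * ?bound")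
proof -
  let ?leading = "us (G residual) - ritz (us residual)" and ?defect = "defect (us (G residual) + \<mu> *\<^sub>R us residual)"
  have "norm (ritz (us residual)) \<le> 1 * l * norm (us residual)"
    unfolding ritz_def by (rule norm_us_image_u_le) (use norm_G_le in simp_all)
  also have "\<dots> \<le> l * \<beta>" using l_ge norm_us_residual_le by (simp add: mult_left_mono)
  finally have "norm ?leading \<le> (1 + l) * \<beta>"
    using norm_triangle_ineq4[of "us (G residual)" "ritz (us residual)"] norm_us_G_residual_le
    by (simp add: distrib_right)
  then have "norm ((3/2) *\<^sub>R ?leading + ?defect + lag_remainder)
      \<le> 3/2 * ((1 + l) * \<beta>) + 2 * d * \<beta> + (8/3 * p * \<beta> + (l + 5/3 * p) * \<nu>)"
    using norm_defect_image_le norm_lag_remainder_le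
    by (intro order_trans[OF norm_triangle_ineq] add_mono) simp_all
  also have "\<dots> = ?bound" by simp
  finally have "x\<^sup>2 * norm ((3/2) *\<^sub>R ?leading + ?defect + lag_remainder) \<le> x\<^sup>2 * ?bound"
    by (intro mult_left_mono) simp_all
  moreover have "\<bar>x * x\<bar> = x\<^sup>2" by (simp add: power2_eq_square)
  ultimately show ?thesis unfolding lag_expansion norm_scaleR by (simp only:)
qed

lemma upd_eq: "upd \<phi> = u pullback + x *\<^sub>R G (u \<phi> + drift) + u lag"
proof -
  have "us (mid \<phi>) = \<phi> + defect \<phi> + (1/2) *\<^sub>R us (incr \<phi>)"
    by (simp add: mid_eq linear_simps us_u)
  then have "uh \<phi> = u \<phi> + x *\<^sub>R (G (u (\<phi> + defect \<phi> + (1/2) *\<^sub>R us (incr \<phi>))) - u (us (G (mid \<phi>))))"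
    using incr_eq_skew[of \<phi>] by (simp add: uh_eq skew_def)
  then show ?thesis
    by (simp add: upd_def uh_eq[of "defect \<phi>"] pullback_def lag_def drift_def linear_simps algebra_simps)
qed

lemma shifted_upd: "shifted \<mu> (upd \<phi>) = shifted \<mu> (u pullback) + change"
  by (simp add: upd_eq change_def residual_def linear_simps shifted_G)

lemma pullback_eq: "pullback = (1 - x * \<mu>) *\<^sub>R \<phi> - x *\<^sub>R ritz_residual"
  by (simp add: pullback_def ritz_residual_def algebra_simps)

lemma shifted_pullback:
  "shifted \<mu> (u pullback) = (1 - x * \<mu>) *\<^sub>R residual - x *\<^sub>R shifted \<mu> (u ritz_residual)"
  by (simp add: pullback_eq linear_simps residual_def)

end

section \<open>Propagation of the defect inequality\<close>

context two_stage
begin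

definition upd_adj :: "'v \<Rightarrow> 'e" where "upd_adj v = uhs v - x *\<^sub>R defect (uhs (G v))"
definition new_defect :: "'e \<Rightarrow> 'e" where "new_defect \<xi> = upd_adj (upd \<xi>) - \<xi>"

lemma upd_adj: "upd \<xi> \<bullet> v = \<xi> \<bullet> upd_adj v"
  by (simp add: upd_def upd_adj_def inner_diff_left inner_diff_right uh_adj G_sym flip: defect_sym)

lemma inner_new_defect: "\<xi> \<bullet> new_defect \<xi> = (norm (upd \<xi>))\<^sup>2 - (norm \<xi>)\<^sup>2"
  by (simp add: new_defect_def inner_diff_right power2_norm_eq_inner flip: upd_adj)

end

context test_direction
begin

sublocale balance: balance_parameters d p l r s "defect_weight l"
  using p_bounds by unfold_locales (simp_all add: l_ge d_def p_def s_def field_simps)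

lemma norm_G_shifted_residual_le: "norm (G (shifted \<mu> residual)) \<le> \<gamma>"
  using norm_G_le_green_norm[of "shifted \<mu> residual"] green_norm_shifted_mu_le[of residual] by (simp add: \<gamma>_def)

lemma norm_us_G_shifted_residual_le: "norm (us (G (shifted \<mu> residual))) \<le> s * \<beta>"
  by (rule order_trans[OF norm_us_le order_trans[OF mult_left_mono[OF norm_G_shifted_residual_le] sqrt_l_gamma_le]])
    (use l_ge in simp)

lemma norm_incr_adj_G_shifted_residual_le: "norm (incr_adj (G (shifted \<mu> residual))) \<le> x * l * (s * \<beta>)"
proof -
  have "footprint (G (shifted \<mu> residual)) \<le> s * \<beta>"
    by (rule order_trans[OF footprint_le order_trans[OF mult_left_mono[OF norm_G_shifted_residual_le] sqrt_l_gamma_le]])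
      (use l_ge in simp)
  then show ?thesis by (rule order_trans[OF norm_incr_adj_le mult_left_mono[OF _ x_bounds(3)]])
qed

lemma growth_loss_nonneg: "0 \<le> \<rho> \<Longrightarrow> 0 \<le> growth_loss l p s \<beta> \<nu> \<rho>"
  using l_ge p_bounds s_nonneg beta_nonneg nu_nonneg by (simp add: growth_loss_def)

lemma growth_loss_eq: "growth_loss l p s \<beta> \<nu> \<rho> = growth_loss l p s \<beta> \<nu> 0 + \<rho> * ((s + 4 * p) * \<beta> + 17/6 * p * \<nu>)"
  by (simp add: growth_loss_def)

lemma residual_change_eq:
  "residual \<bullet> change = x * \<gamma>\<^sup>2 + x * (1/2 * (us (G (shifted \<mu> residual)) \<bullet> us (incr \<phi>)))
    - x * (incr_adj (G (shifted \<mu> residual)) \<bullet> defect \<phi>) + us (shifted \<mu> residual) \<bullet> lag"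
proof -
  have "residual \<bullet> G (shifted \<mu> drift) = G (shifted \<mu> residual) \<bullet> drift" by (metis G_sym shifted_sym shifted_G)
  also have "\<dots> = 1/2 * (us (G (shifted \<mu> residual)) \<bullet> us (incr \<phi>)) - incr_adj (G (shifted \<mu> residual)) \<bullet> defect \<phi>"
    by (simp add: drift_def inner_diff_right inner_commute[of "G (shifted \<mu> residual)"] u_adj incr_adj
        inner_commute[of "us (incr \<phi>)"] inner_commute[of "defect \<phi>"])
  finally have drift: "residual \<bullet> G (shifted \<mu> drift)
      = 1/2 * (us (G (shifted \<mu> residual)) \<bullet> us (incr \<phi>)) - incr_adj (G (shifted \<mu> residual)) \<bullet> defect \<phi>" .
  have lag: "residual \<bullet> shifted \<mu> (u lag) = us (shifted \<mu> residual) \<bullet> lag"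
    by (metis shifted_sym u_adj inner_commute)
  have "residual \<bullet> change
      = x * (residual \<bullet> G residual) + x * (residual \<bullet> G (shifted \<mu> drift)) + residual \<bullet> shifted \<mu> (u lag)"
    by (simp add: change_def linear_simps inner_add_right distrib_left)
  then show ?thesis unfolding drift lag by (simp add: \<gamma>_def green_norm_power2 right_diff_distrib)
qed

lemma residual_change_ge: "residual \<bullet> change \<ge> x * \<gamma>\<^sup>2 - x\<^sup>2 * growth_loss l p s \<beta> \<nu> 0"
proof -
  let ?us_incr = "(d + 11/20 * p) * \<beta> + (l + 11/20 * p) * \<nu>"
  have "\<bar>us (G (shifted \<mu> residual)) \<bullet> us (incr \<phi>)\<bar> \<le> (s * \<beta>) * (x * ?us_incr)"
    using s_nonneg beta_nonneg
    by (intro order_trans[OF Cauchy_Schwarz_ineq2] mult_mono norm_us_G_shifted_residual_le norm_us_incr_le) simp_all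
  then have us_bound: "- ((s * \<beta>) * (x * ?us_incr)) \<le> us (G (shifted \<mu> residual)) \<bullet> us (incr \<phi>)" by linarith
  have "- (x\<^sup>2 * (s / 2 * \<beta> * ?us_incr)) = x / 2 * - ((s * \<beta>) * (x * ?us_incr))" by (simp add: power2_eq_square)
  also have "\<dots> \<le> x / 2 * (us (G (shifted \<mu> residual)) \<bullet> us (incr \<phi>))"
    using x_pos by (intro mult_left_mono us_bound) simp
  also have "\<dots> = x * (1/2 * (us (G (shifted \<mu> residual)) \<bullet> us (incr \<phi>)))" by simp
  finally have us_part: "- (x\<^sup>2 * (s / 2 * \<beta> * ?us_incr))
      \<le> x * (1/2 * (us (G (shifted \<mu> residual)) \<bullet> us (incr \<phi>)))" .
  have "incr_adj (G (shifted \<mu> residual)) \<bullet> defect \<phi> \<le> (x * l * (s * \<beta>)) * \<nu>"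
    using x_bounds(3) s_nonneg beta_nonneg
    by (intro order_trans[OF norm_cauchy_schwarz] mult_mono norm_incr_adj_G_shifted_residual_le norm_defect_le_nu) simp_all
  then have "x * (incr_adj (G (shifted \<mu> residual)) \<bullet> defect \<phi>) \<le> x * ((x * l * (s * \<beta>)) * \<nu>)"
    using x_pos by (intro mult_left_mono) simp_all
  also have "\<dots> = x\<^sup>2 * (s * l * \<beta> * \<nu>)" by (simp add: power2_eq_square)
  finally have incr_part: "x * (incr_adj (G (shifted \<mu> residual)) \<bullet> defect \<phi>) \<le> x\<^sup>2 * (s * l * \<beta> * \<nu>)" .
  have "x\<^sup>2 * growth_loss l p s \<beta> \<nu> 0 = x\<^sup>2 * (s / 2 * \<beta> * ?us_incr) + x\<^sup>2 * (s * l * \<beta> * \<nu>)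
      + x\<^sup>2 * (3/8 * l\<^sup>2 * \<beta>\<^sup>2 + \<beta> * (2 * d * \<beta> + 8/3 * p * \<beta> + (l + 5/3 * p) * \<nu>))"
    unfolding growth_loss_def d_def distrib_left[of "x\<^sup>2", symmetric] by simp
  with us_part incr_part residual_lag_ge show ?thesis unfolding residual_change_eq by linarith
qed

lemma l_norm_us_incr_le: "l * norm (us (incr \<phi>)) \<le> p * (\<beta> + 11/10 * \<nu>)"
proof -
  have "(d + 11/20 * p) * \<beta> + (l + 11/20 * p) * \<nu> \<le> l * \<beta> + (11/10 * l) * \<nu>"
    using p_bounds l_ge beta_nonneg nu_nonneg by (intro add_mono mult_right_mono) (simp_all add: d_def)
  also have "\<dots> = l * (\<beta> + 11/10 * \<nu>)" by (simp add: algebra_simps)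
  finally have "l * norm (us (incr \<phi>)) \<le> l * (x * (l * (\<beta> + 11/10 * \<nu>)))"
    using x_pos l_ge by (intro mult_left_mono order_trans[OF norm_us_incr_le]) simp_all
  also have "\<dots> = x * l\<^sup>2 * (\<beta> + 11/10 * \<nu>)" by (simp add: power2_eq_square)
  also have "\<dots> \<le> p * (\<beta> + 11/10 * \<nu>)" using beta_nonneg nu_nonneg by (intro x_l_mult_le) simp
  finally show ?thesis .
qed

lemma sqrt_l_norm_drift_le: "sqrt l * norm drift \<le> p * (1/2 * \<beta> + 31/20 * \<nu>)"
proof -
  have "norm (incr (defect \<phi>)) \<le> x * l * (sqrt l * \<nu>)"
    using x_bounds(3) l_ge by (intro order_trans[OF norm_incr_le] mult_left_mono norm_defect_le_nu) simp_all
  then have "norm drift \<le> 1/2 * (sqrt l * norm (us (incr \<phi>))) + x * l * (sqrt l * \<nu>)"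
    using norm_triangle_ineq4[of "(1/2) *\<^sub>R u (us (incr \<phi>))" "incr (defect \<phi>)"] norm_u_le[of "us (incr \<phi>)"]
    by (simp add: drift_def)
  then have "sqrt l * norm drift \<le> sqrt l * (1/2 * (sqrt l * norm (us (incr \<phi>))) + x * l * (sqrt l * \<nu>))"
    using l_ge by (intro mult_left_mono) auto
  also have "\<dots> = 1/2 * (l * norm (us (incr \<phi>))) + x * l\<^sup>2 * \<nu>"
    unfolding distrib_left sqrt_l_mult by (simp add: power2_eq_square)
  also have "\<dots> \<le> 1/2 * (p * (\<beta> + 11/10 * \<nu>)) + p * \<nu>"
    using l_norm_us_incr_le x_l_mult_le(2)[OF nu_nonneg] by linarith
  also have "\<dots> = p * (1/2 * \<beta> + 31/20 * \<nu>)" by (simp add: field_simps)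
  finally show ?thesis .
qed

lemma l_norm_lag_le: "l * norm lag \<le> x * (p * (7/2 * \<beta> + 23/18 * \<nu>))"
proof -
  have "3/2 * (1 + l) * \<beta> + 2 * d * \<beta> + 8/3 * p * \<beta> + (l + 5/3 * p) * \<nu>
      = (7/2 * l - 1/2 + 8/3 * p) * \<beta> + (l + 5/3 * p) * \<nu>" by (simp add: d_def field_simps)
  also have "\<dots> \<le> (7/2 * l) * \<beta> + (23/18 * l) * \<nu>"
    using p_bounds l_ge beta_nonneg nu_nonneg by (intro add_mono mult_right_mono) simp_all
  also have "\<dots> = l * (7/2 * \<beta> + 23/18 * \<nu>)" by (simp add: algebra_simps)
  finally have "l * norm lag \<le> l * (x\<^sup>2 * (l * (7/2 * \<beta> + 23/18 * \<nu>)))"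
    using l_ge by (intro mult_left_mono order_trans[OF norm_lag_le]) simp_all
  also have "\<dots> = x * (x * l\<^sup>2 * (7/2 * \<beta> + 23/18 * \<nu>))" by (simp add: power2_eq_square)
  also have "\<dots> \<le> x * (p * (7/2 * \<beta> + 23/18 * \<nu>))"
    using x_pos beta_nonneg nu_nonneg by (intro mult_left_mono x_l_mult_le) simp_all
  finally show ?thesis .
qed

lemma shifted_ritz_residual_change_le:
  "shifted \<mu> (u ritz_residual) \<bullet> change \<le> x * (norm ritz_residual * ((s + 4 * p) * \<beta> + 17/6 * p * \<nu>))"
proof -
  let ?w = "shifted \<mu> (u ritz_residual)" and ?\<rho> = "norm ritz_residual"
  have norm_w: "norm ?w \<le> ?\<rho> * sqrt l"
    using norm_shifted_mu_le[of "u ritz_residual"] norm_u_le[of ritz_residual] by (simp add: mult.commute)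
  have "?w \<bullet> G residual = ritz_residual \<bullet> us (G (shifted \<mu> residual))" by (metis shifted_sym u_adj shifted_G)
  also have "\<dots> \<le> ?\<rho> * (s * \<beta>)"
    by (intro order_trans[OF norm_cauchy_schwarz] mult_left_mono norm_us_G_shifted_residual_le) simp
  finally have residual_part: "?w \<bullet> G residual \<le> ?\<rho> * (s * \<beta>)" .
  have image_part: "?w \<bullet> v \<le> ?\<rho> * (sqrt l * m)" if "norm v \<le> m" for v m
  proof -
    have "?w \<bullet> v \<le> (?\<rho> * sqrt l) * m"
      using norm_w that l_ge by (intro order_trans[OF norm_cauchy_schwarz] mult_mono) simp_all
    then show ?thesis by (simp add: mult.assoc)
  qed
  have "?w \<bullet> G (shifted \<mu> drift) \<le> ?\<rho> * (sqrt l * norm drift)"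
    by (rule image_part, rule order_trans[OF norm_G_le norm_shifted_mu_le])
  also have "\<dots> \<le> ?\<rho> * (p * (1/2 * \<beta> + 31/20 * \<nu>))" by (intro mult_left_mono sqrt_l_norm_drift_le) simp
  finally have drift_part: "?w \<bullet> G (shifted \<mu> drift) \<le> ?\<rho> * (p * (1/2 * \<beta> + 31/20 * \<nu>))" .
  have "?w \<bullet> shifted \<mu> (u lag) \<le> ?\<rho> * (sqrt l * (sqrt l * norm lag))"
    by (rule image_part, rule order_trans[OF norm_shifted_mu_le norm_u_le])
  also have "\<dots> \<le> ?\<rho> * (x * (p * (7/2 * \<beta> + 23/18 * \<nu>)))"
    unfolding sqrt_l_mult by (intro mult_left_mono l_norm_lag_le) simp
  finally have lag_part: "?w \<bullet> shifted \<mu> (u lag) \<le> ?\<rho> * (x * (p * (7/2 * \<beta> + 23/18 * \<nu>)))" .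
  have "?w \<bullet> change = x * (?w \<bullet> G residual) + x * (?w \<bullet> G (shifted \<mu> drift)) + ?w \<bullet> shifted \<mu> (u lag)"
    by (simp add: change_def linear_simps inner_add_right algebra_simps)
  also have "\<dots> \<le> x * (?\<rho> * (s * \<beta>)) + x * (?\<rho> * (p * (1/2 * \<beta> + 31/20 * \<nu>)))
      + ?\<rho> * (x * (p * (7/2 * \<beta> + 23/18 * \<nu>)))"
    using residual_part drift_part lag_part x_pos by (intro add_mono mult_left_mono) simp_all
  also have "\<dots> = x * (?\<rho> * ((s + 4 * p) * \<beta> + 509/180 * p * \<nu>))" by (simp add: field_simps)
  also have "\<dots> \<le> x * (?\<rho> * ((s + 4 * p) * \<beta> + 17/6 * p * \<nu>))"
    using x_pos p_bounds nu_nonneg by (intro mult_left_mono add_left_mono mult_right_mono) simp_all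
  finally show ?thesis .
qed

text \<open>The restriction on \<open>x\<close> through \<open>b\<close> converts the gain \<open>x \<gamma>\<^sup>2\<close> into a multiple of \<open>x\<^sup>2 \<beta>\<^sup>2\<close>.\<close>

definition gain :: real where "gain = (1 - x * \<mu>) / (x * b)"

lemma gain_ge: "141/50 * l\<^sup>2 + 1269/500 * r * l + r - r / l \<le> gain"
proof -
  have xb: "0 < x * b" using x_pos b_pos by simp
  have "(141/50 * l\<^sup>2 + 1269/500 * r * l + r - r / l) * (x * b)
      = x * (141/50 * l\<^sup>2 * b + 1269/500 * l * (r * b) + r * b) - x * (r * b / l)" by (simp add: algebra_simps)
  also have "\<dots> = x * (141/50 * (b + 9/10) * l\<^sup>2 + l) - x"
    unfolding r_bounds(3) using l_ge by (simp add: power2_eq_square field_simps)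
  also have "\<dots> \<le> 1 - x * \<mu>" using x_le x_mu_bounds by linarith
  finally show ?thesis unfolding gain_def pos_le_divide_eq[OF xb] .
qed

lemma gain_mult: "x\<^sup>2 * (gain * \<beta>\<^sup>2) = (1 - x * \<mu>) * (x * \<gamma>\<^sup>2)" "x\<^sup>2 * (81/50 * gain * \<nu>\<^sup>2) = 2 * x * ((1 - x * \<mu>) * \<kappa>\<^sup>2)"
proof -
  have "\<beta>\<^sup>2 = b * \<gamma>\<^sup>2" "81/50 * \<nu>\<^sup>2 = 2 * (b * \<kappa>\<^sup>2)"
    using b_pos by (simp_all add: \<beta>_def \<nu>_def power_mult_distrib power_divide)
  moreover have "x\<^sup>2 * gain * b = x * (1 - x * \<mu>)"
    using x_pos b_pos by (simp add: gain_def power2_eq_square)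
  ultimately show "x\<^sup>2 * (gain * \<beta>\<^sup>2) = (1 - x * \<mu>) * (x * \<gamma>\<^sup>2)"
    "x\<^sup>2 * (81/50 * gain * \<nu>\<^sup>2) = 2 * x * ((1 - x * \<mu>) * \<kappa>\<^sup>2)" by algebra+
qed

definition growth :: real where "growth = gain * \<beta>\<^sup>2 - growth_loss l p s \<beta> \<nu> (norm ritz_residual)"

lemma norm_shifted_upd_ge:
  "(norm (shifted \<mu> (upd \<phi>)))\<^sup>2 \<ge> (norm (shifted \<mu> (u pullback)))\<^sup>2 + 2 * (x\<^sup>2 * growth)"
proof -
  let ?a = "1 - x * \<mu>" and ?\<rho> = "norm ritz_residual" and ?loss = "growth_loss l p s \<beta> \<nu> 0"
  let ?ritz_loss = "?\<rho> * ((s + 4 * p) * \<beta> + 17/6 * p * \<nu>)"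
  have "x\<^sup>2 * (gain * \<beta>\<^sup>2) - x\<^sup>2 * ?loss \<le> ?a * (x * \<gamma>\<^sup>2) - ?a * (x\<^sup>2 * ?loss)"
    unfolding gain_mult using x_mu_bounds growth_loss_nonneg[of 0]
    by (intro diff_left_mono mult_left_le_one_le) simp_all
  also have "\<dots> = ?a * (x * \<gamma>\<^sup>2 - x\<^sup>2 * ?loss)" by (simp only: right_diff_distrib)
  also have "\<dots> \<le> ?a * (residual \<bullet> change)"
    using residual_change_ge x_mu_bounds by (intro mult_left_mono) simp_all
  finally have "x\<^sup>2 * (gain * \<beta>\<^sup>2) - x\<^sup>2 * ?loss \<le> ?a * (residual \<bullet> change)" .
  moreover have "x * (shifted \<mu> (u ritz_residual) \<bullet> change) \<le> x\<^sup>2 * ?ritz_loss"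
    using mult_left_mono[OF shifted_ritz_residual_change_le less_imp_le[OF x_pos]]
    by (simp only: power2_eq_square[of x] mult.assoc)
  moreover have "shifted \<mu> (u pullback) \<bullet> change
      = ?a * (residual \<bullet> change) - x * (shifted \<mu> (u ritz_residual) \<bullet> change)"
    by (simp add: shifted_pullback inner_diff_left)
  ultimately have "x\<^sup>2 * (gain * \<beta>\<^sup>2) - x\<^sup>2 * ?loss - x\<^sup>2 * ?ritz_loss \<le> shifted \<mu> (u pullback) \<bullet> change"
    by linarith
  moreover have "(norm (shifted \<mu> (upd \<phi>)))\<^sup>2
      = (norm (shifted \<mu> (u pullback)))\<^sup>2 + 2 * (shifted \<mu> (u pullback) \<bullet> change) + (norm change)\<^sup>2"
    unfolding shifted_upd power2_norm_eq_inner
    by (simp add: inner_add_left inner_add_right inner_commute[of change "shifted \<mu> (u pullback)"])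
  moreover have "x\<^sup>2 * growth = x\<^sup>2 * (gain * \<beta>\<^sup>2) - x\<^sup>2 * ?loss - x\<^sup>2 * ?ritz_loss"
    unfolding growth_def growth_loss_eq[of ?\<rho>] by (simp only: right_diff_distrib distrib_left diff_add_eq diff_diff_eq)
  ultimately show ?thesis using zero_le_power2[of "norm change"] by linarith
qed

definition \<omega> :: real where "\<omega> = 1 / (1 - x)"

lemma omega_bounds:
  "0 \<le> \<omega>" "\<mu> / (1 - x * \<mu>) \<le> \<omega>" "x * \<omega> \<le> 1/5" "\<omega> + x * \<omega>\<^sup>2 = \<omega>\<^sup>2" "\<omega>\<^sup>2 \<le> 1 + 8/3 * p / l"
proof -
  have pos: "0 < 1 - x" using x_bounds by linarith
  then show "0 \<le> \<omega>" "x * \<omega> \<le> 1/5" using x_bounds(2) by (simp_all add: \<omega>_def pos_divide_le_eq)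
  have "\<omega> * (1 - x) = 1" using pos by (simp add: \<omega>_def)
  then show "\<omega> + x * \<omega>\<^sup>2 = \<omega>\<^sup>2" by algebra
  show "\<mu> / (1 - x * \<mu>) \<le> \<omega>" unfolding \<omega>_def
    using pos mu x_mu_bounds by (intro frac_le) simp_all
  have "0 \<le> x * (8/3 * (x - 1/6)\<^sup>2 + (16/27 - 31/9 * x))"
    using x_pos x_bounds(2) by (intro mult_nonneg_nonneg add_nonneg_nonneg) simp_all
  then have "1 \<le> (1 + 8/3 * x) * (1 - x)\<^sup>2" by (simp add: power2_eq_square field_simps)
  then have "\<omega>\<^sup>2 \<le> 1 + 8/3 * x" using pos by (simp add: \<omega>_def power_divide pos_divide_le_eq)
  also have "\<dots> \<le> 1 + 8/3 * (p / l)"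
    using x_l_mult_le(1)[of 1] l_ge by (simp add: pos_le_divide_eq)
  finally show "\<omega>\<^sup>2 \<le> 1 + 8/3 * p / l" by simp
qed

definition pullback_weight :: real where
  "pullback_weight = (1 - 2 * (x * \<mu>)) / (1 - x * \<mu>)\<^sup>2"

lemma pullback_weight_bounds: "0 \<le> pullback_weight" "pullback_weight \<le> 1"
  "pullback_weight * (1 - x * \<mu>)\<^sup>2 = 1 - 2 * (x * \<mu>)" "1 - pullback_weight * (1 - x * \<mu>) = x * (\<mu> / (1 - x * \<mu>))"
  "1 - pullback_weight = (x * (\<mu> / (1 - x * \<mu>)))\<^sup>2"
proof -
  have pos: "0 < 1 - x * \<mu>" using x_mu_bounds by linarith
  show "0 \<le> pullback_weight" using x_mu_bounds by (simp add: pullback_weight_def)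
  show "pullback_weight * (1 - x * \<mu>)\<^sup>2 = 1 - 2 * (x * \<mu>)" using pos by (simp add: pullback_weight_def)
  have weight: "pullback_weight = (a - b) / a\<^sup>2" if "a = 1 - x * \<mu>" "b = x * \<mu>" for a b
    by (simp add: pullback_weight_def that)
  have "1 - (a - b) / a\<^sup>2 * a = b / a" "1 - (a - b) / a\<^sup>2 = (b / a)\<^sup>2" if "0 < a" "a + b = 1" for a b :: real
  proof -
    have "a\<^sup>2 = (a - b) + b\<^sup>2" using that(2) by algebra
    then show "1 - (a - b) / a\<^sup>2 * a = b / a" "1 - (a - b) / a\<^sup>2 = (b / a)\<^sup>2"
      using that(1) by (simp_all add: field_simps power2_eq_square)
  qed
  from this[of "1 - x * \<mu>" "x * \<mu>"] pos
  show "1 - pullback_weight * (1 - x * \<mu>) = x * (\<mu> / (1 - x * \<mu>))"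
    and square: "1 - pullback_weight = (x * (\<mu> / (1 - x * \<mu>)))\<^sup>2"
    by (simp_all add: weight)
  show "pullback_weight \<le> 1" using square zero_le_power2[of "x * (\<mu> / (1 - x * \<mu>))"] by linarith
qed

lemma inner_pullback_defect:
  "pullback \<bullet> defect pullback = (1 - x * \<mu>)\<^sup>2 * (\<phi> \<bullet> defect \<phi>) - 2 * (1 - x * \<mu>) * x * (ritz_residual \<bullet> defect \<phi>)
    + x\<^sup>2 * (ritz_residual \<bullet> defect ritz_residual)"
proof -
  have "\<phi> \<bullet> defect ritz_residual = ritz_residual \<bullet> defect \<phi>" by (metis defect_sym inner_commute)
  then show ?thesis
    by (simp add: pullback_eq linear_simps inner_diff_left inner_diff_right power2_eq_square algebra_simps)
qed

definition norm_loss :: real where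
  "norm_loss = 2 * \<omega> * \<nu> * norm ritz_residual + d * (norm ritz_residual)\<^sup>2"

lemma norm_upd_ge_pullback:
  "(norm (upd \<phi>))\<^sup>2 - (norm \<phi>)\<^sup>2 \<ge> pullback_weight * (pullback \<bullet> defect pullback) - x\<^sup>2 * norm_loss"
proof -
  define a where "a = 1 - x * \<mu>"
  let ?\<theta> = pullback_weight and ?\<rho> = "norm ritz_residual"
  let ?r = "ritz_residual \<bullet> defect \<phi>" and ?s = "ritz_residual \<bullet> defect ritz_residual"
  note weight = pullback_weight_bounds[folded a_def]
  have ritz: "ritz_hat \<phi> \<bullet> defect \<phi> = \<mu> * (\<phi> \<bullet> defect \<phi>) + ?r" by (simp add: ritz_residual_def inner_diff_left)
  have "?\<theta> * (pullback \<bullet> defect pullback)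
      = (?\<theta> * a\<^sup>2) * (\<phi> \<bullet> defect \<phi>) - 2 * x * (1 - (1 - ?\<theta> * a)) * ?r + x\<^sup>2 * (?\<theta> * ?s)"
    unfolding inner_pullback_defect a_def[symmetric] by (simp add: algebra_simps)
  also have "\<dots> = \<phi> \<bullet> defect \<phi> - 2 * x * (\<mu> * (\<phi> \<bullet> defect \<phi>) + ?r) + x\<^sup>2 * (2 * (\<mu> / a) * ?r + ?\<theta> * ?s)"
    unfolding weight(3,4) by (simp add: power2_eq_square algebra_simps)
  also have "\<dots> = (norm (upd \<phi>))\<^sup>2 - (norm \<phi>)\<^sup>2 - x\<^sup>2 * (norm (G (uh (defect \<phi>))))\<^sup>2
      + x\<^sup>2 * (2 * (\<mu> / a) * ?r + ?\<theta> * ?s)"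
    unfolding norm_upd ritz by (simp add: inner_defect)
  finally have expand: "?\<theta> * (pullback \<bullet> defect pullback) = (norm (upd \<phi>))\<^sup>2 - (norm \<phi>)\<^sup>2
      - x\<^sup>2 * (norm (G (uh (defect \<phi>))))\<^sup>2 + x\<^sup>2 * (2 * (\<mu> / a) * ?r + ?\<theta> * ?s)" .
  have "0 \<le> \<mu> / a" "\<mu> / a \<le> \<omega>" using mu x_mu_bounds omega_bounds(2) by (simp_all add: a_def)
  then have "(\<mu> / a) * ?r \<le> \<omega> * (\<nu> * ?\<rho>)"
    using norm_cauchy_schwarz[of ritz_residual "defect \<phi>"] mult_left_mono[OF norm_defect_le_nu, of ?\<rho>] nu_nonneg
    by (intro order_trans[OF mult_left_mono mult_right_mono[of _ \<omega>]]) (simp_all add: mult.commute)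
  moreover have "?\<theta> * ?s \<le> d * ?\<rho>\<^sup>2"
  proof -
    have "?\<theta> * ?s \<le> ?\<theta> * (d * ?\<rho>\<^sup>2)"
      using defect_le[of ritz_residual] weight(1) by (intro mult_left_mono) (simp_all add: power2_norm_eq_inner)
    also have "\<dots> \<le> d * ?\<rho>\<^sup>2" using weight(1,2) d_nonneg by (intro mult_left_le_one_le) simp_all
    finally show ?thesis .
  qed
  ultimately have "x\<^sup>2 * (2 * (\<mu> / a) * ?r + ?\<theta> * ?s) \<le> x\<^sup>2 * norm_loss"
    unfolding norm_loss_def by (intro mult_left_mono) simp_all
  moreover have "0 \<le> x\<^sup>2 * (norm (G (uh (defect \<phi>))))\<^sup>2" by simp
  ultimately show ?thesis unfolding expand by linarith
qed

definition defect_damping :: 'e where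
  "defect_damping = ritz_hat (defect \<phi>) - x *\<^sub>R defect (uhs (G (G (uh (defect \<phi>)))))"

lemma new_defect_eq: "new_defect \<phi> = defect pullback - x *\<^sub>R defect_damping"
  by (simp add: new_defect_def upd_adj_def upd_def pullback_def defect_damping_def ritz_hat_def linear_simps uhs_uh us_u
      algebra_simps)

lemma defect_pullback_eq: "defect pullback = (1 - x * \<mu>) *\<^sub>R defect \<phi> - x *\<^sub>R defect ritz_residual"
  by (simp add: pullback_eq linear_simps)

lemma norm_ritz_hat_defect_le: "norm (ritz_hat (defect \<phi>)) \<le> sqrt l * \<kappa>"
  and norm_uhs_G_G_uh_defect_le: "norm (uhs (G (G (uh (defect \<phi>))))) \<le> sqrt l * \<kappa>"
  unfolding ritz_hat_def \<kappa>_def using l_ge norm_G_le_green_norm[of "uh (defect \<phi>)"] norm_G_le[of "G (uh (defect \<phi>))"]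
  by (auto intro!: order_trans[OF norm_uhs_le] mult_left_mono)

lemma norm_defect_damping_le: "norm defect_damping \<le> sqrt l * \<kappa> * (1 + x * d)"
proof -
  have "norm (defect (uhs (G (G (uh (defect \<phi>)))))) \<le> d * (sqrt l * \<kappa>)"
    by (rule order_trans[OF norm_defect_le mult_left_mono[OF norm_uhs_G_G_uh_defect_le d_nonneg]])
  then have "norm defect_damping \<le> sqrt l * \<kappa> + x * (d * (sqrt l * \<kappa>))"
    unfolding defect_damping_def using x_pos norm_ritz_hat_defect_le
    by (intro order_trans[OF norm_triangle_ineq4] add_mono) (simp_all add: mult_left_mono)
  then show ?thesis by (simp add: algebra_simps)
qed

lemma norm_defect_pullback_le: "norm (defect pullback) \<le> \<nu> + x * d * norm ritz_residual"
proof -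
  have "norm (defect pullback) \<le> (1 - x * \<mu>) * norm (defect \<phi>) + x * norm (defect ritz_residual)"
    unfolding defect_pullback_eq
    using norm_triangle_ineq4[of "(1 - x * \<mu>) *\<^sub>R defect \<phi>" "x *\<^sub>R defect ritz_residual"] x_mu_bounds x_pos by simp
  also have "\<dots> \<le> \<nu> + x * (d * norm ritz_residual)"
  proof (rule add_mono)
    show "(1 - x * \<mu>) * norm (defect \<phi>) \<le> \<nu>"
      using x_mu_bounds by (intro order_trans[OF mult_left_le_one_le norm_defect_le_nu]) simp_all
  qed (use x_pos norm_defect_le in simp)
  finally show ?thesis by (simp add: mult.assoc)
qed

lemma defect_pullback_damping_ge:
  "defect pullback \<bullet> defect_damping
    \<ge> (1 - x * \<mu>) * \<kappa>\<^sup>2 - x * (sqrt l * \<kappa> * d * (norm ritz_residual + norm (defect pullback)))"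
proof -
  let ?M = "uhs (G (G (uh (defect \<phi>))))" and ?K = "ritz_hat (defect \<phi>)"
  have "defect ritz_residual \<bullet> ?K \<le> (d * norm ritz_residual) * (sqrt l * \<kappa>)"
    using d_nonneg by (intro order_trans[OF norm_cauchy_schwarz] mult_mono norm_defect_le norm_ritz_hat_defect_le) simp_all
  moreover have "defect (defect pullback) \<bullet> ?M \<le> (d * norm (defect pullback)) * (sqrt l * \<kappa>)"
    using d_nonneg by (intro order_trans[OF norm_cauchy_schwarz] mult_mono norm_defect_le norm_uhs_G_G_uh_defect_le) simp_all
  ultimately have "x * (defect ritz_residual \<bullet> ?K + defect (defect pullback) \<bullet> ?M)
      \<le> x * ((d * norm ritz_residual) * (sqrt l * \<kappa>) + (d * norm (defect pullback)) * (sqrt l * \<kappa>))"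
    using x_pos by (intro mult_left_mono add_mono) simp_all
  also have "\<dots> = x * (sqrt l * \<kappa> * d * (norm ritz_residual + norm (defect pullback)))" by (simp add: algebra_simps)
  finally have "x * (defect ritz_residual \<bullet> ?K + defect (defect pullback) \<bullet> ?M)
      \<le> x * (sqrt l * \<kappa> * d * (norm ritz_residual + norm (defect pullback)))" .
  moreover have "defect \<phi> \<bullet> ?K = \<kappa>\<^sup>2" by (simp add: \<kappa>_def green_norm_power2 inner_ritz_hat)
  then have "defect pullback \<bullet> ?K = (1 - x * \<mu>) * \<kappa>\<^sup>2 - x * (defect ritz_residual \<bullet> ?K)"
    by (simp add: defect_pullback_eq inner_diff_left)
  then have "defect pullback \<bullet> defect_damping
      = (1 - x * \<mu>) * \<kappa>\<^sup>2 - x * (defect ritz_residual \<bullet> ?K + defect (defect pullback) \<bullet> ?M)"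
    by (simp add: defect_damping_def inner_diff_right defect_sym algebra_simps)
  ultimately show ?thesis by linarith
qed

definition defect_loss :: real where
  "defect_loss = 2 * (sqrt l * \<kappa>) * d * (norm ritz_residual + norm (defect pullback)) + (sqrt l * \<kappa> * (1 + x * d))\<^sup>2
    + (\<omega> * norm (defect pullback))\<^sup>2"

text \<open>The square of the defect is damped already at first order in \<open>x\<close>.\<close>

lemma norm_new_defect_le:
  "(norm (new_defect \<phi>))\<^sup>2 \<le> pullback_weight * (norm (defect pullback))\<^sup>2 - x\<^sup>2 * (81/50 * gain * \<nu>\<^sup>2)
    + x\<^sup>2 * defect_loss"
proof -
  let ?\<chi> = "norm (defect pullback)" and ?\<rho> = "norm ritz_residual"
  have "(norm (new_defect \<phi>))\<^sup>2 = ?\<chi>\<^sup>2 - 2 * x * (defect pullback \<bullet> defect_damping) + x\<^sup>2 * (norm defect_damping)\<^sup>2"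
    unfolding new_defect_eq power2_norm_eq_inner
    by (simp add: inner_diff_left inner_diff_right inner_commute[of defect_damping "defect pullback"]
        power2_eq_square algebra_simps)
  moreover have "2 * x * ((1 - x * \<mu>) * \<kappa>\<^sup>2 - x * (sqrt l * \<kappa> * d * (?\<rho> + ?\<chi>)))
      \<le> 2 * x * (defect pullback \<bullet> defect_damping)"
    using x_pos by (intro mult_left_mono defect_pullback_damping_ge) simp_all
  moreover have "x\<^sup>2 * (norm defect_damping)\<^sup>2 \<le> x\<^sup>2 * (sqrt l * \<kappa> * (1 + x * d))\<^sup>2"
    by (intro mult_left_mono power_mono norm_defect_damping_le) simp_all
  moreover have "(1 - pullback_weight) * ?\<chi>\<^sup>2 \<le> x\<^sup>2 * (\<omega> * ?\<chi>)\<^sup>2"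
    unfolding pullback_weight_bounds(5) power_mult_distrib[symmetric] mult.assoc
    using omega_bounds(2) mu x_mu_bounds x_pos by (intro power_mono mult_left_mono mult_right_mono) simp_all
  moreover have "2 * x * ((1 - x * \<mu>) * \<kappa>\<^sup>2 - x * (sqrt l * \<kappa> * d * (?\<rho> + ?\<chi>)))
      = 2 * x * ((1 - x * \<mu>) * \<kappa>\<^sup>2) - x\<^sup>2 * (2 * (sqrt l * \<kappa>) * d * (?\<rho> + ?\<chi>))" by algebra
  ultimately show ?thesis
    unfolding gain_mult defect_loss_def distrib_left[of "x\<^sup>2"] left_diff_distrib[of 1 pullback_weight] by linarith
qed

lemma x_d_le: "x * d \<le> 1/24"
proof -
  have "x * (4 * d) \<le> x * l\<^sup>2" using x_pos by (intro mult_left_mono four_d_le) simp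
  then show ?thesis using x_l_power2_le p_bounds by linarith
qed

lemma losses_le_total_loss:
  "d * (2 * defect_weight l * growth_loss l p s \<beta> \<nu> (norm ritz_residual)) + (defect_loss + d * norm_loss)
    \<le> balance.total_loss \<beta> \<nu> (norm ritz_residual)"
proof -
  let ?\<chi> = "norm (defect pullback)" and ?\<rho> = "norm ritz_residual" and ?V = "1 + 8/3 * p / l"
  have x_d_\<rho>: "x * d * ?\<rho> \<le> 1/24 * ?\<rho>" by (intro mult_right_mono x_d_le) simp
  then have "?\<rho> + ?\<chi> \<le> 25/24 * ?\<rho> + \<nu>" using norm_defect_pullback_le by linarith
  then have "(sqrt l * \<kappa>) * (d * (?\<rho> + ?\<chi>)) \<le> (9/10 * s * \<nu>) * (d * (25/24 * ?\<rho> + \<nu>))"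
    by (rule mult_mono[OF sqrt_l_kappa_le mult_left_mono]) (use d_nonneg s_nonneg nu_nonneg in simp_all)
  moreover have "2 * ((9/10 * s * \<nu>) * (d * (25/24 * ?\<rho> + \<nu>))) = 9/5 * s * d * \<nu> * (25/24 * ?\<rho> + \<nu>)" by algebra
  ultimately have mixed_part: "2 * (sqrt l * \<kappa>) * d * (?\<rho> + ?\<chi>) \<le> 9/5 * s * d * \<nu> * (25/24 * ?\<rho> + \<nu>)"
    by (simp only: mult.assoc)
  have "(sqrt l * \<kappa> * (1 + x * d))\<^sup>2 = (l * \<kappa>\<^sup>2) * (1 + x * d)\<^sup>2" using l_ge by (simp add: power_mult_distrib)
  also have "\<dots> \<le> (81/100 * r * \<nu>\<^sup>2) * (25/24)\<^sup>2"
  proof (rule mult_mono[OF _ power_mono])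
    have "81/100 * r * \<nu>\<^sup>2 = (r * b) * \<kappa>\<^sup>2" using b_pos by (simp add: \<nu>_def power_mult_distrib power_divide)
    then show "l * \<kappa>\<^sup>2 \<le> 81/100 * r * \<nu>\<^sup>2" by (simp only: r_bounds(3))
  qed (use x_d_le x_pos d_nonneg r_bounds in simp_all)
  also have "\<dots> \<le> 22/25 * r * \<nu>\<^sup>2"
    using r_bounds mult_right_mono[of "81/100 * (25/24)\<^sup>2" "22/25" "r * \<nu>\<^sup>2"] by (simp add: power_divide)
  finally have square_part: "(sqrt l * \<kappa> * (1 + x * d))\<^sup>2 \<le> 22/25 * r * \<nu>\<^sup>2" .
  have "(\<omega> * ?\<chi>)\<^sup>2 + d * norm_loss
      \<le> (\<omega> * (\<nu> + x * d * ?\<rho>))\<^sup>2 + d * (2 * \<omega> * \<nu> * ?\<rho> + d * ?\<rho>\<^sup>2)"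
    unfolding norm_loss_def
    using omega_bounds(1) by (intro add_right_mono power_mono mult_left_mono norm_defect_pullback_le) simp_all
  also have "\<dots> = \<omega>\<^sup>2 * \<nu>\<^sup>2 + (\<omega> + x * \<omega>\<^sup>2) * (2 * d * \<nu> * ?\<rho>) + (1 + (x * \<omega>)\<^sup>2) * (d * ?\<rho>)\<^sup>2"
    by (simp add: power2_eq_square algebra_simps)
  also have "\<dots> \<le> ?V * \<nu>\<^sup>2 + ?V * (2 * d * \<nu> * ?\<rho>) + 26/25 * (d * ?\<rho>)\<^sup>2"
    unfolding omega_bounds(4)
  proof (intro add_mono mult_right_mono omega_bounds(5))
    have "(x * \<omega>)\<^sup>2 \<le> (1/5)\<^sup>2" using omega_bounds(1,3) x_pos by (intro power_mono) simp_all
    then show "1 + (x * \<omega>)\<^sup>2 \<le> 26/25" by (simp add: power_divide)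
  qed (use d_nonneg nu_nonneg in simp_all)
  also have "\<dots> = d * (2 * ?V * \<nu> * ?\<rho> + 26/25 * d * ?\<rho>\<^sup>2) + ?V * \<nu>\<^sup>2"
    by (simp add: power2_eq_square algebra_simps)
  finally show ?thesis
    using mixed_part square_part unfolding balance.total_loss_def defect_loss_def distrib_left[of d] by linarith
qed

lemma losses_le_growth:
  "x\<^sup>2 * defect_loss + d * (x\<^sup>2 * norm_loss)
    \<le> d * (defect_weight l * (2 * (x\<^sup>2 * growth))) + x\<^sup>2 * (81/50 * gain * \<nu>\<^sup>2)"
proof -
  let ?growth_loss = "d * (2 * defect_weight l * growth_loss l p s \<beta> \<nu> (norm ritz_residual))"
  have "?growth_loss + (defect_loss + d * norm_loss) \<le> gain * (2 * defect_weight l * d * \<beta>\<^sup>2 + 81/50 * \<nu>\<^sup>2)"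
    by (rule order_trans[OF losses_le_total_loss balance.growth_balance])
      (fact beta_nonneg nu_nonneg norm_ge_zero l_norm_ritz_residual_le gain_ge)+
  also have "\<dots> = ?growth_loss + (d * (defect_weight l * (2 * growth)) + 81/50 * gain * \<nu>\<^sup>2)"
    unfolding growth_def by algebra
  finally have "defect_loss + d * norm_loss \<le> d * (defect_weight l * (2 * growth)) + 81/50 * gain * \<nu>\<^sup>2" by simp
  then have "x\<^sup>2 * (defect_loss + d * norm_loss)
      \<le> x\<^sup>2 * (d * (defect_weight l * (2 * growth)) + 81/50 * gain * \<nu>\<^sup>2)" by (rule mult_left_mono) simp
  moreover have "x\<^sup>2 * (defect_loss + d * norm_loss) = x\<^sup>2 * defect_loss + d * (x\<^sup>2 * norm_loss)" by algebra
  moreover have "x\<^sup>2 * (d * (defect_weight l * (2 * growth)) + 81/50 * gain * \<nu>\<^sup>2)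
      = d * (defect_weight l * (2 * (x\<^sup>2 * growth))) + x\<^sup>2 * (81/50 * gain * \<nu>\<^sup>2)" by algebra
  ultimately show ?thesis by (simp only:)
qed

theorem new_defect_inequality:
  assumes defect_inequality:
    "\<And>\<xi>. (norm (defect \<xi>))\<^sup>2 \<le> d * (\<xi> \<bullet> defect \<xi> + defect_weight l * (norm (shifted \<mu> (u \<xi>)))\<^sup>2)"
  shows "(norm (new_defect \<phi>))\<^sup>2 \<le> d * (\<phi> \<bullet> new_defect \<phi> + defect_weight l * (norm (shifted \<mu> (upd \<phi>)))\<^sup>2)"
proof -
  define c where "c = defect_weight l"
  let ?\<theta> = pullback_weight and ?h = "(norm (shifted \<mu> (u pullback)))\<^sup>2"
  note weight = pullback_weight_bounds(1,2)
  have c_nonneg: "0 \<le> c" unfolding c_def by (rule defect_weight_bounds(1)[OF l_ge])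
  have "?\<theta> * (norm (defect pullback))\<^sup>2 \<le> ?\<theta> * (d * (pullback \<bullet> defect pullback + c * ?h))"
    unfolding c_def by (intro mult_left_mono defect_inequality weight)
  also have "\<dots> = d * (?\<theta> * (pullback \<bullet> defect pullback) + ?\<theta> * (c * ?h))" by (simp add: algebra_simps)
  also have "\<dots> \<le> d * (?\<theta> * (pullback \<bullet> defect pullback) + c * ?h)"
    using weight c_nonneg by (intro mult_left_mono add_left_mono mult_left_le_one_le d_nonneg) simp_all
  finally have "(norm (new_defect \<phi>))\<^sup>2 \<le> d * (?\<theta> * (pullback \<bullet> defect pullback) + c * ?h)
      + d * (c * (2 * (x\<^sup>2 * growth))) - d * (x\<^sup>2 * norm_loss)"
    using norm_new_defect_le losses_le_growth[folded c_def] by linarith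
  also have "\<dots> = d * ((?\<theta> * (pullback \<bullet> defect pullback) - x\<^sup>2 * norm_loss) + c * (?h + 2 * (x\<^sup>2 * growth)))"
    by (simp add: algebra_simps)
  also have "\<dots> \<le> d * (((norm (upd \<phi>))\<^sup>2 - (norm \<phi>)\<^sup>2) + c * (norm (shifted \<mu> (upd \<phi>)))\<^sup>2)"
    by (intro mult_left_mono add_mono norm_upd_ge_pullback norm_shifted_upd_ge c_nonneg d_nonneg)
  finally show ?thesis by (simp only: inner_new_defect c_def)
qed

end

section \<open>Skew operators built from two Gram operators\<close>

lemma (in psd_form) bilinear_compose:
  assumes "linear f" "linear g" "\<And>\<xi>. f \<xi> \<in> V" "\<And>\<xi>. g \<xi> \<in> V"
  shows "bilinear (\<lambda>\<xi> \<zeta>. B (f \<xi>) (g \<zeta>))"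
  using assms by (auto simp: bilinear_def linear_iff bilinear_simps)

definition pair_excess :: "real \<Rightarrow> real \<Rightarrow> real \<Rightarrow> real" where
  "pair_excess s k m = (2 * s * m - 2 * m\<^sup>2) / k - 2 * s - 2 * k + 4 * m + (m - k)\<^sup>2 / s"

lemma pair_excess_symmetrized_nonneg:
  assumes "0 < k" "0 < m" "k \<le> s" "m \<le> s"
  shows "0 \<le> pair_excess s k m + pair_excess s m k"
proof -
  have s: "0 < s" using assms by linarith
  have "(pair_excess s k m + pair_excess s m k) * (k * m * s) = 2 * (m - k)\<^sup>2 * ((s - k) * (s - m))"
    using assms s by (simp add: pair_excess_def field_simps power2_eq_square)
  also have "0 \<le> \<dots>" using assms by simp
  finally have "0 \<le> (pair_excess s k m + pair_excess s m k) * (k * m * s)" .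
  moreover have "0 < k * m * s" using assms(1,2) s by simp
  ultimately show ?thesis by (auto simp: zero_le_mult_iff)
qed

locale symmetric_pair = psd_form V B
  for V :: "'v::real_vector set" and B +
  fixes p q :: "'e::euclidean_space \<Rightarrow> 'v" and P Q S :: "'e \<Rightarrow> 'e"
  assumes pair_linear: "linear p" "linear q" "linear P" "linear Q" "linear S"
    and pair_in: "p \<xi> \<in> V" "q \<xi> \<in> V"
    and P_gram: "B (p \<xi>) (p \<zeta>) = \<xi> \<bullet> P \<zeta>"
    and Q_gram: "B (q \<xi>) (q \<zeta>) = \<xi> \<bullet> Q \<zeta>"
    and S_gram: "B (p \<xi>) (q \<zeta>) = \<xi> \<bullet> S \<zeta>"
    and S_sym: "S \<xi> \<bullet> \<zeta> = \<xi> \<bullet> S \<zeta>"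
begin

definition wedge :: "'e \<Rightarrow> 'v" where
  "wedge \<xi> = p (S \<xi>) - q (P \<xi>)"

lemma wedge_in: "wedge \<xi> \<in> V"
  by (simp add: wedge_def pair_in)

lemma P_sym: "P \<xi> \<bullet> \<zeta> = \<xi> \<bullet> P \<zeta>"
  by (metis P_gram sym pair_in(1) inner_commute)

lemma S_swap: "b \<bullet> S c = c \<bullet> S b"
  by (metis S_sym inner_commute)

context
  fixes E :: "'e set" and k :: "'e \<Rightarrow> real"
  assumes basis: "orthonormal E" "span E = UNIV" and eigen: "\<And>b. b \<in> E \<Longrightarrow> P b = k b *\<^sub>R b"
begin

lemma eigenvalue: "b \<in> E \<Longrightarrow> b \<bullet> P b = k b"
  using orthonormal_inner[OF basis(1)] by (simp add: eigen)

lemma eigenvalue_nonneg: "b \<in> E \<Longrightarrow> 0 \<le> k b"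
  using nonneg[OF pair_in(1), of b] by (simp add: P_gram eigenvalue)

lemma S_eq_zero:
  assumes "b \<in> E" "k b = 0"
  shows "b \<bullet> S \<zeta> = 0"
  using cauchy_schwarz[OF pair_in(1) pair_in(2), of b \<zeta>] eigenvalue[OF assms(1)] assms(2)
  by (simp add: P_gram S_gram)

lemma inner_self_expand: "v \<bullet> v = (\<Sum>b\<in>E. (b \<bullet> v)\<^sup>2)"
  using orthonormal_parseval[OF basis, of v v] by (simp add: power2_eq_square inner_commute)

text \<open>Where \<open>k b = 0\<close> the quotient is the junk value \<open>0\<close>, which is the correct one by \<open>S_eq_zero\<close>.\<close>

lemma bessel_inequality: "(\<Sum>b\<in>E. (b \<bullet> S \<zeta>)\<^sup>2 / k b) \<le> \<zeta> \<bullet> Q \<zeta>"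
proof -
  define z where "z = (\<Sum>b\<in>E. ((b \<bullet> S \<zeta>) / k b) *\<^sub>R b)"
  let ?t = "\<Sum>b\<in>E. (b \<bullet> S \<zeta>)\<^sup>2 / k b"
  have "b \<bullet> P z = b \<bullet> S \<zeta>" if b: "b \<in> E" for b
  proof -
    have "b \<bullet> P z = k b * (b \<bullet> z)" by (simp add: P_sym[symmetric] eigen[OF b])
    also have "b \<bullet> z = (\<Sum>c\<in>E. if b = c then (c \<bullet> S \<zeta>) / k c else 0)"
      unfolding z_def inner_sum_right using orthonormal_inner[OF basis(1) b] by (intro sum.cong) auto
    also have "\<dots> = (b \<bullet> S \<zeta>) / k b" using b basis(1) by (simp add: orthonormal_def)
    finally show ?thesis using S_eq_zero[OF b] by (cases "k b = 0") auto
  qed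
  then have "z \<bullet> P z = ?t" by (simp add: z_def inner_sum_left power2_eq_square)
  moreover have "z \<bullet> S \<zeta> = ?t" by (simp add: z_def inner_sum_left power2_eq_square)
  moreover have "0 \<le> B (q \<zeta> - p z) (q \<zeta> - p z)" by (intro nonneg carrier_closed pair_in)
  moreover have "B (q \<zeta> - p z) (q \<zeta> - p z) = \<zeta> \<bullet> Q \<zeta> - 2 * (z \<bullet> S \<zeta>) + z \<bullet> P z"
    by (simp add: bilinear_simps pair_in P_gram Q_gram S_gram sym[of "q \<zeta>" "p z"])
  ultimately show ?thesis by linarith
qed

lemma wedge_energy:
  assumes c: "c \<in> E"
  shows "B (wedge c) (wedge c) = (\<Sum>b\<in>E. (k b - 2 * k c) * (b \<bullet> S c)\<^sup>2) + (k c)\<^sup>2 * (c \<bullet> Q c)"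
proof -
  have "B (wedge c) (wedge c) = S c \<bullet> P (S c) - 2 * (k c * (S c \<bullet> S c)) + (k c)\<^sup>2 * (c \<bullet> Q c)"
    by (simp add: wedge_def eigen[OF c] linear_scale[OF pair_linear(2)] bilinear_simps pair_in P_gram Q_gram S_gram
        sym[of "q c" "p _"] power2_eq_square algebra_simps)
  also have "S c \<bullet> P (S c) = (\<Sum>b\<in>E. k b * (b \<bullet> S c)\<^sup>2)"
    unfolding orthonormal_parseval[OF basis, of "S c" "P (S c)"]
    by (intro sum.cong) (auto simp: P_sym[symmetric] eigen power2_eq_square inner_commute[of "S c"])
  finally show ?thesis
    by (simp add: inner_self_expand[of "S c"] sum_distrib_left sum_subtractf left_diff_distrib mult.assoc)
qed

lemma norm_commutator:
  assumes c: "c \<in> E"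
  shows "(norm (P (S c) - S (P c)))\<^sup>2 = (\<Sum>b\<in>E. (k c - k b)\<^sup>2 * (b \<bullet> S c)\<^sup>2)"
proof -
  have "b \<bullet> (P (S c) - S (P c)) = (k b - k c) * (b \<bullet> S c)" if "b \<in> E" for b
    using eigen[OF that] eigen[OF c]
    by (simp add: inner_diff_right P_sym[symmetric] linear_scale[OF pair_linear(5)] left_diff_distrib)
  then show ?thesis
    unfolding power2_norm_eq_inner inner_self_expand[of "P (S c) - S (P c)"]
    by (intro sum.cong) (auto simp: power_mult_distrib power2_commute)
qed

lemma column_excess_le:
  assumes c: "c \<in> E" and k_le: "k c \<le> s"
  shows "(\<Sum>b\<in>E. pair_excess s (k b) (k c) * (b \<bullet> S c)\<^sup>2)
    \<le> 2 * s * (P c \<bullet> Q c - S c \<bullet> S c) - 2 * B (wedge c) (wedge c) + (norm (P (S c) - S (P c)))\<^sup>2 / s"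
proof -
  have "0 \<le> 2 * s * k c - 2 * (k c)\<^sup>2"
    using mult_right_mono[OF k_le eigenvalue_nonneg[OF c]] by (simp add: power2_eq_square)
  then have "(2 * s * k c - 2 * (k c)\<^sup>2) * (\<Sum>b\<in>E. (b \<bullet> S c)\<^sup>2 / k b)
      \<le> (2 * s * k c - 2 * (k c)\<^sup>2) * (c \<bullet> Q c)"
    by (intro mult_left_mono bessel_inequality)
  moreover have "(\<Sum>b\<in>E. pair_excess s (k b) (k c) * (b \<bullet> S c)\<^sup>2)
      = (2 * s * k c - 2 * (k c)\<^sup>2) * (\<Sum>b\<in>E. (b \<bullet> S c)\<^sup>2 / k b) - 2 * s * (\<Sum>b\<in>E. (b \<bullet> S c)\<^sup>2)
        - 2 * (\<Sum>b\<in>E. (k b - 2 * k c) * (b \<bullet> S c)\<^sup>2) + (\<Sum>b\<in>E. (k c - k b)\<^sup>2 * (b \<bullet> S c)\<^sup>2) / s"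
    unfolding sum_distrib_left sum_divide_distrib sum_subtractf[symmetric] sum.distrib[symmetric]
    by (intro sum.cong) (simp_all add: pair_excess_def left_diff_distrib distrib_right)
  moreover have "P c \<bullet> Q c = k c * (c \<bullet> Q c)" by (simp add: eigen[OF c])
  ultimately show ?thesis
    unfolding wedge_energy[OF c] norm_commutator[OF c] inner_self_expand[of "S c"]
    by (simp add: algebra_simps)
qed

lemma sum_pair_excess_nonneg:
  assumes k_le: "\<And>b. b \<in> E \<Longrightarrow> k b \<le> s"
  shows "0 \<le> (\<Sum>c\<in>E. \<Sum>b\<in>E. pair_excess s (k b) (k c) * (b \<bullet> S c)\<^sup>2)"
proof -
  have "0 \<le> (\<Sum>c\<in>E. \<Sum>b\<in>E. (pair_excess s (k b) (k c) + pair_excess s (k c) (k b)) * (b \<bullet> S c)\<^sup>2)"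
  proof (intro sum_nonneg)
    fix c b assume cb: "c \<in> E" "b \<in> E"
    show "0 \<le> (pair_excess s (k b) (k c) + pair_excess s (k c) (k b)) * (b \<bullet> S c)\<^sup>2"
    proof (cases "k b = 0 \<or> k c = 0")
      case True
      then show ?thesis using S_eq_zero[OF cb(2), of c] S_eq_zero[OF cb(1), of b] S_swap[of b c] by auto
    next
      case False
      then have "0 < k b" "0 < k c" using eigenvalue_nonneg[OF cb(1)] eigenvalue_nonneg[OF cb(2)] by (auto simp: less_le)
      then show ?thesis using k_le cb by (intro mult_nonneg_nonneg pair_excess_symmetrized_nonneg) auto
    qed
  qed
  also have "\<dots> = (\<Sum>c\<in>E. \<Sum>b\<in>E. pair_excess s (k b) (k c) * (b \<bullet> S c)\<^sup>2)
      + (\<Sum>c\<in>E. \<Sum>b\<in>E. pair_excess s (k c) (k b) * (b \<bullet> S c)\<^sup>2)"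
    by (simp only: distrib_right sum.distrib)
  also have "(\<Sum>c\<in>E. \<Sum>b\<in>E. pair_excess s (k c) (k b) * (b \<bullet> S c)\<^sup>2)
      = (\<Sum>c\<in>E. \<Sum>b\<in>E. pair_excess s (k b) (k c) * (b \<bullet> S c)\<^sup>2)"
    by (subst sum.swap) (simp add: S_swap)
  finally show ?thesis by linarith
qed

end

lemma wedge_linear: "linear wedge"
  unfolding wedge_def
  by (intro linear_compose_sub linear_compose[OF pair_linear(5,1), unfolded o_def]
      linear_compose[OF pair_linear(3,2), unfolded o_def])

text \<open>\<open>wedge \<xi>\<close> is the image of \<open>p \<xi>\<close> under the skew operator \<open>p q* - q p*\<close>, and the first sum on the right is half its
  squared Hilbert-Schmidt norm.\<close>

theorem sum_wedge_energy_le: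
  assumes P_le: "\<And>\<xi>. \<xi> \<bullet> P \<xi> \<le> s * (\<xi> \<bullet> \<xi>)"
  shows "2 * (\<Sum>b\<in>Basis. B (wedge b) (wedge b))
      \<le> 2 * s * (\<Sum>b\<in>Basis. P b \<bullet> Q b - S b \<bullet> S b) + (\<Sum>b\<in>Basis. (norm (P (S b) - S (P b)))\<^sup>2) / s"
proof -
  obtain E k where basis: "orthonormal E" "span E = UNIV" and eigen: "\<And>b. b \<in> E \<Longrightarrow> P b = k b *\<^sub>R b"
    using spectral_theorem[OF pair_linear(3) P_sym] by metis
  note eigen_facts = basis eigen
  have k_le: "k b \<le> s" if "b \<in> E" for b
    using P_le[of b] eigenvalue[OF eigen_facts that] orthonormal_inner[OF basis(1) that that] by simp
  define excess where "excess v w = 2 * s * (P v \<bullet> Q w - S v \<bullet> S w) - 2 * B (wedge v) (wedge w)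
      + (P (S v) - S (P v)) \<bullet> (P (S w) - S (P w)) / s" for v w
  have "bilinear excess"
  proof -
    have combination: "bilinear (\<lambda>v w. 2 * s * (f v w - g v w) - 2 * h v w + n v w / s)"
      if "bilinear f" "bilinear g" "bilinear h" "bilinear n" for f g h n :: "'e \<Rightarrow> 'e \<Rightarrow> real"
      using that by (simp add: bilinear_def linear_iff algebra_simps add_divide_distrib)
    have "bilinear (\<lambda>v w. P v \<bullet> Q w)" "bilinear (\<lambda>v w. S v \<bullet> S w)" "bilinear (\<lambda>v w. B (wedge v) (wedge w))"
      "bilinear (\<lambda>v w. (P (S v) - S (P v)) \<bullet> (P (S w) - S (P w)))"
      using linear_compose[OF pair_linear(5,3)] linear_compose[OF pair_linear(3,5)]
      by (auto intro!: bilinear_inner bilinear_compose pair_linear wedge_linear wedge_in linear_compose_sub simp: o_def)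
    then show ?thesis unfolding excess_def by (intro combination)
  qed
  have "0 \<le> (\<Sum>c\<in>E. \<Sum>b\<in>E. pair_excess s (k b) (k c) * (b \<bullet> S c)\<^sup>2)"
    by (rule sum_pair_excess_nonneg[OF eigen_facts k_le])
  also have "\<dots> \<le> (\<Sum>c\<in>E. excess c c)"
    unfolding excess_def dot_square_norm[of "P (S _) - S (P _)"]
    by (intro sum_mono column_excess_le[OF eigen_facts] k_le)
  also have "\<dots> = (\<Sum>b\<in>Basis. excess b b)"
    using sum_Basis_bilinear[OF basis \<open>bilinear excess\<close>] by simp
  also have "\<dots> = 2 * s * (\<Sum>b\<in>Basis. P b \<bullet> Q b - S b \<bullet> S b) - 2 * (\<Sum>b\<in>Basis. B (wedge b) (wedge b))
      + (\<Sum>b\<in>Basis. (norm (P (S b) - S (P b)))\<^sup>2) / s"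
    unfolding excess_def power2_norm_eq_inner
    by (simp only: sum.distrib sum_subtractf sum_distrib_left[symmetric] sum_divide_distrib[symmetric])
  finally show ?thesis by linarith
qed

end

section \<open>Energy spaces\<close>

locale energy_space = positive_contraction G
  for G :: "'v::real_inner \<Rightarrow> 'v" +
  fixes H :: "'v set" and a :: "'v \<Rightarrow> 'v \<Rightarrow> real"
  assumes subspace_H: "subspace H"
    and a_sym: "v \<in> H \<Longrightarrow> w \<in> H \<Longrightarrow> a v w = a w v"
    and a_add: "v \<in> H \<Longrightarrow> w \<in> H \<Longrightarrow> z \<in> H \<Longrightarrow> a (v + w) z = a v z + a w z"
    and a_scale: "v \<in> H \<Longrightarrow> z \<in> H \<Longrightarrow> a (c *\<^sub>R v) z = c * a v z"
    and a_ge: "v \<in> H \<Longrightarrow> v \<bullet> v \<le> a v v"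
    and G_in: "G v \<in> H"
    and a_G: "w \<in> H \<Longrightarrow> a (G v) w = v \<bullet> w"
begin

sublocale energy: psd_form H a
  by unfold_locales (use subspace_H a_sym a_add a_scale a_ge inner_ge_zero order_trans in blast)+

abbreviation energy_norm :: "'v \<Rightarrow> real" where
  "energy_norm \<equiv> energy.seminorm"

lemma a_G_right: "w \<in> H \<Longrightarrow> a w (G v) = w \<bullet> v"
  using a_G[of w v] a_sym[of w "G v"] G_in[of v] by (simp add: inner_commute)

lemma energy_norm_G: "energy_norm (G v) = green_norm v"
  by (simp add: energy.seminorm_def green.seminorm_def a_G G_in)

lemma norm_le_energy_norm: "v \<in> H \<Longrightarrow> norm v \<le> energy_norm v"
  unfolding energy.seminorm_def norm_eq_sqrt_inner by (intro real_sqrt_le_mono a_ge)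

lemma norm_adjoint_le_green_norm:
  fixes f :: "'e::real_inner \<Rightarrow> 'v"
  assumes "\<And>\<xi>. f \<xi> \<in> H" and adj: "\<And>\<xi> v. f \<xi> \<bullet> v = \<xi> \<bullet> g v"
    and le: "\<And>\<xi>. energy_norm (f \<xi>) \<le> m * norm \<xi>" and m: "0 \<le> m"
  shows "norm (g v) \<le> m * green_norm v"
proof (cases "g v = 0")
  case False
  have "norm (g v) * norm (g v) = a (f (g v)) (G v)"
    using assms(1) by (simp add: a_G_right adj power2_norm_eq_inner flip: power2_eq_square)
  also have "\<dots> \<le> energy_norm (f (g v)) * green_norm v"
    using energy.abs_le_seminorm[OF assms(1) G_in, of "g v" v] by (simp add: energy_norm_G)
  also have "\<dots> \<le> (m * norm (g v)) * green_norm v" by (intro mult_right_mono le green_norm_nonneg)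
  finally show ?thesis using False by (simp add: mult_ac)
qed (use m green_norm_nonneg in simp)

end

context energy_space
begin

definition energy_gram :: "('e::euclidean_space \<Rightarrow> 'v) \<Rightarrow> 'e \<Rightarrow> 'e" where
  "energy_gram f \<xi> = (\<Sum>b\<in>Basis. a (f b) (f \<xi>) *\<^sub>R b)"

definition total_energy :: "('e::euclidean_space \<Rightarrow> 'v) \<Rightarrow> real" where
  "total_energy f = (\<Sum>b\<in>Basis. a (f b) (f b))"

lemma total_energy_nonneg: "(\<And>\<xi>. f \<xi> \<in> H) \<Longrightarrow> 0 \<le> total_energy f"
  by (simp add: total_energy_def sum_nonneg energy.nonneg)

context
  fixes f :: "'e::euclidean_space \<Rightarrow> 'v"
  assumes f_linear: "linear f" and f_in: "\<And>\<xi>. f \<xi> \<in> H"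
begin

lemma energy_gram_linear: "linear (energy_gram f)"
  by (rule linearI) (simp_all add: energy_gram_def linear_add[OF f_linear] linear_scale[OF f_linear]
      energy.bilinear_simps f_in scaleR_add_left sum.distrib scaleR_right.sum)

lemma inner_energy_gram: "\<xi> \<bullet> energy_gram f \<zeta> = a (f \<xi>) (f \<zeta>)"
proof -
  have "a (f \<xi>) (f \<zeta>) = a (\<Sum>b\<in>Basis. (\<xi> \<bullet> b) *\<^sub>R f b) (f \<zeta>)"
    by (simp add: euclidean_representation flip: linear_scale[OF f_linear] linear_sum[OF f_linear])
  then show ?thesis
    by (simp add: energy.sum_left energy.bilinear_simps f_in energy_gram_def inner_sum_right mult.commute)
qed

lemma energy_gram_sym: "energy_gram f \<xi> \<bullet> \<zeta> = \<xi> \<bullet> energy_gram f \<zeta>"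
  by (simp add: inner_commute[of "energy_gram f \<xi>"] inner_energy_gram a_sym f_in)

lemma energy_le_of_norm_ge:
  assumes total: "total_energy f \<le> e" and lower: "\<And>\<xi>. m * (\<xi> \<bullet> \<xi>) \<le> f \<xi> \<bullet> f \<xi>"
  shows "a (f \<xi>) (f \<xi>) \<le> (e - m * (real DIM('e) - 1)) * (\<xi> \<bullet> \<xi>)"
proof -
  let ?T = "\<lambda>\<xi>. energy_gram f \<xi> - m *\<^sub>R \<xi>"
  have "\<xi> \<bullet> ?T \<xi> \<le> (\<Sum>b\<in>Basis. b \<bullet> ?T b) * (\<xi> \<bullet> \<xi>)"
  proof (rule psd_operator_le_trace)
    show "linear ?T" by (intro linear_compose_sub energy_gram_linear linear_scale_self)
    show "?T \<xi> \<bullet> \<zeta> = \<xi> \<bullet> ?T \<zeta>" for \<xi> \<zeta> by (simp add: inner_diff_left inner_diff_right energy_gram_sym)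
    show "0 \<le> \<xi> \<bullet> ?T \<xi>" for \<xi>
      using order_trans[OF lower a_ge[OF f_in], of \<xi>] by (simp add: inner_diff_right inner_energy_gram)
  qed
  also have "(\<Sum>b\<in>Basis. b \<bullet> ?T b) = total_energy f - m * real DIM('e)"
    by (simp add: inner_diff_right inner_energy_gram total_energy_def sum_subtractf)
  also have "(total_energy f - m * real DIM('e)) * (\<xi> \<bullet> \<xi>) \<le> (e - m * real DIM('e)) * (\<xi> \<bullet> \<xi>)"
    using total by (intro mult_right_mono) simp_all
  finally show ?thesis by (simp add: inner_diff_right inner_energy_gram algebra_simps)
qed

lemma energy_norm_le_of_norm_ge:
  assumes "total_energy f \<le> e" and "\<And>\<xi>. m * (\<xi> \<bullet> \<xi>) \<le> f \<xi> \<bullet> f \<xi>"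
  shows "energy_norm (f \<xi>) \<le> sqrt (e - m * (real DIM('e) - 1)) * norm \<xi>"
  using real_sqrt_le_mono[OF energy_le_of_norm_ge[OF assms, of \<xi>]]
  by (simp add: energy.seminorm_def real_sqrt_mult norm_eq_sqrt_inner)

end

end

section \<open>Energy drop of one step\<close>

locale energy_step = two_stage G u uh us uhs x l + energy_space G H a
  for G :: "'v::real_inner \<Rightarrow> 'v" and u uh :: "'e::euclidean_space \<Rightarrow> 'v" and us uhs x l H a +
  fixes e2 :: real
  assumes u_in: "u \<xi> \<in> H"
    and total_energy_u_le: "total_energy u \<le> e2"
    and e2_ge: "l + (real DIM('e) - 1) \<le> e2"
    and x_le: "x * (2 * sqrt (real DIM('e)) * e2 * l\<^sup>2 + l) \<le> 1"
begin

definition mass :: "'e \<Rightarrow> 'e" where "mass \<xi> = us (u \<xi>)"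
definition descent :: "'e \<Rightarrow> 'v" where "descent \<xi> = skew (u \<xi>)"

abbreviation stiffness :: "'e \<Rightarrow> 'e" where "stiffness \<equiv> energy_gram u"

definition dual_descent :: "'e \<Rightarrow> 'v" where "dual_descent \<xi> = u (mass \<xi>) - G (u (stiffness \<xi>))"
definition dissipation :: real where
  "dissipation = (\<Sum>b\<in>Basis. ritz b \<bullet> stiffness b - mass b \<bullet> mass b)"
definition \<kappa> :: real where "\<kappa> = sqrt (l * e2)"

lemma l_le_e2: "l \<le> e2"
  using e2_ge DIM_positive[where 'a='e] by linarith

lemma skew_in: "skew v \<in> H"
  by (simp add: skew_def G_in u_in)

lemma incr_in: "incr \<xi> \<in> H"
  by (simp add: incr_eq_skew skew_in)

lemma uh_in: "uh \<xi> \<in> H"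
  by (simp add: uh_eq u_in incr_in)

lemma descent_in: "descent \<xi> \<in> H" and dual_descent_in: "dual_descent \<xi> \<in> H"
  by (simp_all add: descent_def dual_descent_def skew_in u_in G_in)

lemma upd_in: "upd \<xi> \<in> H"
  by (simp add: upd_def uh_in G_in)

lemmas in_H = u_in G_in skew_in incr_in uh_in descent_in dual_descent_in upd_in

lemma mass_linear: "linear mass"
  by (rule linearI) (simp_all add: mass_def linear_simps)

lemmas stiffness_linear = energy_gram_linear[OF u_linear u_in]
  and inner_stiffness = inner_energy_gram[OF u_linear u_in]

lemma inner_mass: "\<xi> \<bullet> mass \<zeta> = u \<xi> \<bullet> u \<zeta>"
  by (simp add: mass_def u_adj)

lemma mass_sym: "mass \<xi> \<bullet> \<zeta> = \<xi> \<bullet> mass \<zeta>"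
  by (simp add: inner_commute[of "mass \<xi>"] inner_mass) (rule inner_commute)

sublocale primal: symmetric_pair H a "\<lambda>\<xi>. G (u \<xi>)" u ritz stiffness mass
proof (intro symmetric_pair.intro energy.psd_form_axioms symmetric_pair_axioms.intro)
  show "a (G (u \<xi>)) (G (u \<zeta>)) = \<xi> \<bullet> ritz \<zeta>" for \<xi> \<zeta>
    by (simp add: a_G G_in inner_ritz)
qed (auto intro: linear_compose[OF u_linear G_linear, unfolded o_def] operators_linear u_linear stiffness_linear
    mass_linear G_in u_in simp: a_G u_in inner_stiffness inner_mass mass_sym)

sublocale dual: symmetric_pair H a u "\<lambda>\<xi>. G (u \<xi>)" stiffness ritz mass
proof (intro symmetric_pair.intro energy.psd_form_axioms symmetric_pair_axioms.intro)
  show "a (u \<xi>) (G (u \<zeta>)) = \<xi> \<bullet> mass \<zeta>" for \<xi> \<zeta>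
    by (simp add: a_G_right u_in inner_mass)
qed (auto intro: primal.pair_linear primal.pair_in simp: primal.P_gram primal.S_sym inner_stiffness)

lemma descent_eq_wedge: "descent \<xi> = primal.wedge \<xi>"
  by (simp add: descent_def primal.wedge_def skew_def mass_def ritz_def)

lemma dual_descent_eq_wedge: "dual_descent \<xi> = dual.wedge \<xi>"
  by (simp add: dual_descent_def dual.wedge_def)

lemma total_energy_descent_le:
  "2 * total_energy descent \<le> 2 * l * dissipation + (\<Sum>b\<in>Basis. (norm (us (descent b)))\<^sup>2) / l"
proof -
  have "us (descent \<xi>) = ritz (mass \<xi>) - mass (ritz \<xi>)" for \<xi>
    by (simp add: descent_def skew_def ritz_def mass_def linear_simps)
  then show ?thesis
    using primal.sum_wedge_energy_le[of l] ritz_le by (simp add: total_energy_def dissipation_def descent_eq_wedge)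
qed

lemma sum_norm_us_descent_le:
  "(\<Sum>b\<in>Basis. (norm (us (descent b)))\<^sup>2) \<le> l * (\<Sum>b\<in>Basis. (norm (descent b))\<^sup>2)"
  "(\<Sum>b\<in>Basis. (norm (descent b))\<^sup>2) \<le> total_energy descent"
  unfolding sum_distrib_left total_energy_def
  by (intro sum_mono norm_us_power2_le, intro sum_mono) (simp add: power2_norm_eq_inner a_ge descent_in)

lemma total_energy_descent_le_dissipation: "total_energy descent \<le> 2 * l * dissipation"
proof -
  have "(\<Sum>b\<in>Basis. (norm (us (descent b)))\<^sup>2) \<le> l * total_energy descent"
    using order_trans[OF sum_norm_us_descent_le(1) mult_left_mono[OF sum_norm_us_descent_le(2)]] l_ge by simp
  then have "(\<Sum>b\<in>Basis. (norm (us (descent b)))\<^sup>2) / l \<le> total_energy descent"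
    using l_ge by (simp add: pos_divide_le_eq mult.commute)
  then show ?thesis using total_energy_descent_le by linarith
qed

lemma dissipation_nonneg: "0 \<le> dissipation"
proof -
  have "0 \<le> (2 * l) * dissipation"
    using total_energy_descent_le_dissipation total_energy_nonneg[of descent] descent_in by force
  then show ?thesis using l_ge by (simp add: zero_le_mult_iff)
qed

lemma stiffness_le: "\<xi> \<bullet> stiffness \<xi> \<le> e2 * (\<xi> \<bullet> \<xi>)"
  using energy_le_of_norm_ge[OF u_linear u_in total_energy_u_le, of 0] by (simp add: inner_stiffness)

lemma energy_norm_u_le: "energy_norm (u \<xi>) \<le> sqrt e2 * norm \<xi>"
  using energy_norm_le_of_norm_ge[OF u_linear u_in total_energy_u_le, of 0] by simp

lemma sum_norm_dual_descent_le: "(\<Sum>b\<in>Basis. (norm (dual_descent b))\<^sup>2) \<le> 2 * e2 * dissipation"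
proof -
  let ?c = "\<lambda>b. stiffness (mass b) - mass (stiffness b)"
  have e2_pos: "0 < e2" using l_ge l_le_e2 by linarith
  have "2 * total_energy dual_descent
      \<le> 2 * e2 * (\<Sum>b\<in>Basis. stiffness b \<bullet> ritz b - mass b \<bullet> mass b) + (\<Sum>b\<in>Basis. (norm (?c b))\<^sup>2) / e2"
    unfolding total_energy_def dual_descent_eq_wedge by (rule dual.sum_wedge_energy_le[OF stiffness_le])
  moreover have "(\<Sum>b\<in>Basis. stiffness b \<bullet> ritz b - mass b \<bullet> mass b) = dissipation"
    by (simp add: dissipation_def inner_commute)
  moreover have "(\<Sum>b\<in>Basis. (norm (?c b))\<^sup>2) \<le> e2 * total_energy dual_descent"
    unfolding total_energy_def sum_distrib_left
  proof (rule sum_mono)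
    fix b :: 'e
    have "\<xi> \<bullet> ?c b = a (u \<xi>) (dual_descent b)" for \<xi>
      by (simp add: dual_descent_def energy.bilinear_simps u_in G_in a_G_right inner_stiffness inner_mass inner_diff_right)
    then have "norm (?c b) * norm (?c b) = a (u (?c b)) (dual_descent b)"
      by (metis power2_norm_eq_inner power2_eq_square)
    also have "\<dots> \<le> energy_norm (u (?c b)) * energy_norm (dual_descent b)"
      using energy.abs_le_seminorm[OF u_in dual_descent_in, of "?c b" b] by simp
    also have "\<dots> \<le> (sqrt e2 * norm (?c b)) * energy_norm (dual_descent b)"
      by (intro mult_right_mono energy_norm_u_le energy.seminorm_nonneg dual_descent_in)
    finally have "norm (?c b) \<le> sqrt e2 * energy_norm (dual_descent b)"
      using e2_pos energy.seminorm_nonneg[OF dual_descent_in, of b] by (cases "?c b = 0") simp_all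
    then have "(norm (?c b))\<^sup>2 \<le> (sqrt e2 * energy_norm (dual_descent b))\<^sup>2" by (intro power_mono) simp_all
    then show "(norm (?c b))\<^sup>2 \<le> e2 * a (dual_descent b) (dual_descent b)"
      using e2_pos by (simp add: power_mult_distrib energy.seminorm_power2 dual_descent_in)
  qed
  then have "(\<Sum>b\<in>Basis. (norm (?c b))\<^sup>2) / e2 \<le> total_energy dual_descent"
    using e2_pos by (simp add: pos_divide_le_eq mult.commute)
  moreover have "(\<Sum>b\<in>Basis. (norm (dual_descent b))\<^sup>2) \<le> total_energy dual_descent"
    unfolding total_energy_def by (intro sum_mono) (simp add: power2_norm_eq_inner a_ge dual_descent_in)
  ultimately show ?thesis by (simp add: mult.assoc)
qed

lemma kappa_bounds: "0 < \<kappa>" "l \<le> \<kappa>" "\<kappa> \<le> l * e2" "\<kappa>\<^sup>2 = l * e2"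
proof -
  have "l * l \<le> l * e2" using l_ge l_le_e2 by (intro mult_left_mono) simp_all
  then show l_le: "l \<le> \<kappa>" unfolding \<kappa>_def by (intro real_le_rsqrt) (simp add: power2_eq_square)
  then show "0 < \<kappa>" using l_ge by linarith
  show sq: "\<kappa>\<^sup>2 = l * e2" using l_ge l_le_e2 by (simp add: \<kappa>_def)
  have "\<kappa> * 1 \<le> \<kappa> * \<kappa>" using l_le l_ge by (intro mult_left_mono) simp_all
  then show "\<kappa> \<le> l * e2" unfolding sq[symmetric] by (simp add: power2_eq_square)
qed

lemma x_bounds: "x * (2 * e2 * l\<^sup>2 + l) \<le> 1" "3 * (x * l) \<le> 1" "2 * (x * \<kappa>) \<le> 1" "x * \<kappa> + 31/16 * (x * l) \<le> 1"
proof -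
  have "1 * (2 * e2 * l\<^sup>2) \<le> sqrt (real DIM('e)) * (2 * e2 * l\<^sup>2)"
    using DIM_positive[where 'a='e] l_ge l_le_e2 by (intro mult_right_mono) simp_all
  then have "x * (2 * e2 * l\<^sup>2 + l) \<le> x * (2 * sqrt (real DIM('e)) * e2 * l\<^sup>2 + l)"
    using x_pos by (intro mult_left_mono) (simp_all add: mult_ac)
  then show bound: "x * (2 * e2 * l\<^sup>2 + l) \<le> 1" using x_le by linarith
  have "l * \<kappa> \<le> e2 * l\<^sup>2" using mult_left_mono[OF kappa_bounds(3), of l] l_ge by (simp add: power2_eq_square mult_ac)
  moreover have "1 * \<kappa> \<le> l * \<kappa>" "l * 1 \<le> l * \<kappa>"
    using l_ge kappa_bounds(1,2) by (intro mult_mono; simp)+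
  ultimately have "3 * l \<le> 2 * e2 * l\<^sup>2 + l" "2 * \<kappa> \<le> 2 * e2 * l\<^sup>2 + l" "\<kappa> + 31/16 * l \<le> 2 * e2 * l\<^sup>2 + l"
    using l_ge by linarith+
  then have "x * (3 * l) \<le> 1" "x * (2 * \<kappa>) \<le> 1" "x * (\<kappa> + 31/16 * l) \<le> 1"
    using bound x_pos by (meson mult_left_mono less_imp_le order_trans)+
  then show "3 * (x * l) \<le> 1" "2 * (x * \<kappa>) \<le> 1" "x * \<kappa> + 31/16 * (x * l) \<le> 1"
    by (simp_all add: distrib_left)
qed

lemma incr_eq_descent: "incr \<xi> = x *\<^sub>R (descent \<xi> + (1/2) *\<^sub>R skew (incr \<xi>))"
  using incr_eq_skew[of \<xi>] by (simp add: mid_eq descent_def linear_simps)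

lemma norm_incr_le_energy: "norm (incr \<xi>) \<le> x * energy_norm (descent \<xi>)"
proof (cases "incr \<xi> = 0")
  case False
  have "skew (incr \<xi>) \<bullet> incr \<xi> = 0"
    using skew_antisym[of "incr \<xi>" "incr \<xi>"] by (simp add: inner_commute)
  then have "norm (incr \<xi>) * norm (incr \<xi>) = x * (descent \<xi> \<bullet> incr \<xi>)"
    using arg_cong[OF incr_eq_descent, of "\<lambda>v. v \<bullet> incr \<xi>"]
    by (simp add: inner_add_left power2_norm_eq_inner flip: power2_eq_square)
  also have "\<dots> \<le> x * (norm (descent \<xi>) * norm (incr \<xi>))"
    using x_pos by (intro mult_left_mono norm_cauchy_schwarz) simp
  finally have "norm (incr \<xi>) \<le> x * norm (descent \<xi>)" using False by simp
  also have "\<dots> \<le> x * energy_norm (descent \<xi>)"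
    using x_pos by (intro mult_left_mono norm_le_energy_norm descent_in) simp
  finally show ?thesis .
qed (use x_pos energy.seminorm_nonneg descent_in in simp)

lemma energy_norm_u_us_G_le: "energy_norm (u (us (G v))) \<le> \<kappa> * norm v"
proof -
  have "energy_norm (u (us (G v))) \<le> sqrt e2 * norm (us (G v))" by (rule energy_norm_u_le)
  also have "\<dots> \<le> sqrt e2 * (sqrt l * norm v)"
    using order_trans[OF norm_us_le mult_left_mono[OF norm_G_le]] l_ge l_le_e2 by (intro mult_left_mono) auto
  finally show ?thesis by (simp add: \<kappa>_def real_sqrt_mult mult_ac)
qed

lemma energy_norm_skew_le: "energy_norm (skew v) \<le> (l + \<kappa>) * norm v"
proof -
  have "green_norm (u (us v)) \<le> norm (u (us v))"
    unfolding green.seminorm_def norm_eq_sqrt_inner using inner_G_le by (rule real_sqrt_le_mono)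
  also have "\<dots> \<le> sqrt l * (sqrt l * norm v)"
    using l_ge by (intro order_trans[OF norm_u_le mult_left_mono[OF norm_us_le]]) simp
  finally have "energy_norm (G (u (us v))) \<le> l * norm v" by (simp only: energy_norm_G sqrt_l_mult)
  moreover have "energy_norm (skew v) \<le> energy_norm (G (u (us v))) + energy_norm (u (us (G v)))"
    unfolding skew_def by (intro energy.seminorm_diff_le in_H)
  ultimately show ?thesis using energy_norm_u_us_G_le[of v] by (simp add: distrib_right)
qed

lemma energy_norm_incr_le: "energy_norm (incr \<xi>) \<le> 17/12 * (x * energy_norm (descent \<xi>))"
proof -
  let ?e = "energy_norm (descent \<xi>)"
  have e_nonneg: "0 \<le> x * ?e" using x_pos energy.seminorm_nonneg[OF descent_in] by simp
  have "energy_norm (skew (incr \<xi>)) \<le> (l + \<kappa>) * (x * ?e)"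
    using l_ge kappa_bounds(1) by (intro order_trans[OF energy_norm_skew_le mult_left_mono[OF norm_incr_le_energy]]) simp
  then have skew_part: "x * energy_norm (skew (incr \<xi>)) \<le> x * ((l + \<kappa>) * (x * ?e))"
    using x_pos by (intro mult_left_mono) simp_all
  have "energy_norm (incr \<xi>) = x * energy_norm (descent \<xi> + (1/2) *\<^sub>R skew (incr \<xi>))"
    using arg_cong[OF incr_eq_descent, of energy_norm] x_pos by (simp add: energy.seminorm_scale in_H)
  also have "\<dots> \<le> x * (?e + energy_norm ((1/2) *\<^sub>R skew (incr \<xi>)))"
    using x_pos by (intro mult_left_mono energy.seminorm_add_le) (simp_all add: in_H)
  also have "\<dots> \<le> (1 + 1/2 * (x * l + x * \<kappa>)) * (x * ?e)"
    using skew_part by (simp add: energy.seminorm_scale in_H algebra_simps)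
  also have "\<dots> \<le> 17/12 * (x * ?e)"
    using x_bounds(2,3) by (intro mult_right_mono e_nonneg) simp
  finally show ?thesis .
qed

lemma energy_descent_incr_le: "a (descent \<xi>) (incr \<xi>) \<le> 17/12 * x * a (descent \<xi>) (descent \<xi>)"
proof -
  let ?e = "energy_norm (descent \<xi>)"
  have "a (descent \<xi>) (incr \<xi>) \<le> ?e * energy_norm (incr \<xi>)"
    using energy.abs_le_seminorm[OF descent_in incr_in, of \<xi> \<xi>] by simp
  also have "\<dots> \<le> ?e * (17/12 * (x * ?e))"
    by (intro mult_left_mono energy_norm_incr_le energy.seminorm_nonneg descent_in)
  also have "\<dots> = 17/12 * x * ?e\<^sup>2" by (simp add: power2_eq_square)
  finally show ?thesis by (simp only: energy.seminorm_power2[OF descent_in])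
qed

lemma energy_skew_incr_le: "a (skew (incr \<xi>)) (incr \<xi>) \<le> 25/24 * x * a (descent \<xi>) (descent \<xi>)"
proof -
  let ?e = "energy_norm (descent \<xi>)" and ?w = "u (us (G (incr \<xi>)))"
  have e_nonneg: "0 \<le> x * ?e" using x_pos energy.seminorm_nonneg[OF descent_in] by simp
  have "a (skew (incr \<xi>)) (incr \<xi>) = (norm (us (incr \<xi>)))\<^sup>2 - a ?w (incr \<xi>)"
    by (simp add: skew_def energy.bilinear_simps in_H a_G u_adj power2_norm_eq_inner)
  also have "\<dots> \<le> (norm (us (incr \<xi>)))\<^sup>2 + energy_norm ?w * energy_norm (incr \<xi>)"
    using energy.abs_le_seminorm[OF u_in incr_in, of "us (G (incr \<xi>))" \<xi>] by simp
  also have "\<dots> \<le> l * (x * ?e)\<^sup>2 + (\<kappa> * (x * ?e)) * (17/12 * (x * ?e))"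
  proof (intro add_mono mult_mono energy_norm_incr_le)
    show "(norm (us (incr \<xi>)))\<^sup>2 \<le> l * (x * ?e)\<^sup>2"
      using l_ge by (intro order_trans[OF norm_us_power2_le] mult_left_mono power_mono norm_incr_le_energy) simp_all
    show "energy_norm ?w \<le> \<kappa> * (x * ?e)"
      using kappa_bounds(1) by (intro order_trans[OF energy_norm_u_us_G_le] mult_left_mono norm_incr_le_energy) simp
  qed (use kappa_bounds(1) e_nonneg energy.seminorm_nonneg in_H in simp_all)
  also have "\<dots> = (x * l + 17/12 * (x * \<kappa>)) * (x * ?e\<^sup>2)" by (simp add: power2_eq_square algebra_simps)
  also have "\<dots> \<le> 25/24 * (x * ?e\<^sup>2)" using x_bounds(2,3) x_pos by (intro mult_right_mono) simp_all
  finally show ?thesis by (simp add: energy.seminorm_power2 descent_in)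
qed

lemma sum_incr_dual_descent_le: "(\<Sum>b\<in>Basis. incr b \<bullet> dual_descent b) \<le> 2 * x * \<kappa> * dissipation"
proof -
  have sum_incr: "(\<Sum>b\<in>Basis. (norm (incr b))\<^sup>2) \<le> x\<^sup>2 * (2 * l * dissipation)"
  proof -
    have "(norm (incr b))\<^sup>2 \<le> x\<^sup>2 * a (descent b) (descent b)" for b
      using power_mono[OF norm_incr_le_energy norm_ge_zero, of b 2]
      by (simp add: power_mult_distrib energy.seminorm_power2 descent_in)
    then have "(\<Sum>b\<in>Basis. (norm (incr b))\<^sup>2) \<le> x\<^sup>2 * total_energy descent"
      unfolding total_energy_def sum_distrib_left by (intro sum_mono)
    also have "\<dots> \<le> x\<^sup>2 * (2 * l * dissipation)" by (intro mult_left_mono total_energy_descent_le_dissipation) simp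
    finally show ?thesis .
  qed
  have "(\<Sum>b\<in>Basis. incr b \<bullet> dual_descent b) \<le> (\<Sum>b\<in>Basis. \<bar>norm (incr b)\<bar> * \<bar>norm (dual_descent b)\<bar>)"
    by (intro sum_mono) (simp add: norm_cauchy_schwarz)
  also have "\<dots> \<le> sqrt (\<Sum>b\<in>Basis. (norm (incr b))\<^sup>2) * sqrt (\<Sum>b\<in>Basis. (norm (dual_descent b))\<^sup>2)"
    by (rule L2_set_mult_ineq[unfolded L2_set_def])
  also have "\<dots> \<le> sqrt (x\<^sup>2 * (2 * l * dissipation)) * sqrt (2 * e2 * dissipation)"
    using dissipation_nonneg l_ge
    by (intro mult_mono real_sqrt_le_mono sum_incr sum_norm_dual_descent_le) (simp_all add: sum_nonneg)
  also have "\<dots> = sqrt ((2 * x * dissipation)\<^sup>2 * (l * e2))"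
    unfolding real_sqrt_mult[symmetric] by (simp add: power2_eq_square mult_ac)
  also have "\<dots> = 2 * x * \<kappa> * dissipation"
    using x_pos dissipation_nonneg by (simp add: real_sqrt_mult \<kappa>_def)
  finally show ?thesis .
qed

lemma energy_u_diff_uh:
  "a (u \<xi>) (u \<xi>) - a (uh \<xi>) (uh \<xi>) = 2 * x * (ritz \<xi> \<bullet> stiffness \<xi> - mass \<xi> \<bullet> mass \<xi>
    - 1/2 * a (descent \<xi>) (incr \<xi>) - 1/2 * (incr \<xi> \<bullet> dual_descent \<xi>) - 1/4 * a (skew (incr \<xi>)) (incr \<xi>))"
proof -
  have mid_in: "mid \<xi> \<in> H" by (simp add: mid_eq in_H)
  have "a (uh \<xi>) (uh \<xi>) - a (u \<xi>) (u \<xi>) = 2 * a (incr \<xi>) (mid \<xi>)"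
    by (simp add: uh_eq mid_eq energy.bilinear_simps in_H a_sym[of "u \<xi>" "incr \<xi>"])
  also have "\<dots> = 2 * x * a (skew (mid \<xi>)) (mid \<xi>)" by (simp add: incr_eq_skew energy.scale_left in_H mid_in)
  also have "a (skew (mid \<xi>)) (mid \<xi>) = a (descent \<xi>) (u \<xi>) + 1/2 * a (descent \<xi>) (incr \<xi>)
      + 1/2 * a (skew (incr \<xi>)) (u \<xi>) + 1/4 * a (skew (incr \<xi>)) (incr \<xi>)"
    by (simp add: mid_eq linear_simps energy.bilinear_simps in_H flip: descent_def)
  also have "a (descent \<xi>) (u \<xi>) = - (ritz \<xi> \<bullet> stiffness \<xi> - mass \<xi> \<bullet> mass \<xi>)"
  proof -
    have "descent \<xi> = G (u (mass \<xi>)) - u (ritz \<xi>)" by (simp add: descent_def skew_def mass_def ritz_def)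
    then show ?thesis by (simp add: energy.bilinear_simps in_H a_G inner_stiffness inner_mass)
  qed
  also have "a (skew (incr \<xi>)) (u \<xi>) = incr \<xi> \<bullet> dual_descent \<xi>"
  proof -
    have "a (u (us (G (incr \<xi>)))) (u \<xi>) = u (stiffness \<xi>) \<bullet> G (incr \<xi>)"
      by (simp add: inner_stiffness[symmetric] inner_commute[of "us _"] u_adj)
    moreover have "u (us (incr \<xi>)) \<bullet> u \<xi> = u (mass \<xi>) \<bullet> incr \<xi>"
      by (metis inner_commute mass_def u_adj)
    ultimately show ?thesis
      by (simp add: skew_def dual_descent_def energy.bilinear_simps in_H a_G inner_diff_right
          inner_commute[of "incr \<xi>"] G_sym)
  qed
  finally show ?thesis by (simp add: algebra_simps)
qed

lemma stage_one_energy_drop: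
  "2 * x * ((1 - x * \<kappa>) * dissipation - 31/32 * (x * total_energy descent)) \<le> total_energy u - total_energy uh"
proof -
  have descent_part: "(\<Sum>b\<in>Basis. a (descent b) (incr b)) \<le> 17/12 * x * total_energy descent"
    unfolding total_energy_def sum_distrib_left by (intro sum_mono energy_descent_incr_le)
  have skew_part: "(\<Sum>b\<in>Basis. a (skew (incr b)) (incr b)) \<le> 25/24 * x * total_energy descent"
    unfolding total_energy_def sum_distrib_left by (intro sum_mono energy_skew_incr_le)
  have "(1 - x * \<kappa>) * dissipation - 31/32 * (x * total_energy descent)
      \<le> dissipation - 1/2 * (\<Sum>b\<in>Basis. a (descent b) (incr b))
        - 1/2 * (\<Sum>b\<in>Basis. incr b \<bullet> dual_descent b) - 1/4 * (\<Sum>b\<in>Basis. a (skew (incr b)) (incr b))"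
    using descent_part skew_part sum_incr_dual_descent_le by (simp add: left_diff_distrib)
  moreover have "total_energy u - total_energy uh = 2 * x * (dissipation - 1/2 * (\<Sum>b\<in>Basis. a (descent b) (incr b))
        - 1/2 * (\<Sum>b\<in>Basis. incr b \<bullet> dual_descent b) - 1/4 * (\<Sum>b\<in>Basis. a (skew (incr b)) (incr b)))"
    unfolding total_energy_def dissipation_def sum_subtractf[symmetric] energy_u_diff_uh sum_distrib_left ..
  ultimately show ?thesis using x_pos by simp
qed

lemma total_energy_uh_le: "total_energy uh \<le> e2"
proof -
  have "x * total_energy descent \<le> x * (2 * l * dissipation)"
    using x_pos by (intro mult_left_mono total_energy_descent_le_dissipation) simp
  moreover have "0 \<le> (1 - (x * \<kappa> + 31/16 * (x * l))) * dissipation"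
    using x_bounds(4) by (intro mult_nonneg_nonneg dissipation_nonneg) simp
  ultimately have "0 \<le> (1 - x * \<kappa>) * dissipation - 31/32 * (x * total_energy descent)"
    by (simp add: algebra_simps)
  then have "0 \<le> 2 * x * ((1 - x * \<kappa>) * dissipation - 31/32 * (x * total_energy descent))"
    using x_pos by (intro mult_nonneg_nonneg) simp_all
  then show ?thesis using stage_one_energy_drop total_energy_u_le by linarith
qed

definition defect_trace :: real where "defect_trace = (\<Sum>b\<in>Basis. b \<bullet> defect b)"
definition defect_square_trace :: real where "defect_square_trace = (\<Sum>b\<in>Basis. (norm (defect b))\<^sup>2)"

lemma stage_two_energy_drop:
  "2 * x * (defect_trace + (1 - x * l / 2) * defect_square_trace) \<le> total_energy uh - total_energy upd"
proof -
  have "2 * x * (b \<bullet> defect b + (1 - x * l / 2) * (norm (defect b))\<^sup>2) \<le> a (uh b) (uh b) - a (upd b) (upd b)" for b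
  proof -
    have "a (uh b) (uh b) - a (upd b) (upd b)
        = 2 * x * (uh (defect b) \<bullet> uh b) - x\<^sup>2 * (defect b \<bullet> ritz_hat (defect b))"
      by (simp add: upd_def energy.bilinear_simps in_H a_G a_G_right inner_ritz_hat inner_commute[of "uh b"]
          power2_eq_square algebra_simps) (metis inner_commute)
    also have "uh (defect b) \<bullet> uh b = b \<bullet> defect b + (norm (defect b))\<^sup>2"
      by (simp only: uh_inner_uh u_adj us_u inner_add_right power2_norm_eq_inner inner_commute[of "defect b" b])
    finally have "a (uh b) (uh b) - a (upd b) (upd b) = 2 * x * (b \<bullet> defect b + (norm (defect b))\<^sup>2)
        - x\<^sup>2 * (defect b \<bullet> ritz_hat (defect b))" .
    moreover have "x\<^sup>2 * (defect b \<bullet> ritz_hat (defect b)) \<le> x\<^sup>2 * (l * (norm (defect b))\<^sup>2)"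
      using ritz_hat_le[of "defect b"] by (intro mult_left_mono) (simp_all add: power2_norm_eq_inner)
    ultimately show ?thesis by (simp add: power2_eq_square algebra_simps)
  qed
  then have "(\<Sum>b\<in>Basis. 2 * x * (b \<bullet> defect b + (1 - x * l / 2) * (norm (defect b))\<^sup>2))
      \<le> (\<Sum>b\<in>Basis. a (uh b) (uh b) - a (upd b) (upd b))"
    by (intro sum_mono)
  then show ?thesis
    by (simp only: defect_trace_def defect_square_trace_def total_energy_def sum_subtractf sum.distrib sum_distrib_left[symmetric])
qed

definition slack :: "'v \<Rightarrow> real" where
  "slack v = l * (norm v)\<^sup>2 - (norm (us v))\<^sup>2"

lemma slack_nonneg: "0 \<le> slack v"
  using norm_us_power2_le by (simp add: slack_def)

lemma dissipation_ge:
  "total_energy descent / (2 * l) + (\<Sum>b\<in>Basis. slack (descent b)) / (2 * l\<^sup>2) \<le> dissipation"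
  "(\<Sum>b\<in>Basis. slack (descent b)) / (2 * l\<^sup>2) \<le> total_energy descent / (2 * l)"
proof -
  define T where "T = total_energy descent"
  define N where "N = (\<Sum>b\<in>Basis. (norm (descent b))\<^sup>2)"
  define M where "M = (\<Sum>b\<in>Basis. (norm (us (descent b)))\<^sup>2)"
  have slack: "(\<Sum>b\<in>Basis. slack (descent b)) = l * N - M"
    by (simp add: slack_def N_def M_def sum_subtractf sum_distrib_left)
  have N_le: "l * N \<le> l * T" using sum_norm_us_descent_le(2) l_ge by (intro mult_left_mono) (auto simp: N_def T_def)
  have "M \<ge> 0" by (simp add: M_def sum_nonneg)
  then have "(l * N - M) / (2 * l\<^sup>2) \<le> (l * T) / (2 * l\<^sup>2)" using N_le by (intro divide_right_mono) simp_all
  then show "(\<Sum>b\<in>Basis. slack (descent b)) / (2 * l\<^sup>2) \<le> total_energy descent / (2 * l)"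
    unfolding slack T_def[symmetric] using l_ge by (simp add: power2_eq_square)
  have "2 * T \<le> 2 * l * dissipation + M / l" using total_energy_descent_le by (simp add: T_def M_def)
  then have "2 * (l * T) \<le> l * (2 * l * dissipation + M / l)"
    using mult_left_mono[of "2 * T" _ l] l_ge by simp
  also have "\<dots> = dissipation * (2 * l\<^sup>2) + M" using l_ge by (simp add: power2_eq_square algebra_simps)
  finally have "l * T + (l * N - M) \<le> dissipation * (2 * l\<^sup>2)" using N_le by linarith
  then have "(l * T + (l * N - M)) / (2 * l\<^sup>2) \<le> dissipation" using l_ge by (simp add: pos_divide_le_eq)
  moreover have "(l * T + (l * N - M)) / (2 * l\<^sup>2) = T / (2 * l) + (l * N - M) / (2 * l\<^sup>2)"
    using l_ge by (simp add: field_simps power2_eq_square)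
  ultimately show "T / (2 * l) + (\<Sum>b\<in>Basis. slack (descent b)) / (2 * l\<^sup>2) \<le> dissipation"
    unfolding slack by simp
qed

lemma energy_drop:
  assumes trace: "- \<sigma> \<le> defect_trace + (1 - x * l / 2) * defect_square_trace"
    and \<sigma>_le: "\<sigma> \<le> (\<Sum>b\<in>Basis. slack (descent b)) / (2 * l\<^sup>2)"
    and c_ge: "\<kappa> * (total_energy descent / (2 * l) + \<sigma>) + 31/32 * total_energy descent \<le> c * total_energy descent"
  shows "2 * x * ((1 / (2 * l) - c * x) * total_energy descent) \<le> total_energy u - total_energy upd"
proof -
  define T where "T = total_energy descent"
  have "(1 - x * \<kappa>) * (T / (2 * l) + \<sigma>) \<le> (1 - x * \<kappa>) * dissipation"
    using \<sigma>_le dissipation_ge(1) x_bounds(3) by (intro mult_left_mono) (simp_all add: T_def)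
  moreover have "x * (\<kappa> * (T / (2 * l) + \<sigma>) + 31/32 * T - c * T) \<le> 0"
    using c_ge x_pos by (intro mult_nonneg_nonpos) (simp_all add: T_def)
  moreover have "(1 / (2 * l) - c * x) * T = (1 - x * \<kappa>) * (T / (2 * l) + \<sigma>)
      + x * (\<kappa> * (T / (2 * l) + \<sigma>) + 31/32 * T - c * T) - 31/32 * (x * T) - \<sigma>"
    by (simp add: algebra_simps diff_divide_distrib)
  ultimately have "(1 / (2 * l) - c * x) * T \<le> ((1 - x * \<kappa>) * dissipation - 31/32 * (x * T))
      + (defect_trace + (1 - x * l / 2) * defect_square_trace)"
    using trace by simp
  then have "2 * x * ((1 / (2 * l) - c * x) * T) \<le> 2 * x * (((1 - x * \<kappa>) * dissipation - 31/32 * (x * T))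
      + (defect_trace + (1 - x * l / 2) * defect_square_trace))"
    using x_pos by (intro mult_left_mono) simp_all
  then show ?thesis
    using stage_one_energy_drop stage_two_energy_drop unfolding T_def distrib_left by linarith
qed

end

section \<open>One step of the scheme\<close>

lemma linear_dim_1_scale:
  fixes f :: "'a::euclidean_space \<Rightarrow> 'a"
  assumes dim: "DIM('a) = 1" and lin: "linear f"
  obtains c where "\<And>v. f v = c *\<^sub>R v"
proof -
  obtain b :: 'a where b: "Basis = {b}" using dim by (metis card_1_singletonE)
  have expand: "v = (v \<bullet> b) *\<^sub>R b" for v using euclidean_representation[of v] by (simp add: b)
  have "f v = (f b \<bullet> b) *\<^sub>R v" for v
    using linear_scale[OF lin, of "v \<bullet> b" b] expand[of v] expand[of "f b"]
    by (metis mult.commute scaleR_scaleR)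
  then show thesis by (rule that)
qed

locale scheme_step = energy_step G u uh us uhs x l H a e2
  for G :: "'v::real_inner \<Rightarrow> 'v" and u uh :: "'e::euclidean_space \<Rightarrow> 'v" and us uhs x l H a e2 +
  assumes defect_inequality: "0 \<le> \<mu> \<Longrightarrow> \<mu> \<le> 1 \<Longrightarrow>
      (norm (defect \<xi>))\<^sup>2 \<le> d * (\<xi> \<bullet> defect \<xi> + defect_weight l * (norm (shifted \<mu> (u \<xi>)))\<^sup>2)"
    and norm_u_ge_of_dim_1: "DIM('e) = 1 \<Longrightarrow> (norm \<xi>)\<^sup>2 \<le> (norm (u \<xi>))\<^sup>2"
begin

lemma penalized_defect_nonneg:
  assumes "0 \<le> \<mu>"
  shows "0 \<le> \<xi> \<bullet> defect \<xi> + defect_weight l * (norm (shifted \<mu> (u \<xi>)))\<^sup>2"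
proof (cases "d = 0")
  case True
  then have "defect \<xi> = 0" using defect_inequality[of 0 \<xi>] by simp
  then show ?thesis using defect_weight_bounds(1)[OF l_ge] by simp
next
  case False
  then have nonneg: "0 \<le> \<xi> \<bullet> defect \<xi> + defect_weight l * (norm (shifted t (u \<xi>)))\<^sup>2" if "0 \<le> t" "t \<le> 1" for t
    using order_trans[OF zero_le_power2 defect_inequality[OF that, of \<xi>]] d_nonneg by (simp add: zero_le_mult_iff)
  show ?thesis
  proof (cases "\<mu> \<le> 1")
    case False
    then have "(norm (shifted 1 (u \<xi>)))\<^sup>2 \<le> (norm (shifted \<mu> (u \<xi>)))\<^sup>2"
      by (intro power_mono norm_shifted_one_le) simp_all
    then have "defect_weight l * (norm (shifted 1 (u \<xi>)))\<^sup>2 \<le> defect_weight l * (norm (shifted \<mu> (u \<xi>)))\<^sup>2"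
      by (intro mult_left_mono defect_weight_bounds(1) l_ge)
    then show ?thesis using nonneg[of 1] by linarith
  qed (use nonneg assms in blast)
qed

lemma penalty_le:
  "defect_weight l * (norm (shifted (1/2) (u \<xi>)))\<^sup>2 \<le> 1/10 * (\<xi> \<bullet> \<xi>)"
  "defect_weight l * (norm (shifted (1/2) (u \<xi>)))\<^sup>2 \<le> 2 * d * (\<xi> \<bullet> \<xi>)"
proof -
  have "norm (shifted (1/2) (u \<xi>)) \<le> 1/2 * norm (u \<xi>)" by (rule norm_shifted_le) simp_all
  then have "(norm (shifted (1/2) (u \<xi>)))\<^sup>2 \<le> (1/2 * norm (u \<xi>))\<^sup>2" by (rule power_mono) simp
  also have "\<dots> = 1/4 * (norm (u \<xi>))\<^sup>2" by (simp add: power_divide)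
  also have "\<dots> \<le> 1/4 * (l * (\<xi> \<bullet> \<xi>))" using u_le[of \<xi>] by (simp add: power2_norm_eq_inner)
  finally have "defect_weight l * (norm (shifted (1/2) (u \<xi>)))\<^sup>2 \<le> defect_weight l * (1/4 * (l * (\<xi> \<bullet> \<xi>)))"
    by (intro mult_left_mono defect_weight_bounds(1) l_ge)
  also have "\<dots> = (defect_weight l * l) / 4 * (\<xi> \<bullet> \<xi>)" by simp
  finally have bound: "defect_weight l * (norm (shifted (1/2) (u \<xi>)))\<^sup>2 \<le> (defect_weight l * l) / 4 * (\<xi> \<bullet> \<xi>)" .
  show "defect_weight l * (norm (shifted (1/2) (u \<xi>)))\<^sup>2 \<le> 1/10 * (\<xi> \<bullet> \<xi>)"
    using defect_weight_bounds(2)[OF l_ge] by (intro order_trans[OF bound] mult_right_mono) (simp_all add: mult_ac)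
  show "defect_weight l * (norm (shifted (1/2) (u \<xi>)))\<^sup>2 \<le> 2 * d * (\<xi> \<bullet> \<xi>)"
    using defect_weight_bounds(3)[OF l_ge] by (intro order_trans[OF bound] mult_right_mono) (simp_all add: d_def)
qed

lemma defect_ge: "- (1/10 * (\<xi> \<bullet> \<xi>)) \<le> \<xi> \<bullet> defect \<xi>"
  using penalized_defect_nonneg[of "1/2" \<xi>] penalty_le(1)[of \<xi>] by simp

lemma defect_ge_neg_d: "- (d * (\<xi> \<bullet> \<xi>)) \<le> \<xi> \<bullet> defect \<xi>"
proof (cases "d = 0")
  case True
  then show ?thesis using defect_inequality[of 0 \<xi>] by simp
next
  case False
  have "d * (\<xi> \<bullet> defect \<xi> + defect_weight l * (norm (shifted (1/2) (u \<xi>)))\<^sup>2) \<le> d * (\<xi> \<bullet> defect \<xi> + 2 * d * (\<xi> \<bullet> \<xi>))"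
    by (intro mult_left_mono add_left_mono penalty_le d_nonneg)
  then have "(norm (defect \<xi>))\<^sup>2 \<le> d * (\<xi> \<bullet> defect \<xi> + 2 * d * (\<xi> \<bullet> \<xi>))"
    using defect_inequality[of "1/2" \<xi>] by linarith
  moreover have "(norm (defect \<xi> + d *\<^sub>R \<xi>))\<^sup>2 = (norm (defect \<xi>))\<^sup>2 + 2 * d * (\<xi> \<bullet> defect \<xi>) + d * (d * (\<xi> \<bullet> \<xi>))"
    unfolding power2_norm_eq_inner by (simp add: inner_add_left inner_add_right inner_commute[of "defect \<xi>" \<xi>] algebra_simps)
  ultimately have "0 \<le> 3 * d * (\<xi> \<bullet> defect \<xi> + d * (\<xi> \<bullet> \<xi>))"
    using zero_le_power2[of "norm (defect \<xi> + d *\<^sub>R \<xi>)"] by (simp add: algebra_simps)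
  then show ?thesis using False d_nonneg by (simp add: zero_le_mult_iff)
qed

lemma norm_defect_le: "norm (defect \<xi>) \<le> d * norm \<xi>"
proof (rule norm_symmetric_operator_le[OF operators_linear(6) defect_sym d_nonneg])
  show "\<bar>\<zeta> \<bullet> defect \<zeta>\<bar> \<le> d * (\<zeta> \<bullet> \<zeta>)" for \<zeta>
    using defect_ge_neg_d[of \<zeta>] defect_le[of \<zeta>] by linarith
qed

definition gap :: "'e \<Rightarrow> 'e" where
  "gap \<xi> = d *\<^sub>R \<xi> - defect \<xi>"

lemma inner_gap: "\<xi> \<bullet> gap \<xi> = l * (norm \<xi>)\<^sup>2 - (norm (u \<xi>))\<^sup>2"
  by (simp add: gap_def inner_diff_right inner_defect d_def left_diff_distrib power2_norm_eq_inner)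

lemma gap_nonneg: "0 \<le> \<xi> \<bullet> gap \<xi>"
  using u_le by (simp add: inner_gap)

lemma ritz_hat_gap_le: "gap \<xi> \<bullet> ritz_hat (gap \<xi>) \<le> 2 * l * d * (\<xi> \<bullet> gap \<xi>)"
proof -
  have "(norm (gap \<xi>))\<^sup>2 \<le> 2 * d * (\<xi> \<bullet> gap \<xi>)"
  proof (rule norm_psd_operator_power2_le[OF _ _ gap_nonneg])
    show "linear gap" unfolding gap_def by (intro linear_compose_sub linear_scale_self operators_linear)
    show "gap v \<bullet> w = v \<bullet> gap w" for v w
      by (simp add: gap_def inner_diff_left inner_diff_right defect_sym)
    show "v \<bullet> gap v \<le> 2 * d * (v \<bullet> v)" for v
      using defect_ge_neg_d[of v] by (simp add: gap_def inner_diff_right)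
  qed (use d_nonneg in simp)
  then have "l * (norm (gap \<xi>))\<^sup>2 \<le> l * (2 * d * (\<xi> \<bullet> gap \<xi>))" using l_ge by (intro mult_left_mono) simp_all
  then show ?thesis using ritz_hat_le[of "gap \<xi>"] by (simp add: power2_norm_eq_inner mult_ac)
qed

lemma inner_ritz_hat_gap_le: "2 * (\<xi> \<bullet> ritz_hat (gap \<xi>)) \<le> d * (\<xi> \<bullet> ritz_hat \<xi>) + 2 * l * (\<xi> \<bullet> gap \<xi>)"
proof (rule power2_le_imp_le)
  let ?A = "d * (\<xi> \<bullet> ritz_hat \<xi>)" and ?B = "2 * l * (\<xi> \<bullet> gap \<xi>)"
  have four_mult_le: "4 * (p * q) \<le> (p + q)\<^sup>2" for p q :: real
    using zero_le_power2[of "p - q"] by (simp add: power2_sum power2_diff)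
  have "(\<xi> \<bullet> ritz_hat (gap \<xi>))\<^sup>2 \<le> (\<xi> \<bullet> ritz_hat \<xi>) * (gap \<xi> \<bullet> ritz_hat (gap \<xi>))"
    by (rule ritz_hat.cauchy_schwarz) simp_all
  also have "\<dots> \<le> (\<xi> \<bullet> ritz_hat \<xi>) * (2 * l * d * (\<xi> \<bullet> gap \<xi>))"
    by (intro mult_left_mono ritz_hat_gap_le ritz_hat.nonneg) simp
  finally have "(2 * (\<xi> \<bullet> ritz_hat (gap \<xi>)))\<^sup>2 \<le> 4 * (?A * ?B)" by (simp add: power_mult_distrib mult_ac)
  also have "\<dots> \<le> (?A + ?B)\<^sup>2" by (rule four_mult_le)
  finally show "(2 * (\<xi> \<bullet> ritz_hat (gap \<xi>)))\<^sup>2 \<le> (?A + ?B)\<^sup>2" .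
  show "0 \<le> ?A + ?B" using d_nonneg l_ge gap_nonneg[of \<xi>] ritz_hat.nonneg[of \<xi>] by simp
qed

lemma norm_G_uh_defect_le:
  "(norm (G (uh (defect \<xi>))))\<^sup>2 \<le> 2 * d\<^sup>2 * (\<xi> \<bullet> ritz_hat \<xi>) + 4 * l * d * (\<xi> \<bullet> gap \<xi>)"
proof -
  have parallelogram: "(v - w) \<bullet> ritz_hat (v - w) \<le> 2 * (v \<bullet> ritz_hat v) + 2 * (w \<bullet> ritz_hat w)" for v w
    using ritz_hat.nonneg[of "v + w"]
    by (simp add: ritz_hat.add_left ritz_hat.add_right ritz_hat.diff_left ritz_hat.diff_right)
  have "defect \<xi> = d *\<^sub>R \<xi> - gap \<xi>" by (simp add: gap_def)
  then have "defect \<xi> \<bullet> ritz_hat (defect \<xi>)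
      \<le> 2 * (d *\<^sub>R \<xi> \<bullet> ritz_hat (d *\<^sub>R \<xi>)) + 2 * (gap \<xi> \<bullet> ritz_hat (gap \<xi>))"
    using parallelogram[of "d *\<^sub>R \<xi>" "gap \<xi>"] by (simp only:)
  also have "d *\<^sub>R \<xi> \<bullet> ritz_hat (d *\<^sub>R \<xi>) = d\<^sup>2 * (\<xi> \<bullet> ritz_hat \<xi>)"
    by (simp add: linear_simps power2_eq_square mult.assoc)
  finally show ?thesis using norm_G_uh_le[of "defect \<xi>"] ritz_hat_gap_le[of \<xi>] by linarith
qed

lemma x_d_bounds: "0 \<le> x * d" "4 * (x * d) \<le> 1"
proof -
  have "4 * d \<le> 1 * l\<^sup>2" using four_d_le by simp
  also have "1 * l\<^sup>2 \<le> 2 * e2 * l\<^sup>2" using l_ge l_le_e2 by (intro mult_right_mono) simp_all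
  also have "\<dots> \<le> 2 * e2 * l\<^sup>2 + l" using l_ge by simp
  finally have "x * (4 * d) \<le> 1" using x_pos x_bounds(1) by (meson mult_left_mono less_imp_le order_trans)
  then show "4 * (x * d) \<le> 1" by simp
qed (use x_pos d_nonneg in simp)

theorem norm_upd_power2_le: "(norm (upd \<xi>))\<^sup>2 \<le> l * (norm \<xi>)\<^sup>2"
proof -
  let ?k = "\<xi> \<bullet> ritz_hat \<xi>" and ?c = "\<xi> \<bullet> gap \<xi>"
  have "2 * x * (ritz_hat \<xi> \<bullet> defect \<xi>) = 2 * x * (d * ?k) - x * (2 * (\<xi> \<bullet> ritz_hat (gap \<xi>)))"
    by (simp add: gap_def linear_simps ritz_hat_sym inner_diff_right algebra_simps)
  then have "l * (norm \<xi>)\<^sup>2 - (norm (upd \<xi>))\<^sup>2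
      = ?c + 2 * x * (d * ?k) - x * (2 * (\<xi> \<bullet> ritz_hat (gap \<xi>))) - x\<^sup>2 * (norm (G (uh (defect \<xi>))))\<^sup>2"
    unfolding norm_upd inner_gap by linarith
  also have "\<dots> \<ge> ?c + 2 * x * (d * ?k) - x * (d * ?k + 2 * l * ?c) - x\<^sup>2 * (2 * d\<^sup>2 * ?k + 4 * l * d * ?c)"
    using x_pos by (intro diff_mono diff_left_mono mult_left_mono inner_ritz_hat_gap_le norm_G_uh_defect_le) simp_all
  finally have "?c * (1 - 2 * (x * l) - (x * l) * (4 * (x * d))) + ?k * ((x * d) * (1 - 2 * (x * d)))
      \<le> l * (norm \<xi>)\<^sup>2 - (norm (upd \<xi>))\<^sup>2"
    by (simp add: power2_eq_square algebra_simps)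
  moreover have "0 \<le> ?c * (1 - 2 * (x * l) - (x * l) * (4 * (x * d)))"
  proof (intro mult_nonneg_nonneg gap_nonneg)
    have "(x * l) * (4 * (x * d)) \<le> (x * l) * 1" using x_d_bounds x_pos l_ge by (intro mult_left_mono) simp_all
    then show "0 \<le> 1 - 2 * (x * l) - (x * l) * (4 * (x * d))" using x_bounds(2) by linarith
  qed
  moreover have "0 \<le> ?k * ((x * d) * (1 - 2 * (x * d)))"
    using x_pos d_nonneg x_d_bounds by (intro mult_nonneg_nonneg ritz_hat.nonneg) simp_all
  ultimately show ?thesis by linarith
qed

lemma x_l_le_of_dim_2:
  assumes "2 \<le> DIM('e)"
  shows "5 * (x * l) \<le> 1"
proof -
  have "2 * l \<le> e2 * l\<^sup>2"
    using mult_mono[of 2 e2 l "l\<^sup>2"] e2_ge l_ge assms by (simp add: power2_eq_square)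
  then have "5 * l \<le> 2 * e2 * l\<^sup>2 + l" by simp
  then have "x * (5 * l) \<le> 1" using x_pos x_bounds(1) by (meson mult_left_mono less_imp_le order_trans)
  then show ?thesis by simp
qed

lemma slack_diff_le: "slack (v - w) \<le> 5/4 * slack v + 5 * slack w"
proof -
  have "0 \<le> slack ((1/2) *\<^sub>R v + 2 *\<^sub>R w)" by (rule slack_nonneg)
  also have "\<dots> = 5/4 * slack v + 5 * slack w - slack (v - w)"
    unfolding slack_def power2_norm_eq_inner
    by (simp add: linear_simps inner_add_left inner_add_right inner_diff_left inner_diff_right inner_commute[of w v]
        inner_commute[of "us w" "us v"] algebra_simps)
  finally show ?thesis by linarith
qed

lemma slack_G_u_le: "slack (G (u \<eta>)) \<le> l\<^sup>2 / 4 * (norm \<eta>)\<^sup>2"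
proof -
  have "(norm (G (u \<eta>)))\<^sup>2 \<le> \<eta> \<bullet> ritz \<eta>"
    using G_contraction by (simp add: inner_ritz power2_norm_eq_inner)
  then have "l * (norm (G (u \<eta>)))\<^sup>2 \<le> l * (\<eta> \<bullet> ritz \<eta>)" using l_ge by (intro mult_left_mono) simp_all
  moreover have "(norm (ritz \<eta> - (l / 2) *\<^sub>R \<eta>))\<^sup>2 = (norm (ritz \<eta>))\<^sup>2 - l * (\<eta> \<bullet> ritz \<eta>) + l\<^sup>2 / 4 * (norm \<eta>)\<^sup>2"
    unfolding power2_norm_eq_inner
    by (simp add: inner_diff_left inner_diff_right inner_commute[of "ritz \<eta>" \<eta>] power2_eq_square field_simps)
  ultimately show ?thesis
    using zero_le_power2[of "norm (ritz \<eta> - (l / 2) *\<^sub>R \<eta>)"] unfolding slack_def ritz_def[symmetric] by linarith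
qed

lemma shifted_eigenvector_le:
  assumes eigen: "ritz b = k *\<^sub>R b" and k: "0 \<le> k" "k \<le> l"
  shows "defect_weight l * (norm (shifted k (u b)))\<^sup>2 \<le> slack (descent b) / (2 * l\<^sup>2) + 9/10 * (norm (defect b))\<^sup>2"
proof -
  let ?z = "shifted k (u b)" and ?n = "(norm (defect b))\<^sup>2"
  have z_eq: "?z = G (u b) - u (ritz b)" by (simp add: shifted_def eigen linear_simps)
  then have z_descent: "?z = descent b - G (u (defect b))"
    by (simp add: descent_def skew_def us_u linear_simps ritz_def)
  have "us ?z = - (k *\<^sub>R defect b)"
    using eigen unfolding z_eq linear_simps ritz_def[symmetric] by (simp add: us_u linear_simps scaleR_add_right)
  then have "(norm (us ?z))\<^sup>2 \<le> l\<^sup>2 * ?n"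
    using k by (simp add: power_mult_distrib mult_right_mono)
  then have "l * (norm ?z)\<^sup>2 \<le> 5/4 * slack (descent b) + 9/4 * (l\<^sup>2 * ?n)"
    using slack_diff_le[of "descent b" "G (u (defect b))"] slack_G_u_le[of "defect b"]
    unfolding z_descent[symmetric] by (simp add: slack_def)
  then have bound: "(defect_weight l * l) * (l * (norm ?z)\<^sup>2) \<le> 2/5 * (5/4 * slack (descent b) + 9/4 * (l\<^sup>2 * ?n))"
    using defect_weight_bounds(1,2)[OF l_ge] l_ge by (intro mult_mono) simp_all
  have "(defect_weight l * (norm ?z)\<^sup>2) * l\<^sup>2 = (defect_weight l * l) * (l * (norm ?z)\<^sup>2)"
    by (simp only: power2_eq_square mult_ac)
  also note bound
  also have "2/5 * (5/4 * slack (descent b) + 9/4 * (l\<^sup>2 * ?n)) = (slack (descent b) / (2 * l\<^sup>2) + 9/10 * ?n) * l\<^sup>2"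
    using l_ge by (simp add: distrib_right)
  finally show ?thesis by (rule mult_right_le_imp_le) (use l_ge in simp)
qed

lemma defect_trace_ge:
  assumes "2 \<le> DIM('e)"
  shows "- ((\<Sum>b\<in>Basis. slack (descent b)) / (2 * l\<^sup>2)) \<le> defect_trace + (1 - x * l / 2) * defect_square_trace"
proof -
  obtain E k where basis: "orthonormal E" "span E = UNIV" and eigen: "\<And>b. b \<in> E \<Longrightarrow> ritz b = k b *\<^sub>R b"
    using spectral_theorem[OF operators_linear(7) ritz_sym] by metis
  define \<beta> where "\<beta> v w = v \<bullet> defect w + (l * (descent v \<bullet> descent w) - us (descent v) \<bullet> us (descent w)) / (2 * l\<^sup>2)
    + 9/10 * (defect v \<bullet> defect w)" for v w
  have diagonal: "\<beta> b b = b \<bullet> defect b + slack (descent b) / (2 * l\<^sup>2) + 9/10 * (norm (defect b))\<^sup>2" for b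
    by (simp add: \<beta>_def slack_def power2_norm_eq_inner)
  have "bilinear \<beta>"
    by (auto simp: \<beta>_def bilinear_def descent_def linear_simps inner_add_left inner_add_right algebra_simps
        add_divide_distrib diff_divide_distrib intro!: linearI)
  have "0 \<le> \<beta> b b" if b: "b \<in> E" for b
  proof -
    have "k b = b \<bullet> ritz b" using eigen[OF b] orthonormal_inner[OF basis(1) b b] by simp
    then have k: "0 \<le> k b" "k b \<le> l"
      using ritz_le[of b] orthonormal_inner[OF basis(1) b b] by (simp_all add: inner_ritz G_nonneg)
    then show ?thesis
      using penalized_defect_nonneg[OF k(1), of b] shifted_eigenvector_le[OF eigen[OF b] k] unfolding diagonal by linarith
  qed
  then have "0 \<le> (\<Sum>b\<in>Basis. \<beta> b b)"
    unfolding sum_Basis_bilinear[OF basis \<open>bilinear \<beta>\<close>] by (intro sum_nonneg)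
  also have "\<dots> = defect_trace + (\<Sum>b\<in>Basis. slack (descent b)) / (2 * l\<^sup>2) + 9/10 * defect_square_trace"
    unfolding diagonal defect_trace_def defect_square_trace_def
    by (simp only: sum.distrib sum_distrib_left sum_divide_distrib)
  finally have "- ((\<Sum>b\<in>Basis. slack (descent b)) / (2 * l\<^sup>2)) \<le> defect_trace + 9/10 * defect_square_trace" by linarith
  moreover have "9/10 * defect_square_trace \<le> (1 - x * l / 2) * defect_square_trace"
  proof (rule mult_right_mono)
    show "9/10 \<le> 1 - x * l / 2" using x_l_le_of_dim_2[OF assms] by linarith
  qed (simp add: defect_square_trace_def sum_nonneg)
  ultimately show ?thesis by linarith
qed

lemma total_energy_descent_nonneg: "0 \<le> total_energy descent"
  by (intro total_energy_nonneg descent_in)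

lemma two_kappa_le: "2 * \<kappa> \<le> \<kappa>\<^sup>2 + 1"
  using zero_le_power2[of "\<kappa> - 1"] by (simp add: power2_diff)

lemma energy_decay_of_dim_1:
  assumes dim: "DIM('e) = 1" and c: "\<kappa>\<^sup>2 + 1/2 \<le> c"
  shows "2 * x * ((1 / (2 * l) - c * x) * total_energy descent) \<le> total_energy u - total_energy upd"
proof -
  define T where "T = total_energy descent"
  have "1 \<le> \<kappa>" using kappa_bounds(2) l_ge by linarith
  then have "1 * \<kappa> \<le> \<kappa>\<^sup>2" unfolding power2_eq_square by (intro mult_right_mono) simp_all
  moreover have "\<kappa> / (2 * l) \<le> \<kappa> / 2" using l_ge kappa_bounds(1) by (intro divide_left_mono) simp_all
  ultimately have "\<kappa> / (2 * l) + 31/32 \<le> c" using c \<open>1 \<le> \<kappa>\<close> by linarith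
  then have "(\<kappa> / (2 * l) + 31/32) * T \<le> c * T"
    unfolding T_def by (rule mult_right_mono[OF _ total_energy_descent_nonneg])
  moreover have "0 \<le> b \<bullet> defect b" for b using norm_u_ge_of_dim_1[OF dim] unfolding inner_defect by simp
  then have "0 \<le> defect_trace + (1 - x * l / 2) * defect_square_trace"
    using x_bounds(2) by (simp add: defect_trace_def defect_square_trace_def sum_nonneg)
  ultimately show ?thesis
    using slack_nonneg by (intro energy_drop[of 0]) (simp_all add: T_def sum_nonneg distrib_right)
qed

lemma energy_decay_of_dim_2:
  assumes dim: "2 \<le> DIM('e)" and c: "sqrt (real DIM('e)) * \<kappa>\<^sup>2 + 1/2 \<le> c"
  shows "2 * x * ((1 / (2 * l) - c * x) * total_energy descent) \<le> total_energy u - total_energy upd"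
proof -
  define T where "T = total_energy descent"
  have "2 * 1 \<le> e2 * l" using e2_ge l_ge dim by (intro mult_mono) simp_all
  then have "2 \<le> \<kappa>\<^sup>2" by (simp add: kappa_bounds(4) mult.commute)
  moreover have "141/100 * \<kappa>\<^sup>2 \<le> sqrt (real DIM('e)) * \<kappa>\<^sup>2"
    using dim by (intro mult_right_mono real_le_rsqrt) (simp_all add: power2_eq_square)
  moreover have "\<kappa> / l \<le> \<kappa>" using l_ge kappa_bounds(1) by (simp add: pos_divide_le_eq)
  ultimately have "\<kappa> / l + 31/32 \<le> c" using c two_kappa_le by linarith
  then have "(\<kappa> / l + 31/32) * T \<le> c * T"
    unfolding T_def by (rule mult_right_mono[OF _ total_energy_descent_nonneg])
  moreover have "\<kappa> * (T / (2 * l) + (\<Sum>b\<in>Basis. slack (descent b)) / (2 * l\<^sup>2)) \<le> \<kappa> * (T / (2 * l) + T / (2 * l))"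
    unfolding T_def using kappa_bounds(1) by (intro mult_left_mono add_left_mono dissipation_ge(2)) simp
  ultimately show ?thesis
    by (intro energy_drop[OF defect_trace_ge[OF dim] order_refl]) (simp add: T_def distrib_right)
qed

theorem energy_decay:
  assumes "sqrt (real DIM('e)) * (l * e2) + 1/2 \<le> c"
  shows "2 * x * ((1 / (2 * l) - c * x) * total_energy descent) \<le> total_energy u - total_energy upd"
proof (cases "DIM('e) = 1")
  case True
  then show ?thesis using assms by (intro energy_decay_of_dim_1) (simp_all add: kappa_bounds(4))
next
  case False
  then have "2 \<le> DIM('e)" using DIM_positive[where 'a='e] by linarith
  then show ?thesis using assms by (intro energy_decay_of_dim_2) (simp_all add: kappa_bounds(4))
qed

lemma new_defect_linear: "linear new_defect"
  by (rule linearI) (simp_all add: new_defect_def upd_adj_def upd_def linear_simps algebra_simps)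

lemma new_defect_sym: "new_defect \<xi> \<bullet> \<zeta> = \<xi> \<bullet> new_defect \<zeta>"
  by (simp add: new_defect_def inner_diff_left inner_diff_right upd_adj[symmetric] inner_commute[of _ \<zeta>])
    (simp add: upd_adj[symmetric] inner_commute)

lemma norm_upd_ge_of_dim_1:
  assumes dim: "DIM('e) = 1"
  shows "(norm \<xi>)\<^sup>2 \<le> (norm (upd \<xi>))\<^sup>2"
proof (cases "\<xi> = 0")
  case False
  obtain c where c: "\<And>v. ritz_hat v = c *\<^sub>R v" using linear_dim_1_scale[OF dim operators_linear(8)] by blast
  have "c \<le> l" using ritz_hat_le[of \<xi>] False by (simp add: c)
  then have "x * c \<le> x * l" using x_pos by simp
  then have "0 \<le> (1 - 2 * (x * c)) * (\<xi> \<bullet> defect \<xi>)"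
    using norm_u_ge_of_dim_1[OF dim, of \<xi>] x_bounds(2) by (intro mult_nonneg_nonneg) (simp_all add: inner_defect)
  also have "\<dots> \<le> (norm (upd \<xi>))\<^sup>2 - (norm \<xi>)\<^sup>2"
    unfolding norm_upd c using zero_le_power2[of "norm (G (uh (defect \<xi>)))"]
    by (simp add: inner_defect algebra_simps)
  finally show ?thesis by simp
qed (simp add: linear_0[OF upd_linear])

lemma new_defect_inequality_of_nonneg:
  assumes "\<And>\<xi>. 0 \<le> \<xi> \<bullet> new_defect \<xi>"
  shows "(norm (new_defect \<phi>))\<^sup>2 \<le> d * (\<phi> \<bullet> new_defect \<phi> + defect_weight l * (norm (shifted \<mu> (upd \<phi>)))\<^sup>2)"
proof -
  have "\<xi> \<bullet> new_defect \<xi> \<le> d * (\<xi> \<bullet> \<xi>)" for \<xi>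
    using norm_upd_power2_le[of \<xi>] by (simp add: inner_new_defect d_def left_diff_distrib power2_norm_eq_inner)
  then have "(norm (new_defect \<phi>))\<^sup>2 \<le> d * (\<phi> \<bullet> new_defect \<phi>)"
    by (rule norm_psd_operator_power2_le[OF new_defect_linear new_defect_sym assms _ d_nonneg])
  also have "\<dots> \<le> d * (\<phi> \<bullet> new_defect \<phi> + defect_weight l * (norm (shifted \<mu> (upd \<phi>)))\<^sup>2)"
    using d_nonneg defect_weight_bounds(1)[OF l_ge] by (intro mult_left_mono) simp_all
  finally show ?thesis .
qed

lemma norm_adjoints_le_green_norm:
  defines "b \<equiv> e2 - 9/10 * (real DIM('e) - 1)"
  shows "norm (us v) \<le> sqrt b * green_norm v" "norm (uhs v) \<le> sqrt b * green_norm v"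
proof -
  have b_nonneg: "0 \<le> sqrt b" using e2_ge l_ge DIM_positive[where 'a='e] by (simp add: b_def)
  have lower: "9/10 * (\<xi> \<bullet> \<xi>) \<le> u \<xi> \<bullet> u \<xi>" for \<xi>
    using defect_ge[of \<xi>] by (simp add: inner_defect power2_norm_eq_inner)
  then have lower_uh: "9/10 * (\<xi> \<bullet> \<xi>) \<le> uh \<xi> \<bullet> uh \<xi>" for \<xi>
    by (simp only: uh_inner_uh)
  show "norm (us v) \<le> sqrt b * green_norm v"
    by (rule norm_adjoint_le_green_norm[OF u_in u_adj _ b_nonneg])
      (unfold b_def, rule energy_norm_le_of_norm_ge[OF u_linear u_in total_energy_u_le lower])
  show "norm (uhs v) \<le> sqrt b * green_norm v"
    by (rule norm_adjoint_le_green_norm[OF uh_in uh_adj _ b_nonneg])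
      (unfold b_def, rule energy_norm_le_of_norm_ge[OF uh_linear uh_in total_energy_uh_le lower_uh])
qed

theorem new_defect_inequality:
  assumes mu: "0 \<le> \<mu>" "\<mu> \<le> 1"
  shows "(norm (new_defect \<phi>))\<^sup>2 \<le> d * (\<phi> \<bullet> new_defect \<phi> + defect_weight l * (norm (shifted \<mu> (upd \<phi>)))\<^sup>2)"
proof (cases "DIM('e) = 1")
  case True
  then show ?thesis using norm_upd_ge_of_dim_1 by (intro new_defect_inequality_of_nonneg) (simp add: inner_new_defect)
next
  case False
  define b where "b = e2 - 9/10 * (real DIM('e) - 1)"
  have dim: "2 \<le> real DIM('e)" using False DIM_positive[where 'a='e] by linarith
  have "141/100 \<le> sqrt (real DIM('e))" by (rule real_le_rsqrt) (use dim in \<open>simp add: power2_eq_square\<close>)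
  then have "141/50 * (b + 9/10) \<le> 2 * sqrt (real DIM('e)) * e2"
    using dim l_ge l_le_e2 e2_ge by (intro mult_mono) (simp_all add: b_def)
  then have "141/50 * (b + 9/10) * l\<^sup>2 + l \<le> 2 * sqrt (real DIM('e)) * e2 * l\<^sup>2 + l"
    by (intro add_right_mono mult_right_mono) simp_all
  then have x_b_le: "x * (141/50 * (b + 9/10) * l\<^sup>2 + l) \<le> 1"
    using x_le x_pos by (meson mult_left_mono less_imp_le order_trans)
  have l_le_b: "l \<le> b" using e2_ge dim unfolding b_def by argo
  interpret direction: test_direction G u uh us uhs x l b \<mu> \<phi>
    by unfold_locales
      (use norm_defect_le defect_ge norm_adjoints_le_green_norm[folded b_def] l_le_b mu x_b_le in auto)
  show ?thesis using defect_inequality[OF mu] by (rule direction.new_defect_inequality)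
qed

end

section \<open>Tuples as synthesis operators\<close>

definition synthesis :: "('n::finite \<Rightarrow> 'v::real_vector) \<Rightarrow> real^'n \<Rightarrow> 'v" where
  "synthesis U \<xi> = (\<Sum>i\<in>UNIV. (\<xi> $ i) *\<^sub>R U i)"

definition analysis :: "('n::finite \<Rightarrow> 'v::real_inner) \<Rightarrow> 'v \<Rightarrow> real^'n" where
  "analysis U v = (\<chi> i. U i \<bullet> v)"

definition gram_defect :: "('n::finite \<Rightarrow> 'v::real_inner) \<Rightarrow> real^'n \<Rightarrow> real^'n" where
  "gram_defect U \<xi> = analysis U (synthesis U \<xi>) - \<xi>"

lemma synthesis_linear: "linear (synthesis U)"
  by (rule linearI) (simp_all add: synthesis_def scaleR_add_left sum.distrib scaleR_right.sum)

lemma analysis_linear: "linear (analysis U)"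
  by (rule linearI) (simp_all add: analysis_def vec_eq_iff inner_add_right)

lemma synthesis_adj: "synthesis U \<xi> \<bullet> v = \<xi> \<bullet> analysis U v"
  by (simp add: synthesis_def analysis_def inner_sum_left inner_vec_def)

lemma synthesis_axis: "synthesis U (axis i 1) = U i"
  by (simp add: synthesis_def axis_def if_distrib[of "\<lambda>c. c *\<^sub>R _"] cong: if_cong)

lemma synthesis_in: "subspace H \<Longrightarrow> (\<And>i. U i \<in> H) \<Longrightarrow> synthesis U \<xi> \<in> H"
  by (simp add: synthesis_def subspace_sum subspace_scale)

lemma synthesis_map: "linear f \<Longrightarrow> synthesis (\<lambda>i. f (U i)) \<xi> = f (synthesis U \<xi>)"
  by (simp add: synthesis_def linear_sum linear_scale)

lemma synthesis_eqI:
  assumes "linear f" "\<And>i. U i = f (axis i 1)"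
  shows "synthesis U = f"
proof (rule linear_eq_stdbasis[OF synthesis_linear assms(1)])
  fix b :: "real^'a" assume "b \<in> Basis"
  then obtain i where "b = axis i 1" unfolding Basis_vec_def by auto
  then show "synthesis U b = f b" using assms(2) by (simp add: synthesis_axis)
qed

lemma sum_Basis_axis: "(\<Sum>b\<in>Basis. f b) = (\<Sum>i\<in>UNIV. f (axis i 1))" for f :: "real^'n \<Rightarrow> real"
proof -
  have Basis_eq: "(Basis :: (real^'n) set) = (\<lambda>i. axis i 1) ` UNIV" unfolding Basis_vec_def by auto
  have "inj (\<lambda>i::'n. axis i (1::real))" by (auto simp: inj_def axis_eq_axis)
  then show ?thesis unfolding Basis_eq by (simp add: sum.reindex[unfolded o_def])
qed

lemma gram_defect_linear: "linear (gram_defect U)"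
  unfolding gram_defect_def
  by (intro linear_compose_sub linear_compose[OF synthesis_linear analysis_linear, unfolded o_def] linear_ident)

lemma gram_defect_sym: "gram_defect U \<xi> \<bullet> \<zeta> = \<xi> \<bullet> gram_defect U \<zeta>"
  unfolding gram_defect_def inner_diff_left inner_diff_right by (metis inner_commute synthesis_adj)

lemma inner_gram_defect: "\<xi> \<bullet> gram_defect U \<xi> = (norm (synthesis U \<xi>))\<^sup>2 - (norm \<xi>)\<^sup>2"
  by (simp add: gram_defect_def inner_diff_right power2_norm_eq_inner flip: synthesis_adj)

lemma tmul_eq_synthesis: "tmul U M j = synthesis U (\<chi> i. M $ i $ j)"
  by (simp add: tmul_def synthesis_def)

lemma tmul_gram: "tmul U (gram V W) j = synthesis U (analysis V (W j))"
  by (simp add: tmul_eq_synthesis gram_def analysis_def)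

lemma gram_mult_vec: "gram U U *v \<xi> = analysis U (synthesis U \<xi>)"
  by (simp add: gram_def analysis_def synthesis_def vec_eq_iff matrix_vector_mult_def inner_sum_right mult.commute)

lemma tmul_gram_minus_mat: "tmul U (gram V V - mat 1) j = synthesis U (gram_defect V (axis j 1))"
proof -
  have "(\<chi> i. (gram V V - mat 1) $ i $ j) = gram_defect V (axis j 1)"
    by (simp add: gram_defect_def synthesis_axis vec_eq_iff gram_def analysis_def mat_def) (simp add: axis_def)
  then show ?thesis by (simp add: tmul_eq_synthesis)
qed

lemma A_op_eq:
  assumes "linear G"
  shows "A_op G U V j = G (synthesis U (analysis U (V j))) - synthesis U (analysis U (G (V j)))"
  unfolding A_op_def tmul_gram tG_def by (simp add: synthesis_map[OF assms])

lemma A_op_scaleR: "A_op (\<lambda>v. c *\<^sub>R G v) U V j = c *\<^sub>R A_op G U V j"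
  by (simp add: A_op_def tmul_def tG_def gram_def scaleR_right.sum scaleR_diff_right mult.commute)

lemma tmul_tG_scaleR: "tmul (tG (\<lambda>v. c *\<^sub>R G v) U) M j = c *\<^sub>R tmul (tG G U) M j"
  by (simp add: tmul_def tG_def scaleR_right.sum mult.commute)

lemma finite_eigenvalues:
  fixes f :: "'a::euclidean_space \<Rightarrow> 'a"
  assumes lin: "linear f" and sym: "\<And>v w. f v \<bullet> w = v \<bullet> f w"
  shows "finite {c. \<exists>v. v \<noteq> 0 \<and> f v = c *\<^sub>R v}"
proof -
  obtain B k where B: "orthonormal B" "span B = UNIV" "\<And>b. b \<in> B \<Longrightarrow> f b = k b *\<^sub>R b"
    using spectral_theorem[OF lin sym] by metis
  have "{c. \<exists>v. v \<noteq> 0 \<and> f v = c *\<^sub>R v} \<subseteq> k ` B"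
  proof
    fix c assume "c \<in> {c. \<exists>v. v \<noteq> 0 \<and> f v = c *\<^sub>R v}"
    then obtain v where v: "v \<noteq> 0" "f v = c *\<^sub>R v" by blast
    have "\<exists>b\<in>B. v \<bullet> b \<noteq> 0"
    proof (rule ccontr)
      assume "\<not> ?thesis"
      then have "v \<bullet> v = 0" by (subst orthonormal_parseval[OF B(1,2)]) simp
      then show False using v(1) by simp
    qed
    then obtain b where b: "b \<in> B" "v \<bullet> b \<noteq> 0" by blast
    have "c * (v \<bullet> b) = k b * (v \<bullet> b)" using sym[of v b] v(2) B(3)[OF b(1)] by simp
    then show "c \<in> k ` B" using b by simp
  qed
  then show ?thesis using B(1) by (simp add: orthonormal_def finite_subset)
qed

lemma Max_eigenvalue:
  fixes f :: "'a::euclidean_space \<Rightarrow> 'a"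
  assumes lin: "linear f" and sym: "\<And>v w. f v \<bullet> w = v \<bullet> f w"
  defines "m \<equiv> Max {c. \<exists>v. v \<noteq> 0 \<and> f v = c *\<^sub>R v}"
  shows "v \<bullet> f v \<le> m * (v \<bullet> v)" and "\<exists>e. norm e = 1 \<and> f e = m *\<^sub>R e"
proof -
  obtain b :: 'a where "b \<noteq> 0" using nonempty_Basis nonzero_Basis by blast
  then obtain e k where e: "norm e = 1" "f e = k *\<^sub>R e" and quadratic_le: "\<And>v. v \<bullet> f v \<le> k * (v \<bullet> v)"
    using quadratic_form_max_eigenvector[OF lin sym subspace_UNIV, of b] by auto
  have "m = k"
    unfolding m_def
  proof (rule Max_eqI[OF finite_eigenvalues[OF lin sym]])
    fix c assume "c \<in> {c. \<exists>v. v \<noteq> 0 \<and> f v = c *\<^sub>R v}"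
    then obtain v where "v \<noteq> 0" "f v = c *\<^sub>R v" by blast
    then show "c \<le> k" using quadratic_le[of v] by (simp add: mult_le_cancel_right)
  next
    have "e \<noteq> 0" using e(1) by force
    then show "k \<in> {c. \<exists>v. v \<noteq> 0 \<and> f v = c *\<^sub>R v}" using e(2) by blast
  qed
  then show "v \<bullet> f v \<le> m * (v \<bullet> v)" "\<exists>e. norm e = 1 \<and> f e = m *\<^sub>R e" using e quadratic_le by blast+
qed

lemma lambda_max_gram:
  shows "(norm (synthesis U \<xi>))\<^sup>2 \<le> lambda_max (gram U U) * (norm \<xi>)\<^sup>2"
    and "\<exists>e. norm e = 1 \<and> (norm (synthesis U e))\<^sup>2 = lambda_max (gram U U)"
proof -
  have gram_linear: "linear (\<lambda>\<xi>. gram U U *v \<xi>)" by (rule matrix_vector_mul_linear)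
  have gram_sym: "(gram U U *v \<xi>) \<bullet> \<zeta> = \<xi> \<bullet> (gram U U *v \<zeta>)" for \<xi> \<zeta>
    unfolding gram_mult_vec by (metis inner_commute synthesis_adj)
  note max = Max_eigenvalue[OF gram_linear gram_sym, folded lambda_max_def]
  have norm_eq: "(norm (synthesis U \<xi>))\<^sup>2 = \<xi> \<bullet> (gram U U *v \<xi>)" for \<xi>
    by (simp add: gram_mult_vec power2_norm_eq_inner synthesis_adj)
  show "(norm (synthesis U \<xi>))\<^sup>2 \<le> lambda_max (gram U U) * (norm \<xi>)\<^sup>2"
    using max(1)[of \<xi>] by (simp only: norm_eq power2_norm_eq_inner[of \<xi>])
  show "\<exists>e. norm e = 1 \<and> (norm (synthesis U e))\<^sup>2 = lambda_max (gram U U)"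
    using max(2) by (metis inner_scaleR_right mult.right_neutral norm_eq norm_eq_1)
qed

lemma quasi_stiefel_iff: "quasi_stiefel U \<longleftrightarrow> (\<forall>\<xi>. 0 \<le> \<xi> \<bullet> gram_defect U \<xi>)"
  by (simp add: quasi_stiefel_def psd_def matrix_vector_mult_diff_rdistrib gram_mult_vec gram_defect_def)

section \<open>Admissible tuples\<close>

text \<open>Nonnegativity of the defect is not preserved by the scheme when \<open>N \<ge> 2\<close>. The last clause replaces it: a direction
  in which the defect is negative cannot be close to an eigenvector of \<open>G\<close>.\<close>

definition (in energy_space) admissible :: "real \<Rightarrow> real \<Rightarrow> ('n::finite \<Rightarrow> 'v) \<Rightarrow> bool" where
  "admissible l e2 U \<longleftrightarrow> (\<forall>i. U i \<in> H) \<and> total_energy (synthesis U) \<le> e2 \<and>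
    (\<forall>\<xi>. (norm (synthesis U \<xi>))\<^sup>2 \<le> l * (norm \<xi>)\<^sup>2) \<and>
    (CARD('n) = 1 \<longrightarrow> (\<forall>\<xi>. (norm \<xi>)\<^sup>2 \<le> (norm (synthesis U \<xi>))\<^sup>2)) \<and>
    (\<forall>\<mu> \<xi>. 0 \<le> \<mu> \<longrightarrow> \<mu> \<le> 1 \<longrightarrow> (norm (gram_defect U \<xi>))\<^sup>2
      \<le> (l - 1) * (\<xi> \<bullet> gram_defect U \<xi> + defect_weight l * (norm (shifted \<mu> (synthesis U \<xi>)))\<^sup>2))"

locale tuple_step = energy_space G H a
  for G :: "'v::real_inner \<Rightarrow> 'v" and H :: "'v set" and a :: "'v \<Rightarrow> 'v \<Rightarrow> real" +
  fixes U Uh U' :: "'n::finite \<Rightarrow> 'v" and x l e2 :: real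
  assumes U_admissible: "admissible l e2 U"
    and step_pos: "0 < x" and l_ge_1: "1 \<le> l"
    and Uh_eq: "Uh i = U i + x *\<^sub>R A_op G U (\<lambda>k. (1/2) *\<^sub>R (Uh k + U k)) i"
    and U'_eq: "U' i = Uh i - x *\<^sub>R tmul (tG G Uh) (gram Uh Uh - mat 1) i"
    and e2_lower: "l + (real CARD('n) - 1) \<le> e2"
    and step_le: "x * (2 * sqrt (real CARD('n)) * e2 * l\<^sup>2 + l) \<le> 1"
begin

lemma synthesis_Uh_eq:
  "synthesis Uh \<xi> = synthesis U \<xi> + x *\<^sub>R (G (synthesis U (analysis U ((1/2) *\<^sub>R (synthesis Uh \<xi> + synthesis U \<xi>))))
    - synthesis U (analysis U (G ((1/2) *\<^sub>R (synthesis Uh \<xi> + synthesis U \<xi>)))))" (is "_ = ?f \<xi>")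
proof -
  have "synthesis Uh = ?f"
  proof (rule synthesis_eqI)
    show "linear ?f"
      by (rule linearI) (simp_all add: linear_add[OF synthesis_linear] linear_scale[OF synthesis_linear]
          linear_add[OF analysis_linear] linear_scale[OF analysis_linear] linear_add[OF G_linear]
          linear_scale[OF G_linear] algebra_simps)
    show "Uh i = ?f (axis i 1)" for i
      by (subst Uh_eq) (simp add: A_op_eq[OF G_linear] synthesis_axis)
  qed
  then show ?thesis by (rule fun_cong)
qed

sublocale two_stage G "synthesis U" "synthesis Uh" "analysis U" "analysis Uh" x l
proof (intro two_stage.intro positive_contraction_axioms two_stage_axioms.intro)
  show "(norm (synthesis U \<xi>))\<^sup>2 \<le> l * (norm \<xi>)\<^sup>2" for \<xi> using U_admissible by (simp add: admissible_def)
qed (rule synthesis_linear analysis_linear synthesis_adj step_pos l_ge_1 synthesis_Uh_eq)+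

lemma defect_eq: "defect \<xi> = gram_defect U \<xi>"
  by (simp add: defect_def gram_defect_def)

sublocale scheme_step G "synthesis U" "synthesis Uh" "analysis U" "analysis Uh" x l H a e2
  using U_admissible e2_lower step_le
  by unfold_locales (simp_all add: admissible_def synthesis_in subspace_H defect_eq d_def)

lemma synthesis_U'_eq: "synthesis U' = upd"
proof (rule synthesis_eqI[OF upd_linear])
  have "gram_defect Uh \<xi> = defect \<xi>" for \<xi> by (simp add: gram_defect_def uhs_uh us_u)
  then show "U' i = upd (axis i 1)" for i
    unfolding U'_eq tmul_gram_minus_mat by (simp add: upd_def tG_def synthesis_axis synthesis_map[OF G_linear])
qed

lemma gram_defect_U'_eq: "gram_defect U' \<xi> = new_defect \<xi>"
proof -
  have "\<zeta> \<bullet> analysis U' v = \<zeta> \<bullet> upd_adj v" for \<zeta> v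
    by (simp add: synthesis_U'_eq upd_adj flip: synthesis_adj)
  then have "analysis U' v = upd_adj v" for v by (rule vector_eq_ldot[THEN iffD1, rule_format])
  then show ?thesis by (simp add: gram_defect_def new_defect_def synthesis_U'_eq)
qed

lemma synthesis_A_op_eq: "synthesis (A_op G U U) = descent"
proof (rule synthesis_eqI)
  show "linear descent" by (rule linearI) (simp_all add: descent_def linear_simps)
qed (simp add: A_op_eq[OF G_linear] descent_def skew_def synthesis_axis)

theorem tuple_energy_decay:
  assumes "sqrt (real CARD('n)) * (l * e2) + 1/2 \<le> c"
  shows "2 * x * ((1 / (2 * l) - c * x) * total_energy (synthesis (A_op G U U)))
    \<le> total_energy (synthesis U) - total_energy (synthesis U')"
  using energy_decay assms by (simp add: synthesis_A_op_eq synthesis_U'_eq)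

theorem admissible_U': "admissible l e2 U'"
  unfolding admissible_def
proof (intro conjI allI impI)
  show "U' i \<in> H" for i using upd_in[of "axis i 1"] by (simp add: synthesis_axis flip: synthesis_U'_eq)
  show "total_energy (synthesis U') \<le> e2"
  proof -
    let ?c = "sqrt (real CARD('n)) * (l * e2) + 1/2"
    have "?c * x * (2 * l) \<le> 1" using step_le by (simp add: power2_eq_square algebra_simps)
    then have "0 \<le> 1 / (2 * l) - ?c * x" using l_ge by (simp add: pos_le_divide_eq)
    moreover have "0 \<le> total_energy (synthesis (A_op G U U))"
      unfolding synthesis_A_op_eq by (intro total_energy_nonneg descent_in)
    ultimately have "0 \<le> 2 * x * ((1 / (2 * l) - ?c * x) * total_energy (synthesis (A_op G U U)))"
      using x_pos by (intro mult_nonneg_nonneg) simp_all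
    also note tuple_energy_decay[OF order_refl]
    finally show ?thesis using total_energy_u_le by linarith
  qed
  show "(norm (synthesis U' \<xi>))\<^sup>2 \<le> l * (norm \<xi>)\<^sup>2" for \<xi>
    unfolding synthesis_U'_eq by (rule norm_upd_power2_le)
  show "(norm \<xi>)\<^sup>2 \<le> (norm (synthesis U' \<xi>))\<^sup>2" if "CARD('n) = 1" for \<xi>
    unfolding synthesis_U'_eq by (rule norm_upd_ge_of_dim_1) (simp add: that)
  show "(norm (gram_defect U' \<xi>))\<^sup>2
      \<le> (l - 1) * (\<xi> \<bullet> gram_defect U' \<xi> + defect_weight l * (norm (shifted \<mu> (synthesis U' \<xi>)))\<^sup>2)"
    if "0 \<le> \<mu>" "\<mu> \<le> 1" for \<mu> \<xi>
    unfolding gram_defect_U'_eq synthesis_U'_eq using new_defect_inequality[OF that] by (simp add: d_def)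
qed

end

lemma (in energy_space) admissible_of_quasi_stiefel:
  fixes U :: "'n::finite \<Rightarrow> 'v"
  assumes "\<And>i. U i \<in> H" and "quasi_stiefel U"
  shows "admissible (lambda_max (gram U U)) (total_energy (synthesis U)) U"
    "1 \<le> lambda_max (gram U U)"
    "lambda_max (gram U U) + (real CARD('n) - 1) \<le> total_energy (synthesis U)"
proof -
  define l where "l = lambda_max (gram U U)"
  have nonneg: "0 \<le> \<xi> \<bullet> gram_defect U \<xi>" for \<xi> using assms(2) by (simp add: quasi_stiefel_iff)
  obtain e where e: "norm e = 1" "(norm (synthesis U e))\<^sup>2 = l" using lambda_max_gram(2)[of U] by (auto simp: l_def)
  show l_ge: "1 \<le> lambda_max (gram U U)" using nonneg[of e] e by (simp add: inner_gram_defect l_def)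
  have gram_defect_le: "\<xi> \<bullet> gram_defect U \<xi> \<le> (l - 1) * (\<xi> \<bullet> \<xi>)" for \<xi>
    using lambda_max_gram(1)[of U \<xi>] by (simp add: inner_gram_defect l_def left_diff_distrib power2_norm_eq_inner)
  have "l - 1 \<le> (\<Sum>b\<in>Basis. b \<bullet> gram_defect U b) * (e \<bullet> e)"
    using psd_operator_le_trace[OF gram_defect_linear gram_defect_sym nonneg, of e] e by (simp add: inner_gram_defect)
  also have "\<dots> = (\<Sum>b\<in>Basis. (norm (synthesis U b))\<^sup>2) - real CARD('n)"
    using e(1) by (simp add: inner_gram_defect sum_subtractf norm_eq_1)
  also have "\<dots> \<le> total_energy (synthesis U) - real CARD('n)"
    unfolding total_energy_def power2_norm_eq_inner
    by (intro diff_right_mono sum_mono a_ge synthesis_in subspace_H assms(1))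
  finally show "lambda_max (gram U U) + (real CARD('n) - 1) \<le> total_energy (synthesis U)" by (simp add: l_def)
  have "(norm (gram_defect U \<xi>))\<^sup>2
      \<le> (l - 1) * (\<xi> \<bullet> gram_defect U \<xi> + defect_weight l * (norm (shifted \<mu> (synthesis U \<xi>)))\<^sup>2)" for \<xi> \<mu>
  proof -
    have "(norm (gram_defect U \<xi>))\<^sup>2 \<le> (l - 1) * (\<xi> \<bullet> gram_defect U \<xi>)"
      using l_ge by (intro norm_psd_operator_power2_le[OF gram_defect_linear gram_defect_sym nonneg gram_defect_le]) (simp add: l_def)
    also have "\<dots> \<le> (l - 1) * (\<xi> \<bullet> gram_defect U \<xi> + defect_weight l * (norm (shifted \<mu> (synthesis U \<xi>)))\<^sup>2)"
      using l_ge defect_weight_bounds(1)[of l] by (intro mult_left_mono) (simp_all add: l_def)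
    finally show ?thesis .
  qed
  then show "admissible (lambda_max (gram U U)) (total_energy (synthesis U)) U"
    unfolding admissible_def using assms(1) lambda_max_gram(1)[of U] nonneg by (simp add: inner_gram_defect l_def)
qed

section \<open>Energy decay of the scheme\<close>

locale standing_setting =
  fixes H :: "'v::real_inner set" and a :: "'v \<Rightarrow> 'v \<Rightarrow> real" and G :: "'v \<Rightarrow> 'v" and c\<Omega> lam1 :: real
  assumes standing: "standing H a G c\<Omega> lam1"
begin

lemma H_subspace: "subspace H"
  and form_sym: "v \<in> H \<Longrightarrow> w \<in> H \<Longrightarrow> a v w = a w v"
  and form_add: "v \<in> H \<Longrightarrow> w \<in> H \<Longrightarrow> z \<in> H \<Longrightarrow> a (v + w) z = a v z + a w z"
  and form_scale: "v \<in> H \<Longrightarrow> z \<in> H \<Longrightarrow> a (c *\<^sub>R v) z = c * a v z"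
  and form_nonneg: "v \<in> H \<Longrightarrow> 0 \<le> a v v"
  and poincare: "v \<in> H \<Longrightarrow> norm v \<le> c\<Omega> * sqrt (a v v)"
  and rayleigh: "v \<in> H \<Longrightarrow> lam1 * (v \<bullet> v) \<le> a v v"
  and solution_in: "G v \<in> H"
  and solution: "w \<in> H \<Longrightarrow> a (G v) w = v \<bullet> w"
  using standing unfolding standing_def by blast+

lemma first_eigenvector: obtains e where "e \<in> H" "e \<noteq> 0" "a e e = lam1 * (e \<bullet> e)"
  using standing unfolding standing_def by blast

lemma lam1_lower: "1 \<le> c\<Omega>\<^sup>2 * lam1" and lam1_pos: "0 < lam1"
proof -
  obtain e where e: "e \<in> H" "e \<noteq> 0" "a e e = lam1 * (e \<bullet> e)" by (rule first_eigenvector)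
  have "(norm e)\<^sup>2 \<le> (c\<Omega> * sqrt (a e e))\<^sup>2" using poincare[OF e(1)] by (intro power_mono) simp_all
  then have "1 * (e \<bullet> e) \<le> (c\<Omega>\<^sup>2 * lam1) * (e \<bullet> e)"
    using form_nonneg[OF e(1)] e(3) by (simp add: power2_norm_eq_inner power_mult_distrib)
  then show one_le: "1 \<le> c\<Omega>\<^sup>2 * lam1" by (rule mult_right_le_imp_le) (use e(2) in simp)
  then have "0 < c\<Omega>\<^sup>2 * lam1" by linarith
  then show "0 < lam1" by (simp add: zero_less_mult_iff)
qed

lemma eq_zero_if_form_zero:
  assumes "v \<in> H" "\<And>w. w \<in> H \<Longrightarrow> a v w = 0"
  shows "v = 0"
proof -
  have "lam1 * (v \<bullet> v) \<le> 0" using rayleigh[OF assms(1)] assms(2)[OF assms(1)] by simp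
  then show ?thesis using lam1_pos by (metis inner_gt_zero_iff linorder_not_less mult_pos_pos)
qed

lemma form_diff: "v \<in> H \<Longrightarrow> w \<in> H \<Longrightarrow> z \<in> H \<Longrightarrow> a (v - w) z = a v z - a w z"
  using form_add[of "v - w" w z] H_subspace by (simp add: subspace_diff)

lemma solution_linear: "linear G"
proof (rule linearI)
  note closed = H_subspace[THEN subspace_add] H_subspace[THEN subspace_diff] H_subspace[THEN subspace_scale] solution_in
  have "G (v + w) - (G v + G w) = 0" for v w
    by (rule eq_zero_if_form_zero) (simp_all add: closed form_diff form_add solution inner_add_left)
  then show "G (v + w) = G v + G w" for v w by simp
  have "G (c *\<^sub>R v) - c *\<^sub>R G v = 0" for c v
    by (rule eq_zero_if_form_zero) (simp_all add: closed form_diff form_scale solution)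
  then show "G (c *\<^sub>R v) = c *\<^sub>R G v" for c v by simp
qed

sublocale normalized: energy_space "\<lambda>v. lam1 *\<^sub>R G v" H "\<lambda>v w. a v w / lam1"
proof (intro energy_space.intro positive_contraction.intro energy_space_axioms.intro)
  show "linear (\<lambda>v. lam1 *\<^sub>R G v)" by (intro linear_compose_scale_right solution_linear)
  show "lam1 *\<^sub>R G v \<bullet> w = v \<bullet> lam1 *\<^sub>R G w" for v w
    by (metis form_sym inner_commute inner_scaleR_left inner_scaleR_right solution solution_in)
  show "lam1 *\<^sub>R G v \<bullet> lam1 *\<^sub>R G v \<le> v \<bullet> lam1 *\<^sub>R G v" for v
    using rayleigh[OF solution_in, of v] solution[OF solution_in, of v v] lam1_pos by simp
qed (use H_subspace form_sym form_add form_scale rayleigh solution_in solution lam1_pos in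
    \<open>auto simp: add_divide_distrib pos_le_divide_eq mult.commute subspace_scale\<close>)

lemma tnorm_a_power2:
  assumes "\<And>i. V i \<in> H"
  shows "(tnorm_a a V)\<^sup>2 = lam1 * normalized.total_energy (synthesis V)"
  using assms lam1_pos
  by (simp add: tnorm_a_def mtrace_def gram_a_def normalized.total_energy_def sum_Basis_axis synthesis_axis
      sum_nonneg form_nonneg flip: sum_divide_distrib)

lemma energy_eq: "(\<And>i. V i \<in> H) \<Longrightarrow> energy a V = lam1 / 2 * normalized.total_energy (synthesis V)"
  by (simp add: energy_def tnorm_a_power2)

lemma A_op_in: "(\<And>i. V i \<in> H) \<Longrightarrow> A_op G V V i \<in> H"
  unfolding A_op_eq[OF solution_linear] by (intro subspace_diff H_subspace synthesis_in solution_in)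

lemma total_energy_A_op:
  assumes "\<And>i. V i \<in> H"
  shows "normalized.total_energy (synthesis (A_op (\<lambda>v. lam1 *\<^sub>R G v) V V)) = lam1 * (tnorm_a a (A_op G V V))\<^sup>2"
proof -
  have "synthesis (A_op (\<lambda>v. lam1 *\<^sub>R G v) V V) \<xi> = lam1 *\<^sub>R synthesis (A_op G V V) \<xi>" for \<xi>
    by (simp add: A_op_scaleR synthesis_def scaleR_right.sum mult.commute)
  then show ?thesis
    using assms by (simp add: tnorm_a_power2 A_op_in normalized.total_energy_def normalized.energy.bilinear_simps
        synthesis_in H_subspace sum_distrib_left)
qed

end

locale two_stage_scheme = standing_setting H a G c\<Omega> lam1
  for H :: "'v::real_inner set" and a G c\<Omega> lam1 +
  fixes U Uh :: "nat \<Rightarrow> 'n::finite \<Rightarrow> 'v" and \<tau> :: "nat \<Rightarrow> real" and \<Lambda> E c :: real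
  defines "\<Lambda> \<equiv> lambda_max (gram (U 0) (U 0))" and "E \<equiv> energy a (U 0)"
    and "c \<equiv> 2 * (sqrt 2 * E / lam1 + c\<Omega>^2 * sqrt (E * \<Lambda>)) * sqrt (real CARD('n) * E * \<Lambda>) + 1/2"
  assumes U0_in: "U 0 i \<in> H" and U0: "quasi_stiefel (U 0)"
    and tau_pos: "0 < \<tau> n"
    and stage1: "Uh n = (\<lambda>i. U n i + \<tau> n *\<^sub>R A_op G (U n) (\<lambda>k. (1/2) *\<^sub>R (Uh n k + U n k)) i)"
    and stage2: "U (Suc n) = (\<lambda>i. Uh n i - \<tau> n *\<^sub>R tmul (tG G (Uh n)) (gram (Uh n) (Uh n) - mat 1) i)"
    and tau_small: "\<tau> n < lam1 / (2 * c * \<Lambda>)"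
begin

definition e2 :: real where "e2 = 2 * E / lam1"

lemma e2_eq: "e2 = normalized.total_energy (synthesis (U 0))"
  using lam1_pos U0_in by (simp add: e2_def E_def energy_eq)

lemmas initial = normalized.admissible_of_quasi_stiefel[OF U0_in U0, folded \<Lambda>_def e2_eq]

lemma E_pos: "0 < E"
proof -
  have "0 < e2" using initial(2,3) zero_less_card_finite[where 'a='n] by linarith
  then show ?thesis using lam1_pos by (simp add: e2_def zero_less_divide_iff)
qed

lemma c_ge: "sqrt (real CARD('n)) * (\<Lambda> * e2) + 1/2 \<le> c"
proof -
  let ?s = "sqrt (real CARD('n) * E * \<Lambda>)"
  have "sqrt (E * \<Lambda>) * ?s = sqrt (real CARD('n)) * (sqrt (E * \<Lambda>))\<^sup>2"
    by (simp only: mult.assoc real_sqrt_mult[of "real CARD('n)"] power2_eq_square) (simp only: mult_ac)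
  also have "\<dots> = sqrt (real CARD('n)) * (E * \<Lambda>)" using E_pos initial(2) by simp
  finally have s: "sqrt (E * \<Lambda>) * ?s = sqrt (real CARD('n)) * (E * \<Lambda>)" .
  have "1 / lam1 \<le> c\<Omega>\<^sup>2" using lam1_lower lam1_pos by (simp add: pos_divide_le_eq)
  then have "1 / lam1 * (2 * (sqrt (real CARD('n)) * (E * \<Lambda>))) \<le> c\<Omega>\<^sup>2 * (2 * (sqrt (real CARD('n)) * (E * \<Lambda>)))"
    using E_pos initial(2) by (intro mult_right_mono) simp_all
  also have "\<dots> = 2 * (c\<Omega>\<^sup>2 * sqrt (E * \<Lambda>)) * ?s" unfolding s[symmetric] by simp
  also have "\<dots> \<le> 2 * (sqrt 2 * E / lam1 + c\<Omega>\<^sup>2 * sqrt (E * \<Lambda>)) * ?s"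
    using E_pos lam1_pos initial(2) by (intro mult_right_mono) simp_all
  finally show ?thesis by (simp add: c_def e2_def mult_ac)
qed

lemma step_le: "\<tau> n / lam1 * (2 * sqrt (real CARD('n)) * e2 * \<Lambda>\<^sup>2 + \<Lambda>) \<le> 1"
proof -
  have nonneg: "0 \<le> sqrt (real CARD('n)) * (\<Lambda> * e2)"
    using E_pos lam1_pos initial(2) by (simp add: e2_def)
  then have c_pos: "0 < 2 * c * \<Lambda>" using c_ge initial(2) by (intro mult_pos_pos) linarith+
  have "(2 * sqrt (real CARD('n)) * e2 * \<Lambda>\<^sup>2 + \<Lambda>) = 2 * (sqrt (real CARD('n)) * (\<Lambda> * e2) + 1/2) * \<Lambda>"
    by (simp add: power2_eq_square algebra_simps)
  also have "\<dots> \<le> 2 * c * \<Lambda>" using c_ge initial(2) by (intro mult_right_mono) simp_all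
  finally have "\<tau> n / lam1 * (2 * sqrt (real CARD('n)) * e2 * \<Lambda>\<^sup>2 + \<Lambda>) \<le> \<tau> n / lam1 * (2 * c * \<Lambda>)"
    using tau_pos[of n] lam1_pos by (intro mult_left_mono) simp_all
  also have "\<dots> \<le> 1"
    using tau_small[of n] c_pos lam1_pos by (simp add: pos_less_divide_eq)
  finally show ?thesis .
qed

lemma tuple_step:
  assumes "normalized.admissible \<Lambda> e2 (U n)"
  shows "tuple_step (\<lambda>v. lam1 *\<^sub>R G v) H (\<lambda>v w. a v w / lam1) (U n) (Uh n) (U (Suc n)) (\<tau> n / lam1) \<Lambda> e2"
proof unfold_locales
  show "Uh n i = U n i + (\<tau> n / lam1) *\<^sub>R A_op (\<lambda>v. lam1 *\<^sub>R G v) (U n) (\<lambda>k. (1/2) *\<^sub>R (Uh n k + U n k)) i" for i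
    unfolding A_op_scaleR using lam1_pos fun_cong[OF stage1[of n], of i] by simp
  show "U (Suc n) i = Uh n i - (\<tau> n / lam1) *\<^sub>R tmul (tG (\<lambda>v. lam1 *\<^sub>R G v) (Uh n)) (gram (Uh n) (Uh n) - mat 1) i" for i
    unfolding tmul_tG_scaleR using lam1_pos fun_cong[OF stage2[of n], of i] by simp
qed (use assms tau_pos[of n] lam1_pos initial step_le in simp_all)

lemma admissible: "normalized.admissible \<Lambda> e2 (U n)"
proof (induction n)
  case (Suc n)
  show ?case by (rule tuple_step.admissible_U'[OF tuple_step[OF Suc.IH]])
qed (rule initial(1))

lemma U_in: "U n i \<in> H"
  using admissible[of n] by (simp add: normalized.admissible_def)

theorem energy_decay:
  "energy a (U n) - energy a (U (Suc n)) \<ge> (lam1 / (2 * \<Lambda>) - c * \<tau> n) * \<tau> n * (tnorm_a a (A_op G (U n) (U n)))\<^sup>2"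
proof -
  let ?e = "\<lambda>n. normalized.total_energy (synthesis (U n))" and ?A = "(tnorm_a a (A_op G (U n) (U n)))\<^sup>2"
  have "2 * (\<tau> n / lam1) * ((1 / (2 * \<Lambda>) - c * (\<tau> n / lam1)) * (lam1 * ?A)) \<le> ?e n - ?e (Suc n)"
    using tuple_step.tuple_energy_decay[OF tuple_step[OF admissible] c_ge] by (simp only: total_energy_A_op U_in)
  then have "lam1 / 2 * (2 * (\<tau> n / lam1) * ((1 / (2 * \<Lambda>) - c * (\<tau> n / lam1)) * (lam1 * ?A)))
      \<le> lam1 / 2 * (?e n - ?e (Suc n))"
    using lam1_pos by (intro mult_left_mono) simp_all
  also have "lam1 / 2 * (?e n - ?e (Suc n)) = energy a (U n) - energy a (U (Suc n))"
    by (simp add: energy_eq U_in right_diff_distrib)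
  also have "lam1 / 2 * (2 * (\<tau> n / lam1) * ((1 / (2 * \<Lambda>) - c * (\<tau> n / lam1)) * (lam1 * ?A)))
      = (lam1 / (2 * \<Lambda>) - c * \<tau> n) * \<tau> n * ?A"
    using lam1_pos initial(2) by (simp add: field_simps)
  finally show ?thesis .
qed

end

theorem theorem4p5:
  fixes H :: "'v::real_inner set" and a :: "'v \<Rightarrow> 'v \<Rightarrow> real" and G :: "'v \<Rightarrow> 'v"
    and c\<Omega> lam1 :: real
    and U Uh :: "nat \<Rightarrow> 'n::finite \<Rightarrow> 'v" and \<tau> :: "nat \<Rightarrow> real"
  assumes st: "standing H a G c\<Omega> lam1"
    and U0H: "\<forall>i. U 0 i \<in> H"
    and U0: "quasi_stiefel (U 0)"
    and tau_pos: "\<forall>n. \<tau> n > 0"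
    and stage1: "\<forall>n. Uh n = (\<lambda>i. U n i + \<tau> n *\<^sub>R A_op G (U n) (\<lambda>k. (1/2) *\<^sub>R (Uh n k + U n k)) i)"
    and stage2: "\<forall>n. U (Suc n) = (\<lambda>i. Uh n i - \<tau> n *\<^sub>R tmul (tG G (Uh n)) (gram (Uh n) (Uh n) - mat 1) i)"
    and tau_small: "\<forall>n. \<tau> n < min
        (lam1 / (2 * (2 * (sqrt 2 * energy a (U 0) / lam1
              + c\<Omega>^2 * sqrt (energy a (U 0) * lambda_max (gram (U 0) (U 0))))
            * sqrt (real CARD('n) * energy a (U 0) * lambda_max (gram (U 0) (U 0))) + 1/2)
          * lambda_max (gram (U 0) (U 0))))
        (lam1 / (2 * sqrt (2 * energy a (U 0) * lambda_max (gram (U 0) (U 0)))))"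
  shows "\<forall>n. energy a (U n) - energy a (U (Suc n)) \<ge>
      (lam1 / (2 * lambda_max (gram (U 0) (U 0)))
        - (2 * (sqrt 2 * energy a (U 0) / lam1
              + c\<Omega>^2 * sqrt (energy a (U 0) * lambda_max (gram (U 0) (U 0))))
            * sqrt (real CARD('n) * energy a (U 0) * lambda_max (gram (U 0) (U 0))) + 1/2) * \<tau> n)
      * \<tau> n * (tnorm_a a (A_op G (U n) (U n)))^2"
proof -
  interpret two_stage_scheme H a G c\<Omega> lam1 U Uh \<tau> "lambda_max (gram (U 0) (U 0))" "energy a (U 0)"
    "2 * (sqrt 2 * energy a (U 0) / lam1 + c\<Omega>^2 * sqrt (energy a (U 0) * lambda_max (gram (U 0) (U 0))))
      * sqrt (real CARD('n) * energy a (U 0) * lambda_max (gram (U 0) (U 0))) + 1/2"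
    using tau_small by unfold_locales (rule st U0H[rule_format] U0 tau_pos[rule_format] stage1[rule_format]
      stage2[rule_format] | simp)+
  show ?thesis using energy_decay by blast
qed

end
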